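(* Let $\Omega\subset\mathbb{R}^N$ be a bounded smooth domain, $T>0$, $u_0\in\overline{A_\infty}^{L^2(\partial\Omega)}$, and let $f\in L^1(0,T;L^2(\partial\Omega))$ be nonnegative. Let $u_\infty$ be the solution to $$\begin{cases}f(\cdot,t)-\dfrac{\partial u_\infty}{\partial t}(\cdot,t)\in\partial E_\infty(u_\infty(\cdot,t)), & \text{a.e. } t\in(0,T),\\ u_\infty(\cdot,0)=u_0 & \text{on }\partial\Omega.\end{cases}$$ Then, for a.e. $t\in(0,T)$, $$\int_{\partial\Omega}u_\infty(x,t)\Big(\frac{\partial u_\infty}{\partial t}(x,t)-f(x,t)\Big)d\sigma(x)=\max_{v:\,|v(x)-v(y)|\le d_\Omega(x,y)}\int_{\partial\Omega}v(x)\Big(\frac{\partial u_\infty}{\partial t}(x,t)-f(x,t)\Big)d\sigma(x),$$ where the maximum is over functions $v:\partial\Omega\to\mathbb{R}$ with $|v(x)-v(y)|\le d_\Omega(x,y)$ for all $x,y\in\partial\Omega$; that is, $u_\infty(\cdot,t)$ is a Kantorovich potential for the dual formulation of the Monge-Kantorovich mass transport problem between $f(\cdot,t)\,d\sigma$ and $\frac{\partial u_\infty}{\partial t}(\cdot,t)\,d\sigma$ with cost $d_\Omega$.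
   Context: $\sigma$ is the surface measure on $\partial\Omega$. $A_\infty=\{u\in C(\partial\Omega):\exists\, v:\overline\Omega\to\mathbb{R}\text{ with }|\nabla v|\le1\text{ a.e. in }\Omega,\ v|_{\partial\Omega}=u\}$, where $v$ is understood to be in $W^{1,\infty}(\Omega)$ (continuous representative on $\overline\Omega$). $E_\infty:L^2(\partial\Omega)\to[0,+\infty]$ equals $0$ on $A_\infty$ and $+\infty$ elsewhere. Its subdifferential in $L^2(\partial\Omega)$ is: $g\in\partial E_\infty(u)$ iff $E_\infty(w)-E_\infty(u)\ge\int_{\partial\Omega}g\,(w-u)\,d\sigma$ for all $w\in L^2(\partial\Omega)$. A solution of the evolution problem is a function $u_\infty\in C([0,T];L^2(\partial\Omega))$, locally absolutely continuous on $(0,T)$ with values in $L^2(\partial\Omega)$, satisfying the inclusion for a.e. $t\in(0,T)$ and the initial condition. $d_\Omega(x,y)$ is the infimum of the lengths of curves $\gamma$ inside $\Omega$ (i.e. contained in $\overline\Omega$) with $\gamma(0)=x$, $\gamma(1)=y$. Mass transport: for measures $\mu,\nu$ on $\partial\Omega$ with the same total mass, $C(\mu,\nu)=\min_\theta\int_{\partial\Omega\times\partial\Omega}d_\Omega(x,y)\,d\theta(x,y)$ over measures $\theta$ with first marginal $\mu$ and second marginal $\nu$. Its dual formulation is $C(\mu,\nu)=\max\{\int_{\partial\Omega}v\,(d\mu-d\nu): v:\partial\Omega\to\mathbb{R},\ |v(x)-v(y)|\le d_\Omega(x,y)\ \forall x,y\}$. A Kantorovich potential is a maximizer of this dual problem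 (in particular an admissible $v$). Here $\mu=\frac{\partial u_\infty}{\partial t}(\cdot,t)\,d\sigma$ and $\nu=f(\cdot,t)\,d\sigma$.
   Formalization: The sign in the displayed equality is reversed: both integrals use f − ∂u_∞/∂t in place of ∂u_∞/∂t − f, so u_∞(·,t) is a potential for transport from f dσ to (∂u_∞/∂t) dσ, because the equality as written is false. *)

theory Defs
  imports "HOL-Analysis.Analysis"
begin

section \<open>Smooth functions and smooth bounded domains\<close>

primrec Ck_function :: "nat \<Rightarrow> ('a::euclidean_space \<Rightarrow> real) \<Rightarrow> bool" where
  "Ck_function 0 f \<longleftrightarrow> continuous_on UNIV f"
| "Ck_function (Suc k) f \<longleftrightarrow>
     (\<forall>x. f differentiable (at x)) \<and>
     (\<forall>i\<in>Basis. Ck_function k (\<lambda>x. frechet_derivative f (at x) i))"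

definition smooth_function :: "('a::euclidean_space \<Rightarrow> real) \<Rightarrow> bool" where
  "smooth_function f \<longleftrightarrow> (\<forall>k. Ck_function k f)"

text \<open>Near every boundary point, after a rotation sending the last coordinate axis to the unit
  vector \<open>e\<close>, the domain is the strict epigraph of a smooth function \<open>h\<close> of the remaining
  coordinates. These are the orthogonal projection of \<open>x\<close> to the hyperplane normal to \<open>e\<close>, so
  only the values of \<open>h\<close> on that hyperplane matter.\<close>
definition smooth_bounded_domain :: "'a::euclidean_space set \<Rightarrow> bool" where
  "smooth_bounded_domain \<Omega> \<longleftrightarrow>
     \<Omega> \<noteq> {} \<and> open \<Omega> \<and> connected \<Omega> \<and> bounded \<Omega> \<and>
     (\<forall>p\<in>frontier \<Omega>. \<exists>r>0. \<exists>e h. norm e = 1 \<and> smooth_function h \<and>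
        \<Omega> \<inter> ball p r = {x \<in> ball p r. h (x - (x \<bullet> e) *\<^sub>R e) < x \<bullet> e})"

section \<open>Surface measure\<close>

text \<open>The usual Hausdorff outer measure of dimension \<open>d\<close>, with the factor that makes it agree
  with Lebesgue measure in dimension \<open>d\<close>. Empty covering sets weigh nothing; in dimension 0 a
  nonempty set weighs 1 since \<open>0 ^ 0 = 1\<close>. Boundedness is required because \<open>diameter\<close> is not
  meaningful for unbounded sets.\<close>
definition hausdorff_pre :: "nat \<Rightarrow> real \<Rightarrow> 'a::euclidean_space set \<Rightarrow> ennreal" where
  "hausdorff_pre d \<delta> A =
     (INF C \<in> {C :: nat \<Rightarrow> 'a set. A \<subseteq> (\<Union>i. C i) \<and> (\<forall>i. bounded (C i) \<and> diameter (C i) \<le> \<delta>)}.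
        \<Sum>i. if C i = {} then 0
             else ennreal (unit_ball_vol (real d) * (diameter (C i) / 2) ^ d))"

definition hausdorff_outer :: "nat \<Rightarrow> 'a::euclidean_space set \<Rightarrow> ennreal" where
  "hausdorff_outer d A = (SUP \<delta>\<in>{0<..}. hausdorff_pre d \<delta> A)"

text \<open>\<open>hausdorff_outer d\<close> is a metric outer measure, hence countably additive on the Borel sets, so
  \<open>measure_of\<close> does not fall back to its default value here.\<close>
definition hausdorff_measure :: "nat \<Rightarrow> 'a::euclidean_space measure" where
  "hausdorff_measure d = measure_of UNIV (sets borel) (hausdorff_outer d)"

definition surface_measure :: "'a::euclidean_space set \<Rightarrow> 'a measure" where
  "surface_measure \<Omega> = restrict_space (hausdorff_measure (DIM('a) - 1)) (frontier \<Omega>)"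

section \<open>The space \<open>L\<^sup>2\<close> and curves in it\<close>

text \<open>Elements of \<open>L\<^sup>2\<close> are represented by functions; all notions below are invariant under
  changing a function on a null set.\<close>
definition L2_space :: "'a measure \<Rightarrow> ('a \<Rightarrow> real) set" where
  "L2_space M = {g \<in> borel_measurable M. integrable M (\<lambda>x. (g x)\<^sup>2)}"

definition L2_norm :: "'a measure \<Rightarrow> ('a \<Rightarrow> real) \<Rightarrow> real" where
  "L2_norm M g = sqrt (LINT x|M. (g x)\<^sup>2)"

definition L2_closure :: "'a measure \<Rightarrow> ('a \<Rightarrow> real) set \<Rightarrow> ('a \<Rightarrow> real) set" where
  "L2_closure M S =
     {g \<in> L2_space M. \<forall>\<epsilon>>0. \<exists>w \<in> S \<inter> L2_space M. L2_norm M (\<lambda>x. g x - w x) < \<epsilon>}"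

definition L2_continuous_on :: "'a measure \<Rightarrow> real set \<Rightarrow> (real \<Rightarrow> 'a \<Rightarrow> real) \<Rightarrow> bool" where
  "L2_continuous_on M I u \<longleftrightarrow>
     (\<forall>t\<in>I. u t \<in> L2_space M \<and>
        ((\<lambda>s. L2_norm M (\<lambda>x. u s x - u t x)) \<longlongrightarrow> 0) (at t within I))"

definition L2_abs_continuous_on ::
  "'a measure \<Rightarrow> real \<Rightarrow> real \<Rightarrow> (real \<Rightarrow> 'a \<Rightarrow> real) \<Rightarrow> bool" where
  "L2_abs_continuous_on M a b u \<longleftrightarrow>
     (\<forall>t\<in>{a..b}. u t \<in> L2_space M) \<and>
     (\<forall>\<epsilon>>0. \<exists>\<delta>>0. \<forall>(n::nat) \<alpha> \<beta>.
        (\<forall>i<n. a \<le> \<alpha> i \<and> \<alpha> i \<le> \<beta> i \<and> \<beta> i \<le> b) \<and>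
        disjoint_family_on (\<lambda>i. {\<alpha> i<..<\<beta> i}) {..<n} \<and>
        (\<Sum>i<n. \<beta> i - \<alpha> i) < \<delta> \<longrightarrow>
        (\<Sum>i<n. L2_norm M (\<lambda>x. u (\<beta> i) x - u (\<alpha> i) x)) < \<epsilon>)"

definition has_L2_derivative ::
  "'a measure \<Rightarrow> (real \<Rightarrow> 'a \<Rightarrow> real) \<Rightarrow> ('a \<Rightarrow> real) \<Rightarrow> real \<Rightarrow> bool" where
  "has_L2_derivative M u D t \<longleftrightarrow> D \<in> L2_space M \<and>
     ((\<lambda>h. L2_norm M (\<lambda>x. (u (t + h) x - u t x) / h - D x)) \<longlongrightarrow> 0) (at 0)"

text \<open>Bochner integrability over \<open>(0,T)\<close>: the function is an almost everywhere limit in \<open>L\<^sup>2\<close> of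
  simple functions and its norm is integrable.\<close>
definition L2_simple :: "'a measure \<Rightarrow> (real \<Rightarrow> 'a \<Rightarrow> real) \<Rightarrow> bool" where
  "L2_simple M s \<longleftrightarrow>
     (\<exists>(n::nat) B g. (\<forall>i<n. B i \<in> sets lebesgue \<and> g i \<in> L2_space M) \<and>
        s = (\<lambda>t x. \<Sum>i<n. indicator (B i) t * g i x))"

definition L1_L2_space :: "'a measure \<Rightarrow> real \<Rightarrow> (real \<Rightarrow> 'a \<Rightarrow> real) set" where
  "L1_L2_space M T = {f.
     (AE t in lebesgue_on {0<..<T}. f t \<in> L2_space M) \<and>
     (\<exists>s. (\<forall>k::nat. L2_simple M (s k)) \<and>
        (AE t in lebesgue_on {0<..<T}. (\<lambda>k. L2_norm M (\<lambda>x. s k t x - f t x)) \<longlonglongrightarrow> 0)) \<and>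
     integrable (lebesgue_on {0<..<T}) (\<lambda>t. L2_norm M (f t))}"

definition L2_subdifferential ::
  "'a measure \<Rightarrow> (('a \<Rightarrow> real) \<Rightarrow> ereal) \<Rightarrow> ('a \<Rightarrow> real) \<Rightarrow> ('a \<Rightarrow> real) set" where
  "L2_subdifferential M E u = {g \<in> L2_space M.
     \<forall>w\<in>L2_space M. E w - E u \<ge> ereal (LINT x|M. g x * (w x - u x))}"

section \<open>The set \<open>A\<^sub>\<infinity>\<close> and the functional \<open>E\<^sub>\<infinity>\<close>\<close>

definition test_function :: "'a::euclidean_space set \<Rightarrow> ('a \<Rightarrow> real) \<Rightarrow> bool" where
  "test_function \<Omega> \<phi> \<longleftrightarrow> smooth_function \<phi> \<and>
     compact (closure {x. \<phi> x \<noteq> 0}) \<and> closure {x. \<phi> x \<noteq> 0} \<subseteq> \<Omega>"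

definition Linf_on :: "'a::euclidean_space set \<Rightarrow> ('a \<Rightarrow> 'b::real_normed_vector) set" where
  "Linf_on \<Omega> = {v \<in> borel_measurable (lebesgue_on \<Omega>).
     \<exists>C. AE x in lebesgue_on \<Omega>. norm (v x) \<le> C}"

text \<open>Used only for \<open>v\<close> and \<open>G\<close> in \<open>L\<^sup>\<infinity>\<close> of a bounded set, so that all the integrals exist.\<close>
definition weak_gradient :: "'a::euclidean_space set \<Rightarrow> ('a \<Rightarrow> real) \<Rightarrow> ('a \<Rightarrow> 'a) \<Rightarrow> bool" where
  "weak_gradient \<Omega> v G \<longleftrightarrow> (\<forall>\<phi>. test_function \<Omega> \<phi> \<longrightarrow> (\<forall>i\<in>Basis.
     (LINT x|lebesgue_on \<Omega>. v x * frechet_derivative \<phi> (at x) i) =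
     - (LINT x|lebesgue_on \<Omega>. (G x \<bullet> i) * \<phi> x)))"

definition W1inf_with_gradient ::
  "'a::euclidean_space set \<Rightarrow> ('a \<Rightarrow> real) \<Rightarrow> ('a \<Rightarrow> 'a) \<Rightarrow> bool" where
  "W1inf_with_gradient \<Omega> v G \<longleftrightarrow> v \<in> Linf_on \<Omega> \<and> G \<in> Linf_on \<Omega> \<and> weak_gradient \<Omega> v G"

definition A_inf :: "'a::euclidean_space set \<Rightarrow> ('a \<Rightarrow> real) set" where
  "A_inf \<Omega> = {u. continuous_on (frontier \<Omega>) u \<and>
     (\<exists>v G. continuous_on (closure \<Omega>) v \<and> W1inf_with_gradient \<Omega> v G \<and>
        (AE x in lebesgue_on \<Omega>. norm (G x) \<le> 1) \<and> (\<forall>x\<in>frontier \<Omega>. v x = u x))}"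

definition E_inf :: "'a::euclidean_space set \<Rightarrow> ('a \<Rightarrow> real) \<Rightarrow> ereal" where
  "E_inf \<Omega> u =
     (if \<exists>w\<in>A_inf \<Omega>. AE x in surface_measure \<Omega>. u x = w x then 0 else \<infinity>)"

text \<open>\<open>u\<close> solves the evolution problem with source \<open>f\<close> and initial datum \<open>u\<^sub>0\<close>, and \<open>u'\<close> is its
  time derivative.\<close>
definition evolution_solution ::
  "'a::euclidean_space set \<Rightarrow> real \<Rightarrow> (real \<Rightarrow> 'a \<Rightarrow> real) \<Rightarrow> ('a \<Rightarrow> real) \<Rightarrow>
   (real \<Rightarrow> 'a \<Rightarrow> real) \<Rightarrow> (real \<Rightarrow> 'a \<Rightarrow> real) \<Rightarrow> bool" where
  "evolution_solution \<Omega> T f u\<^sub>0 u u' \<longleftrightarrow>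
     L2_continuous_on (surface_measure \<Omega>) {0..T} u \<and>
     (\<forall>a b. 0 < a \<and> a \<le> b \<and> b < T \<longrightarrow> L2_abs_continuous_on (surface_measure \<Omega>) a b u) \<and>
     (AE t in lebesgue_on {0<..<T}.
        has_L2_derivative (surface_measure \<Omega>) u (u' t) t \<and>
        (\<lambda>x. f t x - u' t x) \<in> L2_subdifferential (surface_measure \<Omega>) (E_inf \<Omega>) (u t)) \<and>
     (AE x in surface_measure \<Omega>. u 0 x = u\<^sub>0 x)"

section \<open>Intrinsic distance and Kantorovich potentials\<close>

definition curve_length :: "(real \<Rightarrow> 'a::metric_space) \<Rightarrow> ennreal" where
  "curve_length g =
     (SUP (n, s) \<in> {(n::nat, s::nat \<Rightarrow> real).
          (\<forall>i\<le>n. s i \<in> {0..1}) \<and> (\<forall>i<n. s i \<le> s (Suc i))}.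
        \<Sum>i<n. ennreal (dist (g (s i)) (g (s (Suc i)))))"

definition domain_dist :: "'a::euclidean_space set \<Rightarrow> 'a \<Rightarrow> 'a \<Rightarrow> ennreal" where
  "domain_dist \<Omega> x y =
     (INF g \<in> {g. path g \<and> path_image g \<subseteq> closure \<Omega> \<and> pathstart g = x \<and> pathfinish g = y}.
        curve_length g)"

text \<open>Only the values of \<open>v\<close> on the boundary matter.\<close>
definition dual_admissible :: "'a::euclidean_space set \<Rightarrow> ('a \<Rightarrow> real) set" where
  "dual_admissible \<Omega> =
     {v. \<forall>x\<in>frontier \<Omega>. \<forall>y\<in>frontier \<Omega>. ennreal \<bar>v x - v y\<bar> \<le> domain_dist \<Omega> x y}"

text \<open>A maximizer of the dual problem for the transport of \<open>\<mu>\<close> to \<open>\<nu>\<close>, which are finite measures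
  on the boundary with the same total mass. The order matters: exchanging \<open>\<mu>\<close> and \<open>\<nu>\<close> replaces
  potentials by their negatives. A solution of the evolution problem is a potential from
  \<open>f \<sigma>\<close> to \<open>u' \<sigma>\<close>, since \<open>f - u'\<close> lies in the subdifferential of an indicator functional at \<open>u\<close>.\<close>
definition kantorovich_potential ::
  "'a::euclidean_space set \<Rightarrow> 'a measure \<Rightarrow> 'a measure \<Rightarrow> ('a \<Rightarrow> real) \<Rightarrow> bool" where
  "kantorovich_potential \<Omega> \<mu> \<nu> v \<longleftrightarrow>
     finite_measure \<mu> \<and> finite_measure \<nu> \<and> measure \<mu> (space \<mu>) = measure \<nu> (space \<nu>) \<and>
     v \<in> dual_admissible \<Omega> \<and>
     (\<forall>w\<in>dual_admissible \<Omega>.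
        (LINT x|\<mu>. w x) - (LINT x|\<nu>. w x) \<le> (LINT x|\<mu>. v x) - (LINT x|\<nu>. v x))"

definition is_maximum :: "real \<Rightarrow> real set \<Rightarrow> bool" where
  "is_maximum m S \<longleftrightarrow> m \<in> S \<and> (\<forall>s\<in>S. s \<le> m)"

end

theory Submission
  imports Defs "HOL-Complex_Analysis.Great_Picard"
begin

text \<open>Since \<open>E\<^sub>\<infinity>\<close> is an indicator functional, the inclusion says that \<open>u(t)\<close> lies in \<open>A\<^sub>\<infinity>\<close> (almost
  everywhere) and \<open>\<integral> (f - u') (w - u) \<le> 0\<close> for all \<open>w \<in> A\<^sub>\<infinity>\<close>. What has to be compared is \<open>A\<^sub>\<infinity>\<close> with
  the set of functions that are 1-Lipschitz for \<open>d\<^sub>\<Omega>\<close>. Mollification shows that a function with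
  \<open>|\<nabla>v| \<le> 1\<close> is 1-Lipschitz on segments in \<open>\<Omega>\<close>, hence along curves in the closure, which boundary
  charts allow to be pushed inside. Conversely, a 1-Lipschitz \<open>w\<close> is a pointwise bounded limit on the
  boundary of elements of \<open>A\<^sub>\<infinity>\<close>, which suffices for the inequality and avoids Rademacher's theorem:
  take the inf-convolution of \<open>w\<close> with the intrinsic distance of a small neighbourhood of the closure
  and mollify it. The sign of \<open>u'\<close> comes from testing with \<open>max (u(t - h)) (u(t))\<close>, and equality of
  the masses from testing with \<open>u \<plusminus> 1\<close>.\<close>

section \<open>Smooth bump functions\<close>

text \<open>Besides letting curves be pushed inside, the boundary charts serve twice more. They
  bound \<open>domain_dist\<close> locally by a multiple of the Euclidean distance, so that the
  competitors in the maximum, of which no measurability is assumed, are continuous and hence square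
  integrable. They also make the surface measure finite, so that f - u' is integrable and the
  variational inequality survives bounded pointwise limits. The inf-convolution is taken in a
  neighbourhood because the mollifier averages over full balls around points of the closure, and the
  Lipschitz constant must remain exactly 1 there. The price is that curves may leave the closure, so
  the inf-convolution can lie strictly below w on the boundary. That this loss disappears as the
  neighbourhood shrinks is proved by compactness of curves, without a rate, and so the convergence
  is only pointwise. The sign of u' has to be settled before potentials can be discussed, since a
  density enters a measure through \<open>ennreal\<close>, which truncates negative values.\<close>

lemma Ck_function_SucI:
  assumes "\<And>x. (f has_derivative f' x) (at x)"
    and "\<And>i. i \<in> Basis \<Longrightarrow> Ck_function k (\<lambda>x. f' x i)"
  shows "Ck_function (Suc k) f"
proof -
  have "frechet_derivative f (at x) = f' x" for x
    using frechet_derivative_at[OF assms(1)] by simp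
  then show ?thesis
    using assms by (auto simp: differentiable_def)
qed

lemma Ck_function_has_derivative:
  assumes "Ck_function (Suc k) f"
  shows "(f has_derivative frechet_derivative f (at x)) (at x)"
  using assms by (auto simp flip: frechet_derivative_works)

section \<open>Closure properties of the classes of k times continuously differentiable
  functions\<close>

lemma Ck_function_Suc_imp: "Ck_function (Suc k) f \<Longrightarrow> Ck_function k f"
proof (induction k arbitrary: f)
  case 0
  then show ?case
    by (auto intro!: continuous_at_imp_continuous_on differentiable_imp_continuous_within)
next
  case (Suc k)
  then show ?case by (metis Ck_function.simps(2))
qed

lemma Ck_function_const: "Ck_function k (\<lambda>x. c)"
  by (induction k arbitrary: c) (auto simp: frechet_derivative_const)

lemma Ck_function_inner: "Ck_function k (\<lambda>x. x \<bullet> b)"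
proof (cases k)
  case (Suc m)
  show ?thesis unfolding Suc
    by (rule Ck_function_SucI[where f'="\<lambda>_ h. h \<bullet> b"])
      (auto intro!: derivative_eq_intros Ck_function_const)
qed (auto intro!: continuous_intros)

lemma Ck_function_add: "Ck_function k f \<Longrightarrow> Ck_function k g \<Longrightarrow> Ck_function k (\<lambda>x. f x + g x)"
proof (induction k arbitrary: f g)
  case (Suc k)
  note D = Ck_function_has_derivative[OF Suc.prems(1)] Ck_function_has_derivative[OF Suc.prems(2)]
  show ?case
    by (rule Ck_function_SucI[OF has_derivative_add[OF D]]) (use Suc in auto)
qed (auto intro!: continuous_intros)

lemma Ck_function_mult: "Ck_function k f \<Longrightarrow> Ck_function k g \<Longrightarrow> Ck_function k (\<lambda>x. f x * g x)"
proof (induction k arbitrary: f g)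
  case (Suc k)
  note D = Ck_function_has_derivative[OF Suc.prems(1)] Ck_function_has_derivative[OF Suc.prems(2)]
  show ?case
  proof (rule Ck_function_SucI[OF has_derivative_mult[OF D]])
    fix i :: 'a assume "i \<in> Basis"
    then show "Ck_function k (\<lambda>x. f x * frechet_derivative g (at x) i + frechet_derivative f (at x) i * g x)"
      using Suc.prems Ck_function_Suc_imp[OF Suc.prems(1)] Ck_function_Suc_imp[OF Suc.prems(2)]
      by (intro Ck_function_add Suc.IH) auto
  qed
qed (auto intro!: continuous_intros)

lemma Ck_function_affine:
  fixes f :: "'a::euclidean_space \<Rightarrow> real"
  shows "Ck_function k f \<Longrightarrow> Ck_function k (\<lambda>x. f (c + a *\<^sub>R x))"
proof (induction k arbitrary: f)
  case 0
  then show ?case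
    by (auto intro!: continuous_on_compose2[of UNIV f] continuous_intros)
next
  case (Suc k)
  have "((\<lambda>x. f (c + a *\<^sub>R x)) has_derivative
      (\<lambda>h. a * frechet_derivative f (at (c + a *\<^sub>R x)) h)) (at x)" for x
  proof -
    have D: "(f has_derivative frechet_derivative f (at (c + a *\<^sub>R x))) (at (c + a *\<^sub>R x))"
      by (rule Ck_function_has_derivative[OF Suc.prems])
    have "((\<lambda>x. f (c + a *\<^sub>R x)) has_derivative
        (\<lambda>h. frechet_derivative f (at (c + a *\<^sub>R x)) (a *\<^sub>R h))) (at x)"
      by (rule has_derivative_compose[where f="\<lambda>x. c + a *\<^sub>R x" and g=f, OF _ D])
        (auto intro!: derivative_eq_intros)
    then show ?thesis
      using linear_scale[OF has_derivative_linear[OF D]] by simp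
  qed
  then show ?case
    by (rule Ck_function_SucI) (use Suc in \<open>auto intro!: Ck_function_mult Ck_function_const\<close>)
qed

text \<open>The classical function is \<open>flat 0\<close>. The power of s in the denominator makes
  the family closed under differentiation up to linear combinations, so smoothness follows by one
  induction that treats all k simultaneously.\<close>

definition flat :: "nat \<Rightarrow> real \<Rightarrow> real" where
  "flat k s = (if s \<le> 0 then 0 else exp (- (1 / s)) / s ^ k)"

lemma flat_nonneg: "0 \<le> flat k s"
  by (simp add: flat_def)

lemma flat_tendsto_0: "((flat k) \<longlongrightarrow> 0) (at 0)"
proof -
  have "((\<lambda>s::real. inverse s ^ k / exp (inverse s)) \<longlongrightarrow> 0) (at_right 0)"
    using tendsto_power_div_exp_0 filterlim_inverse_at_top_right by (rule filterlim_compose)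
  then have "(flat k \<longlongrightarrow> 0) (at_right 0)"
    by (rule Lim_transform_eventually)
      (auto simp: eventually_at_filter flat_def exp_minus divide_simps power_inverse)
  moreover have "(flat k \<longlongrightarrow> 0) (at_left 0)"
    by (rule Lim_transform_eventually[of "\<lambda>_. 0"]) (auto simp: eventually_at_filter flat_def)
  ultimately show ?thesis
    using filterlim_split_at by blast
qed

lemma flat_has_real_derivative:
  "(flat k has_real_derivative flat (k + 2) s - real k * flat (k + 1) s) (at s)"
proof (cases s "0::real" rule: linorder_cases)
  case less
  have "((\<lambda>_. 0) has_real_derivative 0) (at s)" by simp
  then have "(flat k has_real_derivative 0) (at s)"
    by (rule has_field_derivative_transform_within_open[of _ _ _ "{..<0}"])
      (use less in \<open>auto simp: flat_def\<close>)
  then show ?thesis using less by (simp add: flat_def)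
next
  case equal
  \<comment> \<open>For h \<noteq> 0 the difference quotient at 0 is \<open>flat (Suc k) h\<close>:
    dividing by h raises the exponent by one.\<close>
  have "(\<lambda>h. (flat k (0 + h) - flat k 0) / h) \<midarrow>0\<rightarrow> 0"
    using flat_tendsto_0[of "Suc k"]
    by (rule Lim_transform_eventually) (auto simp: eventually_at_filter flat_def)
  then show ?thesis using equal by (simp add: DERIV_def flat_def)
next
  case greater
  \<comment> \<open>Both sides vanish for k = 0, so the truncated subtraction in the exponent is
    harmless.\<close>
  have k: "real k * s ^ (k - Suc 0) = real k * s ^ k / s"
    using greater by (cases k) auto
  have "((\<lambda>s. exp (- (1 / s)) / s ^ k) has_real_derivative
      (exp (- (1 / s)) * (1 / s\<^sup>2) * s ^ k - exp (- (1 / s)) * (real k * s ^ (k - Suc 0))) / (s ^ k * s ^ k)) (at s)"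
    using greater by (auto intro!: derivative_eq_intros simp: power2_eq_square)
  also have "(exp (- (1 / s)) * (1 / s\<^sup>2) * s ^ k - exp (- (1 / s)) * (real k * s ^ (k - Suc 0))) / (s ^ k * s ^ k)
      = flat (k + 2) s - real k * flat (k + 1) s"
    unfolding k using greater by (simp add: flat_def field_simps power2_eq_square)
  finally have "((\<lambda>s. exp (- (1 / s)) / s ^ k) has_real_derivative
      flat (k + 2) s - real k * flat (k + 1) s) (at s)" .
  then show ?thesis
    by (rule has_field_derivative_transform_within_open[of _ _ _ "{0<..}"])
      (use greater in \<open>auto simp: flat_def\<close>)
qed

lemma Ck_function_flat: "Ck_function n (\<lambda>x::'a::euclidean_space. flat k (1 - x \<bullet> x))"
proof (induction n arbitrary: k)
  case 0
  have "isCont (flat k) s" for s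
    using flat_has_real_derivative DERIV_isCont by blast
  then have "isCont (\<lambda>x::'a. flat k (1 - x \<bullet> x)) x" for x
    by (intro continuous_at_compose[of _ "\<lambda>x. 1 - x \<bullet> x" "flat k", unfolded o_def] continuous_intros)
  then show ?case
    by (simp add: continuous_at_imp_continuous_on)
next
  case (Suc n)
  have *: "((\<lambda>x::'a. flat k (1 - x \<bullet> x)) has_derivative
      (\<lambda>h. (flat (k + 2) (1 - x \<bullet> x) + (- real k) * flat (k + 1) (1 - x \<bullet> x)) * (-2 * (h \<bullet> x)))) (at x)" for x
  proof -
    have D: "((\<lambda>x::'a. 1 - x \<bullet> x) has_derivative (\<lambda>h. -2 * (h \<bullet> x))) (at x)"
      by (auto intro!: derivative_eq_intros simp: inner_commute)
    have "(flat k has_derivative (*) (flat (k + 2) (1 - x \<bullet> x) + (- real k) * flat (k + 1) (1 - x \<bullet> x))) (at (1 - x \<bullet> x))"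
      using flat_has_real_derivative[of k "1 - x \<bullet> x"] unfolding has_field_derivative_def by simp
    from has_derivative_compose[OF D this] show ?thesis .
  qed
  have "Ck_function n (\<lambda>x. i \<bullet> x)" for i :: 'a
    using Ck_function_inner[of n i] by (simp add: inner_commute)
  then show ?case
    by (intro Ck_function_SucI[OF *] Ck_function_mult Ck_function_add Ck_function_const Suc.IH)
qed

section \<open>Mollification\<close>

lemma Ck_function_continuous_on: "Ck_function k f \<Longrightarrow> continuous_on S f"
proof (induction k)
  case 0
  then show ?case using continuous_on_subset by auto
next
  case (Suc k)
  then show ?case using Ck_function_Suc_imp by blast
qed

text \<open>\<open>Ck_function\<close> gives continuity of the partial derivatives only, so each of
  them is bounded on S and C is the sum of these bounds over \<open>Basis\<close>.\<close>

lemma frechet_derivative_bounded_on_compact: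
  fixes \<rho> :: "'a::euclidean_space \<Rightarrow> real"
  assumes "Ck_function (Suc 0) \<rho>" and "compact S"
  obtains C where "0 \<le> C" "\<And>x h. x \<in> S \<Longrightarrow> \<bar>frechet_derivative \<rho> (at x) h\<bar> \<le> C * norm h"
proof -
  have "\<exists>B\<ge>0. \<forall>x\<in>S. \<bar>frechet_derivative \<rho> (at x) i\<bar> \<le> B" if "i \<in> Basis" for i
  proof -
    have "continuous_on S (\<lambda>x. frechet_derivative \<rho> (at x) i)"
      using assms that by (auto intro: continuous_on_subset)
    then have "bounded ((\<lambda>x. frechet_derivative \<rho> (at x) i) ` S)"
      using assms by (intro compact_imp_bounded compact_continuous_image)
    then show ?thesis
      unfolding bounded_pos by (metis imageI less_imp_le real_norm_def)
  qed
  then obtain B where B: "\<And>i x. i \<in> Basis \<Longrightarrow> x \<in> S \<Longrightarrow> \<bar>frechet_derivative \<rho> (at x) i\<bar> \<le> B i"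
    and B0: "\<And>i. i \<in> Basis \<Longrightarrow> 0 \<le> B i"
    by metis
  show thesis
  proof
    show "0 \<le> sum B Basis" using B0 by (simp add: sum_nonneg)
    fix x h assume x: "x \<in> S"
    have lin: "linear (frechet_derivative \<rho> (at x))"
      using Ck_function_has_derivative[OF assms(1)] has_derivative_linear by blast
    have "frechet_derivative \<rho> (at x) h = (\<Sum>i\<in>Basis. (h \<bullet> i) * frechet_derivative \<rho> (at x) i)"
      using linear_sum[OF lin, of "\<lambda>i. (h \<bullet> i) *\<^sub>R i" Basis] linear_scale[OF lin]
      by (simp add: euclidean_representation)
    also have "\<bar>\<dots>\<bar> \<le> (\<Sum>i\<in>Basis. norm h * B i)"
      using B[OF _ x] Basis_le_norm
      by (intro order_trans[OF sum_abs] sum_mono) (auto simp: abs_mult intro!: mult_mono)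
    also have "\<dots> = sum B Basis * norm h"
      by (simp add: sum_distrib_left mult.commute)
    finally show "\<bar>frechet_derivative \<rho> (at x) h\<bar> \<le> sum B Basis * norm h" .
  qed
qed

lemma frechet_derivative_bounded:
  fixes \<rho> :: "'a::euclidean_space \<Rightarrow> real"
  assumes "Ck_function (Suc 0) \<rho>" and zero: "\<And>x. x \<notin> S \<Longrightarrow> \<rho> x = 0" and S: "compact S"
  obtains C where "0 \<le> C" "\<And>x h. \<bar>frechet_derivative \<rho> (at x) h\<bar> \<le> C * norm h"
proof -
  obtain C where "0 \<le> C" and C: "\<And>x h. x \<in> S \<Longrightarrow> \<bar>frechet_derivative \<rho> (at x) h\<bar> \<le> C * norm h"
    using frechet_derivative_bounded_on_compact[OF assms(1) S] by blast
  moreover have "frechet_derivative \<rho> (at x) h = 0" if "x \<notin> S" for x h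
  proof -
    have "((\<lambda>_. 0) has_derivative (\<lambda>_. 0)) (at x)" by simp
    then have "(\<rho> has_derivative (\<lambda>_. 0)) (at x)"
      by (rule has_derivative_transform_within_open[of _ _ _ _ "- S"])
        (use that S zero in \<open>auto simp: compact_imp_closed open_Compl\<close>)
    then show ?thesis by (metis frechet_derivative_at)
  qed
  ultimately show thesis
    using that by (metis abs_zero mult_nonneg_nonneg norm_ge_zero)
qed

lemma kernel_bounded:
  fixes \<rho> :: "'a::euclidean_space \<Rightarrow> real"
  assumes "Ck_function k \<rho>" and "\<And>x. x \<notin> S \<Longrightarrow> \<rho> x = 0" and "compact S"
  obtains B where "0 \<le> B" "\<And>x. \<bar>\<rho> x\<bar> \<le> B"
proof -
  have "bounded (\<rho> ` S)"
    using assms Ck_function_continuous_on by (intro compact_imp_bounded compact_continuous_image) auto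
  then obtain B where "0 < B" "\<And>x. x \<in> S \<Longrightarrow> \<bar>\<rho> x\<bar> \<le> B"
    unfolding bounded_pos by auto
  then show thesis using that[of B] assms(2) by (metis abs_zero less_imp_le)
qed

text \<open>Differentiation under the integral sign against a weight W. By the mean value theorem
  the difference quotients of k are bounded by C, so \<open>\<bar>W y\<bar> * C\<close> dominates;
  measurability of the derivative comes with it, as a limit of difference quotients.\<close>

lemma has_real_derivative_integral:
  fixes k k' :: "real \<Rightarrow> 'b \<Rightarrow> real"
  assumes W: "integrable M W"
    and D: "\<And>s y. y \<in> space M \<Longrightarrow> ((\<lambda>s. k s y) has_real_derivative k' s y) (at s)"
    and C: "\<And>s y. y \<in> space M \<Longrightarrow> \<bar>k' s y\<bar> \<le> C"
    and meas[measurable]: "\<And>s. k s \<in> borel_measurable M"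
    and int: "\<And>s. integrable M (\<lambda>y. W y * k s y)"
  shows "((\<lambda>s. LINT y|M. W y * k s y) has_real_derivative (LINT y|M. W y * k' s y)) (at s)"
    and "integrable M (\<lambda>y. W y * k' s y)"
proof -
  have [measurable]: "W \<in> borel_measurable M" using W by auto
  have quot: "(\<lambda>n. (k (s + X n) y - k s y) / X n) \<longlonglongrightarrow> k' s y"
    if "y \<in> space M" "\<And>n. X n \<noteq> 0" "X \<longlonglongrightarrow> 0" for X y
    using D[OF that(1), of s] that(2,3) unfolding DERIV_def tendsto_at_iff_sequentially
    by (auto simp: o_def)
  have [measurable]: "k' s \<in> borel_measurable M"
    by (rule borel_measurable_LIMSEQ_real[where u="\<lambda>n y. (k (s + inverse (real (Suc n))) y - k s y) / inverse (real (Suc n))"])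
      (use quot[of _ "\<lambda>n. inverse (real (Suc n))"] LIMSEQ_inverse_real_of_nat in auto)
  have lip: "\<bar>k (s + h) y - k s y\<bar> \<le> C * \<bar>h\<bar>" if "y \<in> space M" for h y
    using field_differentiable_bound[of UNIV "\<lambda>s. k s y" "\<lambda>s. k' s y" C "s + h" s] D C that
    by auto
  have "integrable M (\<lambda>y. W y * k' s y) \<and>
      (\<lambda>n. (LINT y|M. W y * ((k (s + X n) y - k s y) / X n))) \<longlonglongrightarrow> (LINT y|M. W y * k' s y)"
    if X: "\<And>n. X n \<noteq> 0" "X \<longlonglongrightarrow> 0" for X
  proof -
    have "AE y in M. (\<lambda>n. W y * ((k (s + X n) y - k s y) / X n)) \<longlonglongrightarrow> W y * k' s y"
      using quot[of _ X] X by (intro AE_I2 tendsto_mult_left) auto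
    moreover have "AE y in M. norm (W y * ((k (s + X n) y - k s y) / X n)) \<le> \<bar>W y\<bar> * C" for n
      using X lip by (intro AE_I2) (auto simp: abs_mult divide_le_eq mult.assoc intro!: mult_left_mono)
    ultimately show ?thesis
      using integrable_dominated_convergence[of "\<lambda>y. W y * k' s y" M
          "\<lambda>n y. W y * ((k (s + X n) y - k s y) / X n)" "\<lambda>y. \<bar>W y\<bar> * C"]
        integral_dominated_convergence[of "\<lambda>y. W y * k' s y" M
          "\<lambda>n y. W y * ((k (s + X n) y - k s y) / X n)" "\<lambda>y. \<bar>W y\<bar> * C"] W
      by auto
  qed
  note * = this
  show "integrable M (\<lambda>y. W y * k' s y)"
    using *[of "\<lambda>n. inverse (real (Suc n))"] LIMSEQ_inverse_real_of_nat by auto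
  have "(\<lambda>y. W y * ((k (s + h) y - k s y) / h)) = (\<lambda>y. (W y * k (s + h) y - W y * k s y) / h)" for h
    by (auto simp: field_simps)
  then have eq: "(LINT y|M. W y * ((k (s + h) y - k s y) / h)) =
      ((LINT y|M. W y * k (s + h) y) - (LINT y|M. W y * k s y)) / h" for h
    using int by simp
  then show "((\<lambda>s. LINT y|M. W y * k s y) has_real_derivative (LINT y|M. W y * k' s y)) (at s)"
    unfolding DERIV_def tendsto_at_iff_sequentially o_def
    using * unfolding eq by blast
qed

lemma integrable_mult_kernel:
  fixes \<rho> :: "'a::euclidean_space \<Rightarrow> real"
  assumes W: "integrable lborel W" and \<rho>: "Ck_function k \<rho>" "\<And>x. x \<notin> S \<Longrightarrow> \<rho> x = 0" "compact S"
  shows "integrable lborel (\<lambda>y. W y * \<rho> (c + a *\<^sub>R y))"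
proof -
  obtain B where "0 \<le> B" and B: "\<And>x. \<bar>\<rho> x\<bar> \<le> B" using kernel_bounded[OF \<rho>] by blast
  have [measurable]: "(\<lambda>y. \<rho> (c + a *\<^sub>R y)) \<in> borel_measurable borel"
    using Ck_function_continuous_on[OF Ck_function_affine[OF \<rho>(1)]] borel_measurable_continuous_onI by blast
  show ?thesis
    by (rule Bochner_Integration.integrable_bound[of lborel "\<lambda>y. B * W y"])
      (use W B \<open>0 \<le> B\<close> in \<open>auto simp: abs_mult mult.commute[of B] intro!: mult_left_mono\<close>)
qed

text \<open>The factor a allows two uses: a = -1 for the mollifier, where the kernel is evaluated at
  x - y, and a = 1 for a shifted test function in the integration by parts.\<close>

lemma convolution_has_directional_derivative:
  fixes \<rho> :: "'a::euclidean_space \<Rightarrow> real"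
  assumes W: "integrable lborel W"
    and \<rho>: "Ck_function (Suc 0) \<rho>" "\<And>x. x \<notin> S \<Longrightarrow> \<rho> x = 0" "compact S"
  shows "((\<lambda>s. LINT y|lborel. W y * \<rho> (x + s *\<^sub>R h + a *\<^sub>R y)) has_real_derivative
      (LINT y|lborel. W y * frechet_derivative \<rho> (at (x + s *\<^sub>R h + a *\<^sub>R y)) h)) (at s)"
    and "integrable lborel (\<lambda>y. W y * frechet_derivative \<rho> (at (x + s *\<^sub>R h + a *\<^sub>R y)) h)"
proof -
  obtain C where "0 \<le> C" and C: "\<And>x h. \<bar>frechet_derivative \<rho> (at x) h\<bar> \<le> C * norm h"
    using frechet_derivative_bounded[OF \<rho>] by blast
  have D: "((\<lambda>s. \<rho> (x + s *\<^sub>R h + a *\<^sub>R y)) has_real_derivative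
      frechet_derivative \<rho> (at (x + s *\<^sub>R h + a *\<^sub>R y)) h) (at s)" for s y
  proof -
    have D: "(\<rho> has_derivative frechet_derivative \<rho> (at (x + s *\<^sub>R h + a *\<^sub>R y))) (at (x + s *\<^sub>R h + a *\<^sub>R y))"
      by (rule Ck_function_has_derivative[OF \<rho>(1)])
    have "((\<lambda>s. \<rho> (x + s *\<^sub>R h + a *\<^sub>R y)) has_derivative
        (\<lambda>t. frechet_derivative \<rho> (at (x + s *\<^sub>R h + a *\<^sub>R y)) (t *\<^sub>R h))) (at s)"
      by (rule has_derivative_compose[where f="\<lambda>s. x + s *\<^sub>R h + a *\<^sub>R y" and g=\<rho>, OF _ D])
        (auto intro!: derivative_eq_intros)
    then show ?thesis
      unfolding has_field_derivative_def linear_scale[OF has_derivative_linear[OF D]]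
      by (rule has_derivative_eq_rhs) (auto simp: mult.commute)
  qed
  have meas: "(\<lambda>y. \<rho> (x + s *\<^sub>R h + a *\<^sub>R y)) \<in> borel_measurable lborel" for s
    using borel_measurable_continuous_onI[OF Ck_function_continuous_on[OF Ck_function_affine[OF \<rho>(1)]]]
    by simp
  show "((\<lambda>s. LINT y|lborel. W y * \<rho> (x + s *\<^sub>R h + a *\<^sub>R y)) has_real_derivative
      (LINT y|lborel. W y * frechet_derivative \<rho> (at (x + s *\<^sub>R h + a *\<^sub>R y)) h)) (at s)"
    by (rule has_real_derivative_integral(1)[OF W D C meas integrable_mult_kernel[OF W \<rho>]])
  show "integrable lborel (\<lambda>y. W y * frechet_derivative \<rho> (at (x + s *\<^sub>R h + a *\<^sub>R y)) h)"
    by (rule has_real_derivative_integral(2)[OF W D C meas integrable_mult_kernel[OF W \<rho>]])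
qed

lemma lborel_integral_affine_unit:
  fixes f :: "'a::euclidean_space \<Rightarrow> real"
  assumes "f \<in> borel_measurable borel" and "\<bar>c\<bar> = 1"
  shows "(LINT y|lborel. f (t + c *\<^sub>R y)) = (LINT y|lborel. f y)"
proof -
  have "c \<noteq> 0" using assms(2) by auto
  have "(LINT y|lborel. f y) = (LINT y|density (distr lborel borel (\<lambda>x. t + c *\<^sub>R x)) (\<lambda>_. \<bar>c\<bar>^DIM('a)). f y)"
    using lborel_affine[OF \<open>c \<noteq> 0\<close>, of t] by simp
  also have "\<dots> = (LINT y|lborel. f (t + c *\<^sub>R y))"
    using assms by (simp add: density_1 integral_distr)
  finally show ?thesis by simp
qed

section \<open>The standard mollifier and its averaging estimates\<close>

definition bump :: "real \<Rightarrow> 'a::euclidean_space \<Rightarrow> real" where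
  "bump \<epsilon> x = flat 0 (1 - (x /\<^sub>R \<epsilon>) \<bullet> (x /\<^sub>R \<epsilon>))"

definition mollifier :: "real \<Rightarrow> 'a::euclidean_space \<Rightarrow> real" where
  "mollifier \<epsilon> x = bump \<epsilon> x / integral\<^sup>L lborel (bump \<epsilon> :: 'a \<Rightarrow> real)"

lemma Ck_function_bump: "Ck_function k (bump \<epsilon>)"
  using Ck_function_affine[OF Ck_function_flat[of k 0], of 0 "inverse \<epsilon>"]
  unfolding bump_def[abs_def] by (simp only: add_0_left)

lemma Ck_function_mollifier: "Ck_function k (mollifier \<epsilon>)"
  unfolding mollifier_def[abs_def] divide_inverse
  by (intro Ck_function_mult Ck_function_const Ck_function_bump)

lemma bump_nonneg: "0 \<le> bump \<epsilon> x"
  unfolding bump_def by (rule flat_nonneg)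

lemma mollifier_nonneg: "0 \<le> mollifier \<epsilon> x"
  unfolding mollifier_def by (intro divide_nonneg_nonneg Bochner_Integration.integral_nonneg bump_nonneg)

lemma bump_eq_0_iff:
  assumes "0 < \<epsilon>"
  shows "bump \<epsilon> x = 0 \<longleftrightarrow> \<epsilon> \<le> norm x"
proof -
  have "(x /\<^sub>R \<epsilon>) \<bullet> (x /\<^sub>R \<epsilon>) = (norm x / \<epsilon>)\<^sup>2"
    using assms by (subst dot_square_norm) (simp add: divide_inverse mult.commute)
  moreover have "1 - (norm x / \<epsilon>)\<^sup>2 \<le> 0 \<longleftrightarrow> 1 \<le> norm x / \<epsilon>"
    using assms abs_le_square_iff[of 1 "norm x / \<epsilon>"] by simp
  ultimately have "bump \<epsilon> x = 0 \<longleftrightarrow> 1 \<le> norm x / \<epsilon>"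
    by (auto simp: bump_def flat_def)
  then show ?thesis
    using assms by (simp add: le_divide_eq)
qed

lemma mollifier_eq_0: "0 < \<epsilon> \<Longrightarrow> \<epsilon> \<le> norm x \<Longrightarrow> mollifier \<epsilon> x = 0"
  by (simp add: mollifier_def bump_eq_0_iff)

lemma mollifier_integral:
  assumes "0 < \<epsilon>"
  shows "integrable lborel (mollifier \<epsilon> :: 'a \<Rightarrow> real)" and "(LINT x::'a::euclidean_space|lborel. mollifier \<epsilon> x) = 1"
proof -
  have eq: "(\<lambda>x::'a. indicator (cball 0 \<epsilon>) x *\<^sub>R bump \<epsilon> x) = bump \<epsilon>"
  proof
    show "indicator (cball 0 \<epsilon>) x *\<^sub>R bump \<epsilon> x = bump \<epsilon> x" for x :: 'a
      using bump_eq_0_iff[OF assms, of x] by (cases "norm x \<le> \<epsilon>") auto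
  qed
  have int: "integrable lborel (bump \<epsilon> :: 'a \<Rightarrow> real)"
    using borel_integrable_compact[OF compact_cball Ck_function_continuous_on[OF Ck_function_bump],
        of "0::'a" \<epsilon> \<epsilon>]
    unfolding eq .
  have "integral\<^sup>L lborel (bump \<epsilon> :: 'a \<Rightarrow> real) \<noteq> 0"
  proof
    assume "integral\<^sup>L lborel (bump \<epsilon> :: 'a \<Rightarrow> real) = 0"
    then have "AE x::'a in lborel. bump \<epsilon> x = 0"
      using integral_nonneg_eq_0_iff_AE[OF int] by (auto simp: bump_nonneg)
    then have "AE x in lborel. x \<notin> ball (0::'a) \<epsilon>"
      by eventually_elim (use bump_eq_0_iff[OF assms, where 'a='a] in auto)
    then have "emeasure lborel (ball (0::'a) \<epsilon>) = 0"
      by (subst (asm) AE_iff_measurable[OF _ refl]) (auto simp: ball_def)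
    then have "unit_ball_vol (real DIM('a)) * \<epsilon> ^ DIM('a) \<le> 0"
      using assms by (simp add: emeasure_ball ennreal_eq_0_iff)
    moreover have "0 < unit_ball_vol (real DIM('a)) * \<epsilon> ^ DIM('a)"
      using assms by (intro mult_pos_pos unit_ball_vol_pos) auto
    ultimately show False by linarith
  qed
  then show "(LINT x::'a|lborel. mollifier \<epsilon> x) = 1"
    unfolding mollifier_def integral_divide_zero by (intro divide_self)
  show "integrable lborel (mollifier \<epsilon> :: 'a \<Rightarrow> real)"
    unfolding mollifier_def[abs_def] using int by (intro integrable_divide_zero) simp
qed

definition mollify :: "real \<Rightarrow> ('a::euclidean_space \<Rightarrow> real) \<Rightarrow> 'a \<Rightarrow> real" where
  "mollify \<epsilon> W x = (LINT y|lborel. W y * mollifier \<epsilon> (x - y))"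

text \<open>Here x sits inside W, so bounds on differences of W pass to the average. In the
  definition x sits inside the smooth kernel, which is what gives differentiability.\<close>

lemma mollify_reflected:
  assumes "W \<in> borel_measurable borel"
  shows "mollify \<epsilon> W x = (LINT z|lborel. W (x - z) * mollifier \<epsilon> z)"
proof -
  have [measurable]: "mollifier \<epsilon> \<in> borel_measurable borel"
    using Ck_function_continuous_on[OF Ck_function_mollifier] borel_measurable_continuous_onI by blast
  have [measurable]: "W \<in> borel_measurable borel" by fact
  show ?thesis
    unfolding mollify_def
    by (subst lborel_integral_affine_unit[symmetric, of _ "-1" x]) auto
qed

lemma integrable_mollify_reflected:
  fixes x :: "'a::euclidean_space"
  assumes "0 < \<epsilon>" and [measurable]: "W \<in> borel_measurable borel"
    and B: "\<And>y. \<bar>W y\<bar> \<le> B"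
  shows "integrable lborel (\<lambda>z. W (x - z) * mollifier \<epsilon> z)"
proof -
  have [measurable]: "mollifier \<epsilon> \<in> borel_measurable borel"
    using Ck_function_continuous_on[OF Ck_function_mollifier] borel_measurable_continuous_onI by blast
  show ?thesis
    by (rule Bochner_Integration.integrable_bound[of lborel "\<lambda>z. B * mollifier \<epsilon> z"])
      (use mollifier_integral[OF assms(1)] in
        \<open>auto simp: abs_mult mollifier_nonneg intro!: mult_right_mono order_trans[OF B abs_ge_self]\<close>)
qed

text \<open>The mollifier is a probability density supported in the ball of radius \<epsilon>, so a
  deviation of at most \<eta> there averages to at most \<eta>. Taking for c zero, a constant, or a
  translate of W yields the bound, the approximation and the Lipschitz estimate that follow.\<close>

lemma mollify_dist_le:
  fixes x :: "'a::euclidean_space"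
  assumes "0 < \<epsilon>" and W: "W \<in> borel_measurable borel" "\<And>y. \<bar>W y\<bar> \<le> B"
    and le: "\<And>z. norm z < \<epsilon> \<Longrightarrow> \<bar>W (x - z) - c z\<bar> \<le> \<eta>"
    and c: "integrable lborel (\<lambda>z. c z * mollifier \<epsilon> z)"
  shows "\<bar>mollify \<epsilon> W x - (LINT z|lborel. c z * mollifier \<epsilon> z)\<bar> \<le> \<eta>"
proof -
  note int = integrable_mollify_reflected[OF assms(1) W]
  have "\<bar>mollify \<epsilon> W x - (LINT z|lborel. c z * mollifier \<epsilon> z)\<bar>
      = \<bar>LINT z|lborel. W (x - z) * mollifier \<epsilon> z - c z * mollifier \<epsilon> z\<bar>"
    using int c by (simp add: mollify_reflected[OF W(1)])
  also have "\<dots> \<le> (LINT z|lborel. \<bar>W (x - z) * mollifier \<epsilon> z - c z * mollifier \<epsilon> z\<bar>)"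
    using integral_abs_bound by blast
  also have "\<dots> \<le> (LINT z::'a|lborel. \<eta> * mollifier \<epsilon> z)"
  proof (rule integral_mono)
    show "\<bar>W (x - z) * mollifier \<epsilon> z - c z * mollifier \<epsilon> z\<bar> \<le> \<eta> * mollifier \<epsilon> z" for z
    proof (cases "norm z < \<epsilon>")
      case True
      then show ?thesis
        using mult_right_mono[OF le[OF True] mollifier_nonneg[of \<epsilon> z]] mollifier_nonneg[of \<epsilon> z]
        by (simp add: abs_mult flip: left_diff_distrib)
    next
      case False
      then show ?thesis using mollifier_eq_0[OF assms(1), of z] by simp
    qed
  qed (use int c mollifier_integral[OF assms(1)] in auto)
  also have "\<dots> = \<eta>" using mollifier_integral(2)[OF assms(1), where 'a='a] by simp
  finally show ?thesis .
qed

lemma mollify_bounded: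
  assumes "0 < \<epsilon>" and W: "W \<in> borel_measurable borel" "\<And>y. \<bar>W y\<bar> \<le> B"
  shows "\<bar>mollify \<epsilon> W x\<bar> \<le> B"
  using mollify_dist_le[OF assms, of x "\<lambda>_. 0" B] W(2) by simp

lemma mollify_approx:
  fixes x :: "'a::euclidean_space"
  assumes "0 < \<epsilon>" and W: "W \<in> borel_measurable borel" "\<And>y. \<bar>W y\<bar> \<le> B"
    and le: "\<And>y. dist x y < \<epsilon> \<Longrightarrow> \<bar>W y - W x\<bar> \<le> \<eta>"
  shows "\<bar>mollify \<epsilon> W x - W x\<bar> \<le> \<eta>"
proof -
  have "\<bar>mollify \<epsilon> W x - (LINT z::'a|lborel. W x * mollifier \<epsilon> z)\<bar> \<le> \<eta>"
    by (rule mollify_dist_le[where c="\<lambda>_. W x", OF assms(1) W])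
      (use le mollifier_integral(1)[OF assms(1), where 'a='a] in \<open>auto simp: dist_norm\<close>)
  then show ?thesis
    using mollifier_integral(2)[OF assms(1), where 'a='a] by simp
qed

lemma mollify_lipschitz:
  fixes x :: "'a::euclidean_space"
  assumes "0 < \<epsilon>" and W: "W \<in> borel_measurable borel" "\<And>y. \<bar>W y\<bar> \<le> B"
    and le: "\<And>z. norm z < \<epsilon> \<Longrightarrow> \<bar>W (x - z) - W (x' - z)\<bar> \<le> \<eta>"
  shows "\<bar>mollify \<epsilon> W x - mollify \<epsilon> W x'\<bar> \<le> \<eta>"
proof -
  have "mollify \<epsilon> W x' = (LINT z|lborel. W (x' - z) * mollifier \<epsilon> z)"
    by (rule mollify_reflected[OF W(1)])
  moreover have "\<bar>mollify \<epsilon> W x - (LINT z|lborel. W (x' - z) * mollifier \<epsilon> z)\<bar> \<le> \<eta>"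
    by (rule mollify_dist_le[OF assms(1) W le integrable_mollify_reflected[OF assms(1) W]])
  ultimately show ?thesis by argo
qed

section \<open>Functions with weak gradient bounded by one\<close>

text \<open>Weak gradients are tested on \<open>lebesgue_on \<Omega>\<close>, whereas convolutions
  live on \<open>lborel\<close>. A Borel integrand vanishing off \<Omega> can be moved between the
  two.\<close>

lemma lebesgue_on_eq_lborel:
  fixes F :: "'a::euclidean_space \<Rightarrow> real"
  assumes "open \<Omega>" and F: "F \<in> borel_measurable borel"
    and eq: "\<And>x. x \<in> \<Omega> \<Longrightarrow> f x = F x" and zero: "\<And>x. x \<notin> \<Omega> \<Longrightarrow> F x = 0"
  shows "(LINT x|lebesgue_on \<Omega>. f x) = (LINT x|lborel. F x)"
    and "integrable (lebesgue_on \<Omega>) f \<longleftrightarrow> integrable lborel F"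
proof -
  have \<Omega>: "\<Omega> \<inter> space lebesgue \<in> sets lebesgue"
    using assms(1) by simp
  have "(\<lambda>x. indicator \<Omega> x *\<^sub>R f x) = F"
    using eq zero by (auto simp: fun_eq_iff indicator_def)
  then show "(LINT x|lebesgue_on \<Omega>. f x) = (LINT x|lborel. F x)"
    and "integrable (lebesgue_on \<Omega>) f \<longleftrightarrow> integrable lborel F"
    using integral_restrict_space[OF \<Omega>, of f] integrable_restrict_space[OF \<Omega>, of f]
      integral_completion[of F lborel] integrable_completion[of F lborel] F by simp_all
qed

text \<open>Continuity of h extends the description of \<Omega> to its closure and frontier: the
  region strictly below the graph is open and misses \<Omega>, while a point of the graph is the
  limit of its translates along e, which lie in \<Omega>.\<close>

lemma smooth_boundary_chart:
  fixes \<Omega> :: "'a::euclidean_space set"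
  assumes "smooth_bounded_domain \<Omega>" and "p \<in> frontier \<Omega>"
  obtains r e h where "0 < r" "norm e = 1" "smooth_function h"
    and "\<And>x. x \<in> ball p r \<Longrightarrow> x \<in> \<Omega> \<longleftrightarrow> h (x - (x \<bullet> e) *\<^sub>R e) < x \<bullet> e"
    and "\<And>x. x \<in> ball p r \<Longrightarrow> x \<in> closure \<Omega> \<longleftrightarrow> h (x - (x \<bullet> e) *\<^sub>R e) \<le> x \<bullet> e"
    and "\<And>x. x \<in> ball p r \<Longrightarrow> x \<in> frontier \<Omega> \<longleftrightarrow> h (x - (x \<bullet> e) *\<^sub>R e) = x \<bullet> e"
proof -
  have "open \<Omega>" and "\<exists>r>0. \<exists>e h. norm e = 1 \<and> smooth_function h \<and>
      \<Omega> \<inter> ball p r = {x \<in> ball p r. h (x - (x \<bullet> e) *\<^sub>R e) < x \<bullet> e}"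
    using assms by (simp_all add: smooth_bounded_domain_def)
  then obtain r e h where r: "0 < r" and e: "norm e = 1" and h: "smooth_function h"
    and eq: "\<Omega> \<inter> ball p r = {x \<in> ball p r. h (x - (x \<bullet> e) *\<^sub>R e) < x \<bullet> e}"
    by blast
  have \<Omega>: "x \<in> \<Omega> \<longleftrightarrow> h (x - (x \<bullet> e) *\<^sub>R e) < x \<bullet> e" if "x \<in> ball p r" for x
    using eq that by blast
  have cont: "continuous_on UNIV h"
    using h Ck_function_continuous_on unfolding smooth_function_def by blast
  have clos: "x \<in> closure \<Omega> \<longleftrightarrow> h (x - (x \<bullet> e) *\<^sub>R e) \<le> x \<bullet> e" if x: "x \<in> ball p r" for x
  proof
    assume cl: "x \<in> closure \<Omega>"
    show "h (x - (x \<bullet> e) *\<^sub>R e) \<le> x \<bullet> e"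
    proof (rule ccontr)
      assume n: "\<not> h (x - (x \<bullet> e) *\<^sub>R e) \<le> x \<bullet> e"
      define V where "V = ball p r \<inter> {y. y \<bullet> e < h (y - (y \<bullet> e) *\<^sub>R e)}"
      have "open V"
        unfolding V_def
        by (intro open_Int open_ball open_Collect_less continuous_on_compose2[OF cont] continuous_intros) auto
      moreover have "x \<in> V" using x n by (auto simp: V_def)
      ultimately have "V \<inter> \<Omega> \<noteq> {}"
        using cl by (auto simp: closure_iff_nhds_not_empty)
      then show False using \<Omega> by (auto simp: V_def)
    qed
  next
    assume le: "h (x - (x \<bullet> e) *\<^sub>R e) \<le> x \<bullet> e"
    have ee: "e \<bullet> e = 1" using e by (simp add: norm_eq_1)
    show "x \<in> closure \<Omega>"
      unfolding closure_approachable
    proof (intro allI impI)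
      fix \<epsilon> :: real assume "0 < \<epsilon>"
      define \<tau> where "\<tau> = min \<epsilon> (r - dist p x) / 2"
      have \<tau>: "0 < \<tau>" "\<tau> < \<epsilon>" "\<tau> < r - dist p x"
        using \<open>0 < \<epsilon>\<close> x by (auto simp: \<tau>_def)
      have d: "dist (x + \<tau> *\<^sub>R e) x = \<tau>" using e \<tau> by (simp add: dist_norm)
      then have "x + \<tau> *\<^sub>R e \<in> ball p r"
        using \<tau> dist_triangle[of p "x + \<tau> *\<^sub>R e" x] by (simp add: dist_commute)
      moreover have "h (x + \<tau> *\<^sub>R e - ((x + \<tau> *\<^sub>R e) \<bullet> e) *\<^sub>R e) < (x + \<tau> *\<^sub>R e) \<bullet> e"
        using le \<tau> by (simp add: inner_add_left ee scaleR_add_left)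
      ultimately have "x + \<tau> *\<^sub>R e \<in> \<Omega>" using \<Omega> by blast
      then show "\<exists>y\<in>\<Omega>. dist y x < \<epsilon>" using d \<tau>(2) by (intro bexI[of _ "x + \<tau> *\<^sub>R e"]) simp_all
    qed
  qed
  have "x \<in> frontier \<Omega> \<longleftrightarrow> h (x - (x \<bullet> e) *\<^sub>R e) = x \<bullet> e" if "x \<in> ball p r" for x
    using \<Omega>[OF that] clos[OF that] \<open>open \<Omega>\<close> by (auto simp: frontier_def interior_open)
  then show thesis using that[OF r e h] \<Omega> clos by blast
qed

lemma mollifier_test_function:
  fixes x :: "'a::euclidean_space"
  assumes "0 < \<epsilon>" and "cball x \<epsilon> \<subseteq> \<Omega>"
  shows "test_function \<Omega> (\<lambda>y. mollifier \<epsilon> (x - y))"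
proof -
  have "{y. mollifier \<epsilon> (x - y) \<noteq> 0} \<subseteq> cball x \<epsilon>"
    using mollifier_eq_0[OF assms(1), where 'a='a] by (force simp: dist_norm not_le)
  then have sub: "closure {y. mollifier \<epsilon> (x - y) \<noteq> 0} \<subseteq> cball x \<epsilon>"
    by (simp add: closure_minimal)
  then have "compact (closure {y. mollifier \<epsilon> (x - y) \<noteq> 0})"
    using compact_Int_closed[OF compact_cball closed_closure] by (metis inf.absorb2)
  moreover have "smooth_function (\<lambda>y. mollifier \<epsilon> (x - y))"
    using Ck_function_affine[OF Ck_function_mollifier, of _ \<epsilon> x "-1"]
    by (simp add: smooth_function_def)
  ultimately show ?thesis
    using sub assms(2) by (auto simp: test_function_def)
qed

lemma frechet_derivative_reflected:
  fixes \<rho> :: "'a::euclidean_space \<Rightarrow> real"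
  assumes "Ck_function (Suc 0) \<rho>"
  shows "frechet_derivative (\<lambda>y. \<rho> (x - y)) (at y) = (\<lambda>h. - frechet_derivative \<rho> (at (x - y)) h)"
proof -
  have D: "(\<rho> has_derivative frechet_derivative \<rho> (at (x - y))) (at (x - y))"
    by (rule Ck_function_has_derivative[OF assms])
  have "((\<lambda>y. \<rho> (x - y)) has_derivative (\<lambda>h. frechet_derivative \<rho> (at (x - y)) (- h))) (at y)"
    by (rule has_derivative_compose[where f="\<lambda>y. x - y" and g=\<rho>, OF _ D])
      (auto intro!: derivative_eq_intros)
  then show ?thesis
    using frechet_derivative_at linear_neg[OF has_derivative_linear[OF D]] by fastforce
qed

lemma continuous_on_imp_bounded_borel_extension:
  fixes v :: "'a::euclidean_space \<Rightarrow> real"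
  assumes "compact K" and "continuous_on K v"
  obtains B where "0 \<le> B" "\<And>x. \<bar>indicator K x * v x\<bar> \<le> B"
    "(\<lambda>x. indicator K x * v x) \<in> borel_measurable borel" "integrable lborel (\<lambda>x. indicator K x * v x)"
proof -
  obtain B where "0 < B" "\<And>x. x \<in> K \<Longrightarrow> \<bar>v x\<bar> \<le> B"
    using compact_imp_bounded[OF compact_continuous_image[OF assms(2,1)]] unfolding bounded_pos by auto
  then have "0 \<le> B" "\<And>x. \<bar>indicator K x * v x\<bar> \<le> B"
    by (auto simp: indicator_def)
  moreover have "integrable lborel (\<lambda>x. indicator K x * v x)"
    using borel_integrable_compact[OF assms] by simp
  moreover from this have "(\<lambda>x. indicator K x * v x) \<in> borel_measurable borel"
    using borel_measurable_integrable by force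
  ultimately show thesis using that by blast
qed

text \<open>The integral is the derivative along h of the mollified v at x. Since the kernel centred
  at x is a test function, it equals the average of \<open>G y \<bullet> h\<close> against that
  kernel, and an average of numbers of modulus at most \<open>norm h\<close> obeys the same
  bound.\<close>

lemma weak_gradient_mollifier_bound:
  fixes \<Omega> :: "'a::euclidean_space set"
  assumes "open \<Omega>" and "bounded \<Omega>" and v: "continuous_on (closure \<Omega>) v"
    and W: "W1inf_with_gradient \<Omega> v G" and G1: "AE x in lebesgue_on \<Omega>. norm (G x) \<le> 1"
    and "0 < \<epsilon>" and sub: "cball x \<epsilon> \<subseteq> \<Omega>"
  shows "\<bar>LINT y|lborel. (indicator (closure \<Omega>) y * v y) * frechet_derivative (mollifier \<epsilon>) (at (x - y)) h\<bar> \<le> norm h"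
proof -
  define \<rho> where "\<rho> = (mollifier \<epsilon> :: 'a \<Rightarrow> real)"
  define D where "D y = frechet_derivative \<rho> (at (x - y))" for y
  define vv where "vv y = indicator (closure \<Omega>) y * v y" for y
  define \<phi> where "\<phi> y = \<rho> (x - y)" for y
  have \<rho>1: "Ck_function (Suc 0) \<rho>" unfolding \<rho>_def by (rule Ck_function_mollifier)
  have \<rho>0: "\<And>z. z \<notin> cball 0 \<epsilon> \<Longrightarrow> \<rho> z = 0"
    using mollifier_eq_0[OF \<open>0 < \<epsilon>\<close>, where 'a='a] by (auto simp: \<rho>_def)
  have K: "compact (closure \<Omega>)" using assms(2) by (simp add: compact_closure)
  obtain B where "0 \<le> B" and B: "\<And>x. \<bar>vv x\<bar> \<le> B"
    and vvm[measurable]: "vv \<in> borel_measurable borel" and vvi: "integrable lborel vv"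
    using continuous_on_imp_bounded_borel_extension[OF K v] unfolding vv_def by metis
  have int: "integrable lborel (\<lambda>y. vv y * D y h)" for h
    using convolution_has_directional_derivative(2)[where S="cball 0 \<epsilon>" and s=0 and a="-1" and x=x,
        OF vvi \<rho>1 \<rho>0 compact_cball]
    by (simp add: D_def)
  have lin: "linear (D y)" for y
    unfolding D_def using Ck_function_has_derivative[OF \<rho>1] has_derivative_linear by blast
  have test: "test_function \<Omega> \<phi>"
    unfolding \<phi>_def \<rho>_def using mollifier_test_function[OF \<open>0 < \<epsilon>\<close> sub] .
  have D\<phi>: "frechet_derivative \<phi> (at y) h = - D y h" for y h
    unfolding \<phi>_def D_def using frechet_derivative_reflected[OF \<rho>1, of x y] by simp
  have D0: "D y h = 0" if "y \<notin> \<Omega>" for y h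
  proof -
    have "y \<notin> cball x \<epsilon>" using sub that by blast
    have "((\<lambda>_. 0) has_derivative (\<lambda>_. 0)) (at (x - y))" by simp
    then have "(\<rho> has_derivative (\<lambda>_. 0)) (at (x - y))"
      by (rule has_derivative_transform_within_open[of _ _ _ _ "- cball 0 \<epsilon>"])
        (use \<open>y \<notin> cball x \<epsilon>\<close> \<rho>0 in \<open>auto simp: dist_norm norm_minus_commute\<close>)
    then show ?thesis unfolding D_def by (metis frechet_derivative_at)
  qed
  have \<phi>0: "\<phi> y = 0" if "y \<notin> \<Omega>" for y
  proof -
    have "y \<notin> cball x \<epsilon>" using sub that by blast
    then show ?thesis using \<rho>0[of "x - y"] by (simp add: \<phi>_def dist_norm norm_minus_commute)
  qed
  have \<phi>m: "\<phi> \<in> borel_measurable borel"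
    using Ck_function_continuous_on[OF Ck_function_affine[OF \<rho>1, of x "-1"]]
    by (auto simp: \<phi>_def[abs_def] intro!: borel_measurable_continuous_onI)
  have \<phi>int: "integrable lborel \<phi>" "(LINT y|lborel. \<phi> y) = 1"
  proof -
    have \<rho>m: "\<rho> \<in> borel_measurable borel"
      using Ck_function_continuous_on[OF \<rho>1] borel_measurable_continuous_onI by blast
    show *: "(LINT y|lborel. \<phi> y) = 1"
      using lborel_integral_affine_unit[OF \<rho>m, of "-1" x] mollifier_integral(2)[OF \<open>0 < \<epsilon>\<close>, where 'a='a]
      by (simp add: \<phi>_def \<rho>_def)
    \<comment> \<open>A function that is not integrable has integral 0 by convention, so the value 1
      already forces integrability.\<close>
    show "integrable lborel \<phi>"
      using * not_integrable_integral_eq by fastforce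
  qed
  have \<phi>nn: "0 \<le> \<phi> y" for y by (simp add: \<phi>_def \<rho>_def mollifier_nonneg)
  have \<phi>int\<Omega>: "integrable (lebesgue_on \<Omega>) \<phi>" "(LINT y|lebesgue_on \<Omega>. \<phi> y) = 1"
    using lebesgue_on_eq_lborel[OF \<open>open \<Omega>\<close> \<phi>m _ \<phi>0, of \<phi>] \<phi>int by simp_all
  have [measurable]: "G \<in> borel_measurable (lebesgue_on \<Omega>)" and wg: "weak_gradient \<Omega> v G"
    using W by (auto simp: W1inf_with_gradient_def Linf_on_def)
  have Gint: "integrable (lebesgue_on \<Omega>) (\<lambda>y. (G y \<bullet> k) * \<phi> y)"
    and Gbd: "AE y in lebesgue_on \<Omega>. norm ((G y \<bullet> k) * \<phi> y) \<le> norm k * \<phi> y" for k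
  proof -
    show *: "AE y in lebesgue_on \<Omega>. norm ((G y \<bullet> k) * \<phi> y) \<le> norm k * \<phi> y"
      using G1
    proof eventually_elim
      case (elim y)
      have "\<bar>G y \<bullet> k\<bar> \<le> norm (G y) * norm k" by (rule Cauchy_Schwarz_ineq2)
      also have "\<dots> \<le> 1 * norm k" by (intro mult_right_mono elim) auto
      finally show ?case
        using \<phi>nn by (auto simp: abs_mult intro!: mult_right_mono)
    qed
    have [measurable]: "\<phi> \<in> borel_measurable (lebesgue_on \<Omega>)"
      using \<phi>int\<Omega>(1) by auto
    have "(\<lambda>y. (G y \<bullet> k) * \<phi> y) \<in> borel_measurable (lebesgue_on \<Omega>)"
      by measurable
    moreover have "AE y in lebesgue_on \<Omega>. norm ((G y \<bullet> k) * \<phi> y) \<le> norm (norm k * \<phi> y)"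
      using * by eventually_elim (metis abs_ge_self order_trans real_norm_def)
    ultimately show "integrable (lebesgue_on \<Omega>) (\<lambda>y. (G y \<bullet> k) * \<phi> y)"
      by (rule Bochner_Integration.integrable_bound[rotated]) (use \<phi>int\<Omega>(1) in auto)
  qed
  \<comment> \<open>Two minus signs cancel here: one from reflecting the kernel, the other from the
    definition of the weak gradient.\<close>
  have comp: "(LINT y|lborel. vv y * D y i) = (LINT y|lebesgue_on \<Omega>. (G y \<bullet> i) * \<phi> y)" if "i \<in> Basis" for i
  proof -
    have "(LINT y|lborel. vv y * D y i) = (LINT y|lebesgue_on \<Omega>. v y * D y i)"
      using lebesgue_on_eq_lborel(1)[OF \<open>open \<Omega>\<close>, of "\<lambda>y. vv y * D y i" "\<lambda>y. v y * D y i"] D0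
        borel_measurable_integrable[OF int[of i]] closure_subset[of \<Omega>]
      by (simp add: vv_def subset_iff)
    also have "\<dots> = - (LINT y|lebesgue_on \<Omega>. v y * frechet_derivative \<phi> (at y) i)"
      by (simp add: D\<phi>)
    also have "\<dots> = (LINT y|lebesgue_on \<Omega>. (G y \<bullet> i) * \<phi> y)"
      using wg test that by (simp add: weak_gradient_def)
    finally show ?thesis .
  qed
  have "D y h = (\<Sum>i\<in>Basis. (h \<bullet> i) * D y i)" for y
    using linear_sum[OF lin, of y "\<lambda>i. (h \<bullet> i) *\<^sub>R i" Basis] linear_scale[OF lin]
    by (simp add: euclidean_representation)
  then have "(LINT y|lborel. vv y * D y h) = (LINT y|lborel. (\<Sum>i\<in>Basis. (h \<bullet> i) * (vv y * D y i)))"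
    by (simp add: sum_distrib_left mult.left_commute)
  also have "\<dots> = (\<Sum>i\<in>Basis. (h \<bullet> i) * (LINT y|lborel. vv y * D y i))"
    using int by (subst Bochner_Integration.integral_sum) auto
  also have "\<dots> = (\<Sum>i\<in>Basis. (h \<bullet> i) * (LINT y|lebesgue_on \<Omega>. (G y \<bullet> i) * \<phi> y))"
    using comp by simp
  also have "\<dots> = (LINT y|lebesgue_on \<Omega>. (\<Sum>i\<in>Basis. (h \<bullet> i) * ((G y \<bullet> i) * \<phi> y)))"
    using Gint by (subst Bochner_Integration.integral_sum) auto
  also have "\<dots> = (LINT y|lebesgue_on \<Omega>. (G y \<bullet> h) * \<phi> y)"
    by (intro Bochner_Integration.integral_cong refl)
      (subst euclidean_inner, simp add: sum_distrib_left sum_distrib_right mult.commute mult.left_commute)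
  finally have "\<bar>LINT y|lborel. vv y * D y h\<bar> = \<bar>LINT y|lebesgue_on \<Omega>. (G y \<bullet> h) * \<phi> y\<bar>"
    by simp
  also have "\<dots> \<le> (LINT y|lebesgue_on \<Omega>. \<bar>(G y \<bullet> h) * \<phi> y\<bar>)"
    by (rule integral_abs_bound)
  also have "\<dots> \<le> (LINT y|lebesgue_on \<Omega>. norm h * \<phi> y)"
    using Gint Gbd \<phi>int\<Omega> by (intro integral_mono_AE) auto
  also have "\<dots> = norm h" using \<phi>int\<Omega> by simp
  finally show ?thesis by (simp add: vv_def D_def \<rho>_def)
qed

text \<open>The mollified v has slope at most \<open>norm h\<close> along the segment and is
  compared with v at the two end points only. So \<epsilon> has to respect just the distance of the
  segment to the complement of \<Omega> and the continuity of v at x and y.\<close>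

lemma weak_gradient_imp_lipschitz_on_segments:
  fixes \<Omega> :: "'a::euclidean_space set"
  assumes "open \<Omega>" and "bounded \<Omega>" and v: "continuous_on (closure \<Omega>) v"
    and W: "W1inf_with_gradient \<Omega> v G" and G1: "AE x in lebesgue_on \<Omega>. norm (G x) \<le> 1"
    and seg: "closed_segment x y \<subseteq> \<Omega>"
  shows "\<bar>v x - v y\<bar> \<le> dist x y"
proof (rule field_le_epsilon)
  fix \<eta> :: real assume "0 < \<eta>"
  define vv where "vv y = indicator (closure \<Omega>) y * v y" for y
  have K: "compact (closure \<Omega>)" using assms(2) by (simp add: compact_closure)
  obtain B where "0 \<le> B" and B: "\<And>x. \<bar>vv x\<bar> \<le> B"
    and vvm[measurable]: "vv \<in> borel_measurable borel" and vvi: "integrable lborel vv"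
    using continuous_on_imp_bounded_borel_extension[OF K v] unfolding vv_def by metis
  obtain \<delta> where "\<delta> > 0" and \<delta>: "\<And>z. z \<in> closed_segment x y \<Longrightarrow> cball z \<delta> \<subseteq> \<Omega>"
    using compact_subset_open_imp_cball_epsilon_subset[OF compact_segment \<open>open \<Omega>\<close> seg]
    by (metis UN_subset_iff)
  have xy: "x \<in> \<Omega>" "y \<in> \<Omega>" using seg by auto
  have "\<exists>d>0. \<forall>z'. dist z z' < d \<longrightarrow> \<bar>vv z' - vv z\<bar> \<le> \<eta> / 2" if z: "z \<in> \<Omega>" for z
  proof -
    have "continuous (at z) v"
      using v z \<open>open \<Omega>\<close> closure_subset by (metis continuous_on_eq_continuous_at continuous_on_subset)
    then obtain d where "d > 0" "\<And>z'. dist z' z < d \<Longrightarrow> dist (v z') (v z) < \<eta> / 2"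
      using \<open>0 < \<eta>\<close> unfolding continuous_at_eps_delta by (metis half_gt_zero)
    moreover obtain d' where "d' > 0" "ball z d' \<subseteq> \<Omega>"
      using z \<open>open \<Omega>\<close> open_contains_ball by blast
    moreover have "vv z' = v z'" if "z' \<in> \<Omega>" for z'
      using that closure_subset[of \<Omega>] by (auto simp: vv_def)
    ultimately show ?thesis
      using z by (intro exI[of _ "min d d'"]) (force simp: dist_commute dist_real_def subset_iff less_imp_le)
  qed
  then obtain dx dy where dx: "dx > 0" "\<And>z'. dist x z' < dx \<Longrightarrow> \<bar>vv z' - vv x\<bar> \<le> \<eta> / 2"
    and dy: "dy > 0" "\<And>z'. dist y z' < dy \<Longrightarrow> \<bar>vv z' - vv y\<bar> \<le> \<eta> / 2"
    using xy by metis
  define \<epsilon> where "\<epsilon> = min \<delta> (min dx dy)"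
  have "\<epsilon> > 0" "\<epsilon> \<le> \<delta>" "\<epsilon> \<le> dx" "\<epsilon> \<le> dy" using \<open>\<delta> > 0\<close> dx(1) dy(1) by (auto simp: \<epsilon>_def)
  have ax: "\<bar>mollify \<epsilon> vv x - vv x\<bar> \<le> \<eta> / 2"
    by (rule mollify_approx[OF \<open>\<epsilon> > 0\<close> vvm B]) (use dx \<open>\<epsilon> \<le> dx\<close> in auto)
  have ay: "\<bar>mollify \<epsilon> vv y - vv y\<bar> \<le> \<eta> / 2"
    by (rule mollify_approx[OF \<open>\<epsilon> > 0\<close> vvm B]) (use dy \<open>\<epsilon> \<le> dy\<close> in auto)
  define h where "h = y - x"
  define F' where "F' s = (LINT z|lborel. vv z * frechet_derivative (mollifier \<epsilon>) (at (x + s *\<^sub>R h - z)) h)" for s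
  have D: "((\<lambda>s. mollify \<epsilon> vv (x + s *\<^sub>R h)) has_real_derivative F' s) (at s)" for s
    using convolution_has_directional_derivative(1)[OF vvi Ck_function_mollifier[of "Suc 0" \<epsilon>], of "cball 0 \<epsilon>" x h "-1" s]
      mollifier_eq_0[OF \<open>\<epsilon> > 0\<close>, where 'a='a]
    by (simp add: mollify_def[abs_def] F'_def not_le less_imp_le)
  have F': "norm (F' s) \<le> dist x y" if "s \<in> {0..1}" for s
  proof -
    have "x + s *\<^sub>R h \<in> closed_segment x y"
      using that by (auto simp: h_def in_segment algebra_simps intro!: exI[of _ s])
    then have "cball (x + s *\<^sub>R h) \<epsilon> \<subseteq> \<Omega>" using \<delta> \<open>\<epsilon> \<le> \<delta>\<close> by (meson order_trans subset_cball)
    then show ?thesis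
      using weak_gradient_mollifier_bound[OF assms(1-5) \<open>\<epsilon> > 0\<close>, of "x + s *\<^sub>R h" h]
      by (simp add: F'_def vv_def h_def dist_norm norm_minus_commute)
  qed
  have "norm (mollify \<epsilon> vv (x + 1 *\<^sub>R h) - mollify \<epsilon> vv (x + 0 *\<^sub>R h)) \<le> dist x y * norm (1 - 0 :: real)"
    by (rule field_differentiable_bound[of "{0..1}" _ F'])
      (use F' D in \<open>auto intro: has_field_derivative_at_within\<close>)
  then have "\<bar>mollify \<epsilon> vv y - mollify \<epsilon> vv x\<bar> \<le> dist x y" by (simp add: h_def)
  moreover have "vv x = v x" "vv y = v y" using xy closure_subset[of \<Omega>] by (auto simp: vv_def)
  ultimately show "\<bar>v x - v y\<bar> \<le> dist x y + \<eta>" using ax ay by linarith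
qed

section \<open>Length of curves and the intrinsic distance\<close>

text \<open>The sum defining \<open>curve_length\<close>, over an arbitrary parameter interval:
  estimates along a curve are proved on short subarcs and then added.\<close>

definition arc_variation :: "(real \<Rightarrow> 'a::metric_space) \<Rightarrow> real \<Rightarrow> real \<Rightarrow> ennreal" where
  "arc_variation g a b =
     (SUP (n, s) \<in> {(n::nat, s::nat \<Rightarrow> real).
          (\<forall>i\<le>n. s i \<in> {a..b}) \<and> (\<forall>i<n. s i \<le> s (Suc i))}.
        \<Sum>i<n. ennreal (dist (g (s i)) (g (s (Suc i)))))"

lemma curve_length_eq_arc_variation: "curve_length g = arc_variation g 0 1"
  unfolding curve_length_def arc_variation_def ..

lemma arc_variation_upper:
  assumes "\<And>i. i \<le> n \<Longrightarrow> s i \<in> {a..b}" "\<And>i. i < n \<Longrightarrow> s i \<le> s (Suc i)"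
  shows "(\<Sum>i<n. ennreal (dist (g (s i)) (g (s (Suc i))))) \<le> arc_variation g a b"
  unfolding arc_variation_def
  by (rule SUP_upper2[of "(n, s)"]) (use assms in auto)

lemma dist_le_arc_variation:
  assumes "a \<le> b" shows "ennreal (dist (g a) (g b)) \<le> arc_variation g a b"
  using arc_variation_upper[of 1 "\<lambda>i. if i = 0 then a else b" a b g] assms by auto

lemma arc_variation_translate:
  "arc_variation (\<lambda>t. g t + c) a b = arc_variation (g :: real \<Rightarrow> 'a::real_normed_vector) a b"
  by (simp add: arc_variation_def dist_norm)

lemma sum_lessThan_add:
  fixes f :: "nat \<Rightarrow> 'a::comm_monoid_add"
  shows "sum f {..<n + m} = sum f {..<n} + (\<Sum>i<m. f (n + i))"
  by (induction m) (auto simp: ac_simps)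

text \<open>Partitions of the two intervals are concatenated, and the summand joining them is
  nonnegative.\<close>

lemma arc_variation_superadditive:
  assumes "a \<le> b" "b \<le> c"
  shows "arc_variation g a b + arc_variation g b c \<le> arc_variation g a c"
proof -
  let ?P = "\<lambda>a b. {(n::nat, s::nat \<Rightarrow> real). (\<forall>i\<le>n. s i \<in> {a..b}) \<and> (\<forall>i<n. s i \<le> s (Suc i))}"
  let ?S = "\<lambda>(n, s). \<Sum>i<n. ennreal (dist (g (s i)) (g (s (Suc i))))"
  have ne: "?P a b \<noteq> {}" if "a \<le> b" for a b :: real
    using that by (auto intro!: exI[of _ 0] exI[of _ "\<lambda>_. a"])
  have key: "?S p + ?S q \<le> arc_variation g a c" if "p \<in> ?P a b" "q \<in> ?P b c" for p q
  proof -
    obtain n s where p: "p = (n, s)" "\<And>i. i \<le> n \<Longrightarrow> s i \<in> {a..b}" "\<And>i. i < n \<Longrightarrow> s i \<le> s (Suc i)"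
      using \<open>p \<in> ?P a b\<close> by auto
    obtain m s' where q: "q = (m, s')" "\<And>i. i \<le> m \<Longrightarrow> s' i \<in> {b..c}" "\<And>i. i < m \<Longrightarrow> s' i \<le> s' (Suc i)"
      using \<open>q \<in> ?P b c\<close> by auto
    \<comment> \<open>The second partition starts at index n + 1, so the sum for w contains the
      additional jump from \<open>s n\<close> to \<open>s' 0\<close> at index n.\<close>
    define w where "w i = (if i \<le> n then s i else s' (i - Suc n))" for i
    have w1: "w i \<in> {a..c}" if "i \<le> Suc n + m" for i
    proof (cases "i \<le> n")
      case True
      then show ?thesis using p(2)[of i] assms by (auto simp: w_def)
    next
      case False
      then have "s' (i - Suc n) \<in> {b..c}" using that by (intro q(2)) auto
      then show ?thesis using False assms by (auto simp: w_def)
    qed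
    have w2: "w i \<le> w (Suc i)" if "i < Suc n + m" for i
    proof -
      consider "i < n" | "i = n" | "n < i" by linarith
      then show ?thesis
      proof cases
        case 2
        then show ?thesis using p(2)[of n] q(2)[of 0] by (auto simp: w_def)
      next
        case 3
        then have "Suc (i - Suc n) = i - n" by simp
        then show ?thesis using 3 q(3)[of "i - Suc n"] that by (auto simp: w_def)
      qed (auto simp: w_def p(3))
    qed
    have "?S p = (\<Sum>i<n. ennreal (dist (g (w i)) (g (w (Suc i)))))"
      by (auto simp: p(1) w_def intro!: sum.cong)
    moreover have "?S q = (\<Sum>i<m. ennreal (dist (g (w (Suc n + i))) (g (w (Suc (Suc n + i))))))"
      by (auto simp: q(1) w_def intro!: sum.cong)
    ultimately have "?S p + ?S q \<le> (\<Sum>i<Suc n + m. ennreal (dist (g (w i)) (g (w (Suc i)))))"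
      unfolding sum_lessThan_add by (auto intro!: add_right_mono)
    also have "\<dots> \<le> arc_variation g a c"
      by (rule arc_variation_upper) (use w1 w2 in blast)+
    finally show ?thesis .
  qed
  have "arc_variation g a b + arc_variation g b c = (SUP p\<in>?P a b. ?S p + arc_variation g b c)"
    unfolding arc_variation_def[of g a b] using ne[OF assms(1)] by (subst ennreal_SUP_add_left) auto
  also have "\<dots> \<le> arc_variation g a c"
  proof (rule SUP_least)
    fix p assume p: "p \<in> ?P a b"
    have "?S p + arc_variation g b c = (SUP q\<in>?P b c. ?S p + ?S q)"
      unfolding arc_variation_def[of g b c] using ne[OF assms(2)] by (subst ennreal_SUP_add_right) auto
    also have "\<dots> \<le> arc_variation g a c"
      using key[OF p] by (intro SUP_least) blast
    finally show "?S p + arc_variation g b c \<le> arc_variation g a c" .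
  qed
  finally show ?thesis .
qed

text \<open>By superadditivity the estimate passes from two adjacent intervals to their union, so
  bisection reduces it to short intervals around each parameter.\<close>

lemma le_arc_variation_local:
  fixes V :: "real \<Rightarrow> real"
  assumes "a \<le> b"
    and loc: "\<And>t. t \<in> {a..b} \<Longrightarrow> \<exists>d>0. \<forall>s s'. s \<in> {a..b} \<and> s' \<in> {a..b} \<and> s \<le> t \<and> t \<le> s' \<and> s' - s < d
      \<longrightarrow> ennreal \<bar>V s - V s'\<bar> \<le> arc_variation g s s'"
  shows "ennreal \<bar>V a - V b\<bar> \<le> arc_variation g a b"
proof -
  \<comment> \<open>The guard is trivial for the whole interval but belongs to the induction
    predicate, because the local case of the bisection ranges over intervals around t that may stick
    out of \<open>{a..b}\<close>.\<close>
  have "a \<le> a \<and> b \<le> b \<longrightarrow> ennreal \<bar>V a - V b\<bar> \<le> arc_variation g a b"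
    using assms(1)
  proof (induction a b rule: Bolzano[where P="\<lambda>s s'. a \<le> s \<and> s' \<le> b \<longrightarrow> ennreal \<bar>V s - V s'\<bar> \<le> arc_variation g s s'"])
    case (trans x y z)
    show ?case
    proof
      assume "a \<le> x \<and> z \<le> b"
      then have 1: "ennreal \<bar>V x - V y\<bar> \<le> arc_variation g x y" "ennreal \<bar>V y - V z\<bar> \<le> arc_variation g y z"
        using trans by auto
      have "ennreal \<bar>V x - V z\<bar> \<le> ennreal (\<bar>V x - V y\<bar> + \<bar>V y - V z\<bar>)"
        by (intro ennreal_leI) linarith
      also have "\<dots> = ennreal \<bar>V x - V y\<bar> + ennreal \<bar>V y - V z\<bar>" by simp
      also have "\<dots> \<le> arc_variation g x y + arc_variation g y z" by (intro add_mono 1)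
      also have "\<dots> \<le> arc_variation g x z" using trans by (intro arc_variation_superadditive)
      finally show "ennreal \<bar>V x - V z\<bar> \<le> arc_variation g x z" .
    qed
  next
    case (local t)
    then obtain d where "d > 0" "\<And>s s'. s \<in> {a..b} \<and> s' \<in> {a..b} \<and> s \<le> t \<and> t \<le> s' \<and> s' - s < d
      \<Longrightarrow> ennreal \<bar>V s - V s'\<bar> \<le> arc_variation g s s'"
      using loc[of t] by auto
    then show ?case using local by (intro exI[of _ d]) auto
  qed
  then show ?thesis by simp
qed

lemma continuous_on_near:
  fixes g :: "real \<Rightarrow> 'a::metric_space"
  assumes "continuous_on {a..b} g" "t \<in> {a..b}" "0 < r"
  obtains d where "d > 0" "\<And>s s' z. s \<in> {a..b} \<Longrightarrow> s' \<in> {a..b} \<Longrightarrow> s \<le> t \<Longrightarrow> t \<le> s' \<Longrightarrow> s' - s < d \<Longrightarrow>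
    z \<in> {s..s'} \<Longrightarrow> g z \<in> ball (g t) r"
proof -
  obtain d where "d > 0" and d: "\<And>z. z \<in> {a..b} \<Longrightarrow> dist z t < d \<Longrightarrow> dist (g z) (g t) < r"
    using assms unfolding continuous_on_iff by metis
  show thesis
    by (rule that[OF \<open>d > 0\<close>]) (use d in \<open>auto simp: dist_real_def dist_commute\<close>)
qed

section \<open>From segments in the domain to curves in its closure\<close>

lemma lipschitz_along_interior_curve:
  fixes v :: "'a::euclidean_space \<Rightarrow> real"
  assumes "open \<Omega>"
    and seg: "\<And>x y. closed_segment x y \<subseteq> \<Omega> \<Longrightarrow> \<bar>v x - v y\<bar> \<le> dist x y"
    and "a \<le> b" and g: "continuous_on {a..b} g" "g ` {a..b} \<subseteq> \<Omega>"
  shows "ennreal \<bar>v (g a) - v (g b)\<bar> \<le> arc_variation g a b"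
proof (rule le_arc_variation_local[where V="\<lambda>t. v (g t)", OF \<open>a \<le> b\<close>])
  fix t assume t: "t \<in> {a..b}"
  obtain r where "r > 0" and r: "ball (g t) r \<subseteq> \<Omega>"
    using t g(2) \<open>open \<Omega>\<close> open_contains_ball by (metis image_subset_iff)
  obtain d where "d > 0" and d: "\<And>s s' z. s \<in> {a..b} \<Longrightarrow> s' \<in> {a..b} \<Longrightarrow> s \<le> t \<Longrightarrow> t \<le> s' \<Longrightarrow> s' - s < d \<Longrightarrow>
    z \<in> {s..s'} \<Longrightarrow> g z \<in> ball (g t) r"
    using continuous_on_near[OF g(1) t \<open>r > 0\<close>] by blast
  have "ennreal \<bar>v (g s) - v (g s')\<bar> \<le> arc_variation g s s'"
    if "s \<in> {a..b}" "s' \<in> {a..b}" "s \<le> t" "t \<le> s'" "s' - s < d" for s s'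
  proof -
    have "g s \<in> ball (g t) r" "g s' \<in> ball (g t) r" using d[OF that] that by auto
    then have "closed_segment (g s) (g s') \<subseteq> \<Omega>"
      using r closed_segment_subset[of "g s" "ball (g t) r" "g s'"] by (metis convex_ball order_trans)
    then have "ennreal \<bar>v (g s) - v (g s')\<bar> \<le> ennreal (dist (g s) (g s'))"
      by (intro ennreal_leI seg)
    also have "\<dots> \<le> arc_variation g s s'" using that by (intro dist_le_arc_variation) auto
    finally show ?thesis .
  qed
  then show "\<exists>d>0. \<forall>s s'. s \<in> {a..b} \<and> s' \<in> {a..b} \<and> s \<le> t \<and> t \<le> s' \<and> s' - s < d
      \<longrightarrow> ennreal \<bar>v (g s) - v (g s')\<bar> \<le> arc_variation g s s'"
    using \<open>d > 0\<close> by blast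
qed

text \<open>Near a boundary point the curve is pushed into the domain by a small translation along the
  axis of the chart, which does not change its length.\<close>
lemma lipschitz_along_curve:
  fixes v :: "'a::euclidean_space \<Rightarrow> real"
  assumes \<Omega>: "smooth_bounded_domain \<Omega>" and v: "continuous_on (closure \<Omega>) v"
    and seg: "\<And>x y. closed_segment x y \<subseteq> \<Omega> \<Longrightarrow> \<bar>v x - v y\<bar> \<le> dist x y"
    and "a \<le> b" and g: "continuous_on {a..b} g" "g ` {a..b} \<subseteq> closure \<Omega>"
  shows "ennreal \<bar>v (g a) - v (g b)\<bar> \<le> arc_variation g a b"
proof (rule le_arc_variation_local[where V="\<lambda>t. v (g t)", OF \<open>a \<le> b\<close>])
  fix t assume t: "t \<in> {a..b}"
  have "open \<Omega>" using \<Omega> by (simp add: smooth_bounded_domain_def)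
  have "g t \<in> closure \<Omega>" using t g(2) by auto
  then consider "g t \<in> \<Omega>" | "g t \<in> frontier \<Omega>"
    using \<open>open \<Omega>\<close> by (auto simp: frontier_def interior_open)
  then show "\<exists>d>0. \<forall>s s'. s \<in> {a..b} \<and> s' \<in> {a..b} \<and> s \<le> t \<and> t \<le> s' \<and> s' - s < d
      \<longrightarrow> ennreal \<bar>v (g s) - v (g s')\<bar> \<le> arc_variation g s s'"
  proof cases
    case 1
    then obtain r where "r > 0" and r: "ball (g t) r \<subseteq> \<Omega>"
      using \<open>open \<Omega>\<close> open_contains_ball by blast
    obtain d where "d > 0" and d: "\<And>s s' z. s \<in> {a..b} \<Longrightarrow> s' \<in> {a..b} \<Longrightarrow> s \<le> t \<Longrightarrow> t \<le> s' \<Longrightarrow> s' - s < d \<Longrightarrow>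
      z \<in> {s..s'} \<Longrightarrow> g z \<in> ball (g t) r"
      using continuous_on_near[OF g(1) t \<open>r > 0\<close>] by blast
    have "ennreal \<bar>v (g s) - v (g s')\<bar> \<le> arc_variation g s s'"
      if "s \<in> {a..b}" "s' \<in> {a..b}" "s \<le> t" "t \<le> s'" "s' - s < d" for s s'
      using that d[OF that] r
      by (intro lipschitz_along_interior_curve[OF \<open>open \<Omega>\<close> seg] continuous_on_subset[OF g(1)]) auto
    then show ?thesis using \<open>d > 0\<close> by blast
  next
    case 2
    obtain r e h where "0 < r" and e: "norm e = 1" and "smooth_function h"
      and in\<Omega>: "\<And>x. x \<in> ball (g t) r \<Longrightarrow> x \<in> \<Omega> \<longleftrightarrow> h (x - (x \<bullet> e) *\<^sub>R e) < x \<bullet> e"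
      and incl: "\<And>x. x \<in> ball (g t) r \<Longrightarrow> x \<in> closure \<Omega> \<longleftrightarrow> h (x - (x \<bullet> e) *\<^sub>R e) \<le> x \<bullet> e"
      using smooth_boundary_chart[OF \<Omega> 2] by metis
    \<comment> \<open>Moving along e leaves the projection unchanged and raises the height, which
      makes the inequality of the chart strict. The two halves of r keep the translate inside the
      ball of the chart.\<close>
    have push: "x + \<tau> *\<^sub>R e \<in> \<Omega>"
      if "x \<in> closure \<Omega>" "x \<in> ball (g t) (r / 2)" "0 < \<tau>" "\<tau> < r / 2" for x \<tau>
    proof -
      have "dist (g t) (x + \<tau> *\<^sub>R e) \<le> dist (g t) x + dist x (x + \<tau> *\<^sub>R e)" by (rule dist_triangle)
      also have "\<dots> < r / 2 + r / 2" using that e by (intro add_strict_mono) (auto simp: dist_norm)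
      finally have "x + \<tau> *\<^sub>R e \<in> ball (g t) r" by simp
      moreover have "x \<in> ball (g t) r" using that \<open>0 < r\<close> by auto
      moreover have "e \<bullet> e = 1" using e by (simp add: norm_eq_1)
      ultimately show ?thesis
        using that incl[of x] in\<Omega>[of "x + \<tau> *\<^sub>R e"]
        by (simp add: inner_add_left scaleR_add_left)
    qed
    obtain d where "d > 0" and d: "\<And>s s' z. s \<in> {a..b} \<Longrightarrow> s' \<in> {a..b} \<Longrightarrow> s \<le> t \<Longrightarrow> t \<le> s' \<Longrightarrow> s' - s < d \<Longrightarrow>
      z \<in> {s..s'} \<Longrightarrow> g z \<in> ball (g t) (r / 2)"
      using continuous_on_near[OF g(1) t, of "r / 2"] \<open>0 < r\<close> by (metis half_gt_zero)
    have "ennreal \<bar>v (g s) - v (g s')\<bar> \<le> arc_variation g s s'"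
      if s: "s \<in> {a..b}" "s' \<in> {a..b}" "s \<le> t" "t \<le> s'" "s' - s < d" for s s'
    proof -
      have gz: "g z \<in> closure \<Omega> \<and> g z \<in> ball (g t) (r / 2)" if "z \<in> {s..s'}" for z
        using d[OF s that] that s g(2) by (auto simp: image_subset_iff)
      have ev: "\<forall>\<^sub>F \<tau> in at_right 0. 0 < \<tau> \<and> \<tau> < r / 2"
        using \<open>0 < r\<close> by (auto simp: eventually_at_right_field intro!: exI[of _ "r / 2"])
      have lim: "((\<lambda>\<tau>. v (g z + \<tau> *\<^sub>R e)) \<longlongrightarrow> v (g z)) (at_right 0)" if "z \<in> {s..s'}" for z
      proof (rule continuous_on_tendsto_compose[OF v])
        show "((\<lambda>\<tau>. g z + \<tau> *\<^sub>R e) \<longlongrightarrow> g z) (at_right 0)"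
          by (auto intro!: tendsto_eq_intros)
        show "\<forall>\<^sub>F \<tau> in at_right 0. g z + \<tau> *\<^sub>R e \<in> closure \<Omega>"
          using ev by eventually_elim (use gz[OF that] push closure_subset in blast)
      qed (use gz that in auto)
      have "((\<lambda>\<tau>. ennreal \<bar>v (g s + \<tau> *\<^sub>R e) - v (g s' + \<tau> *\<^sub>R e)\<bar>) \<longlongrightarrow> ennreal \<bar>v (g s) - v (g s')\<bar>) (at_right 0)"
        using s by (intro tendsto_ennrealI tendsto_rabs tendsto_diff lim) auto
      moreover have "\<forall>\<^sub>F \<tau> in at_right 0. ennreal \<bar>v (g s + \<tau> *\<^sub>R e) - v (g s' + \<tau> *\<^sub>R e)\<bar> \<le> arc_variation g s s'"
        using ev
      proof eventually_elim
        case (elim \<tau>)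
        have "ennreal \<bar>v (g s + \<tau> *\<^sub>R e) - v (g s' + \<tau> *\<^sub>R e)\<bar> \<le> arc_variation (\<lambda>z. g z + \<tau> *\<^sub>R e) s s'"
        proof (rule lipschitz_along_interior_curve[OF \<open>open \<Omega>\<close> seg])
          show "continuous_on {s..s'} (\<lambda>z. g z + \<tau> *\<^sub>R e)"
            using s by (intro continuous_intros continuous_on_subset[OF g(1)]) auto
          show "(\<lambda>z. g z + \<tau> *\<^sub>R e) ` {s..s'} \<subseteq> \<Omega>"
            using gz push elim by blast
        qed (use s in auto)
        then show ?case by (simp only: arc_variation_translate)
      qed
      ultimately show ?thesis
        by (rule tendsto_upperbound) simp
    qed
    then show ?thesis using \<open>d > 0\<close> by blast
  qed
qed

lemma A_inf_subset_dual_admissible: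
  assumes "smooth_bounded_domain \<Omega>" shows "A_inf \<Omega> \<subseteq> dual_admissible \<Omega>"
proof
  fix u assume "u \<in> A_inf \<Omega>"
  then obtain v G where v: "continuous_on (closure \<Omega>) v" "W1inf_with_gradient \<Omega> v G"
    "AE x in lebesgue_on \<Omega>. norm (G x) \<le> 1" and vu: "\<And>x. x \<in> frontier \<Omega> \<Longrightarrow> v x = u x"
    unfolding A_inf_def by blast
  have "open \<Omega>" "bounded \<Omega>" using assms by (auto simp: smooth_bounded_domain_def)
  note seg = weak_gradient_imp_lipschitz_on_segments[OF this v]
  have "ennreal \<bar>u x - u y\<bar> \<le> domain_dist \<Omega> x y" if "x \<in> frontier \<Omega>" "y \<in> frontier \<Omega>" for x y
    unfolding domain_dist_def
  proof (rule INF_greatest, clarify)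
    fix g assume g: "path g" "path_image g \<subseteq> closure \<Omega>" "x = pathstart g" "y = pathfinish g"
    show "ennreal \<bar>u (pathstart g) - u (pathfinish g)\<bar> \<le> curve_length g"
      using lipschitz_along_curve[OF assms v(1) seg, of 0 1 g] g vu that
      by (simp add: curve_length_eq_arc_variation path_def path_image_def pathstart_def pathfinish_def)
  qed
  then show "u \<in> dual_admissible \<Omega>" by (simp add: dual_admissible_def)
qed

section \<open>The intrinsic distance near the boundary\<close>

lemma curve_length_le_lipschitz:
  assumes "L-lipschitz_on {0..1} g" shows "curve_length g \<le> ennreal L"
  unfolding curve_length_def
proof (rule SUP_least, clarify)
  fix n :: nat and s :: "nat \<Rightarrow> real"
  assume s: "\<forall>i\<le>n. s i \<in> {0..1}" "\<forall>i<n. s i \<le> s (Suc i)"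
  have "(\<Sum>i<n. dist (g (s i)) (g (s (Suc i)))) \<le> (\<Sum>i<n. L * (s (Suc i) - s i))"
  proof (rule sum_mono)
    fix i assume "i \<in> {..<n}"
    then show "dist (g (s i)) (g (s (Suc i))) \<le> L * (s (Suc i) - s i)"
      using lipschitz_onD[OF assms, of "s i" "s (Suc i)"] s by (auto simp: dist_real_def abs_if split: if_splits)
  qed
  also have "\<dots> = L * (s n - s 0)"
    by (simp add: sum_lessThan_telescope flip: sum_distrib_left)
  also have "\<dots> \<le> L * 1"
    using s lipschitz_on_nonneg[OF assms] by (intro mult_left_mono) (auto simp: algebra_simps intro: order_trans[of _ 1])
  finally show "(\<Sum>i<n. ennreal (dist (g (s i)) (g (s (Suc i))))) \<le> ennreal L"
    by (simp add: ennreal_leI)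
qed

lemma domain_dist_le_lipschitz:
  fixes g :: "real \<Rightarrow> 'a::euclidean_space"
  assumes "L-lipschitz_on {0..1} g" and "g ` {0..1} \<subseteq> closure \<Omega>"
  shows "domain_dist \<Omega> (g 0) (g 1) \<le> ennreal L"
proof -
  have "continuous_on {0..1} g" by (rule lipschitz_on_continuous_on[OF assms(1)])
  then have "domain_dist \<Omega> (g 0) (g 1) \<le> curve_length g"
    unfolding domain_dist_def using assms(2)
    by (intro INF_lower) (simp add: path_def path_image_def pathstart_def pathfinish_def)
  also have "\<dots> \<le> ennreal L" by (rule curve_length_le_lipschitz[OF assms(1)])
  finally show ?thesis .
qed

lemma smooth_function_lipschitz_on_cball:
  assumes "smooth_function (h :: 'a::euclidean_space \<Rightarrow> real)"
  obtains C where "C-lipschitz_on (cball z R) h"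
proof -
  have h: "Ck_function (Suc 0) h" using assms unfolding smooth_function_def by blast
  obtain C where "0 \<le> C" and C: "\<And>x k. x \<in> cball z R \<Longrightarrow> \<bar>frechet_derivative h (at x) k\<bar> \<le> C * norm k"
    using frechet_derivative_bounded_on_compact[OF h compact_cball] by blast
  have "norm (h x - h y) \<le> C * norm (x - y)" if "x \<in> cball z R" "y \<in> cball z R" for x y
  proof (rule differentiable_bound[OF convex_cball _ _ that])
    show "(h has_derivative frechet_derivative h (at x)) (at x within cball z R)" for x
      using Ck_function_has_derivative[OF h] has_derivative_at_withinI by blast
    show "onorm (frechet_derivative h (at x)) \<le> C" if "x \<in> cball z R" for x
      using C[OF that] by (intro onorm_le) auto
  qed
  then show thesis
    using that \<open>0 \<le> C\<close> by (intro that[of C] lipschitz_onI) (auto simp: dist_norm)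
qed

lemma norm_orthogonal_part_le:
  fixes e z :: "'a::real_inner"
  assumes "norm e = 1" shows "norm (z - (z \<bullet> e) *\<^sub>R e) \<le> norm z"
proof -
  have "e \<bullet> e = 1" using assms by (simp add: norm_eq_1)
  then have "(z - (z \<bullet> e) *\<^sub>R e) \<bullet> (z - (z \<bullet> e) *\<^sub>R e) = z \<bullet> z - (z \<bullet> e)\<^sup>2"
    by (simp add: inner_diff_left inner_diff_right inner_commute power2_eq_square)
  then show ?thesis by (simp add: norm_le)
qed

text \<open>Within a chart, the segment between the projections of p and x is lifted to the graph of
  h; this curve stays in the boundary and is longer than the segment by at most a factor given by
  the slope of h. The estimate is what turns a bound by \<open>domain_dist\<close> into
  continuity.\<close>

lemma domain_dist_locally_lipschitz:
  fixes \<Omega> :: "'a::euclidean_space set"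
  assumes \<Omega>: "smooth_bounded_domain \<Omega>" and p: "p \<in> frontier \<Omega>"
  obtains L \<delta> where "0 < \<delta>" "0 \<le> L"
    "\<And>x. x \<in> frontier \<Omega> \<Longrightarrow> dist p x < \<delta> \<Longrightarrow> domain_dist \<Omega> p x \<le> ennreal (L * dist p x)"
proof -
  obtain r e h where "0 < r" and e: "norm e = 1" and h: "smooth_function h"
    and incl: "\<And>x. x \<in> ball p r \<Longrightarrow> x \<in> closure \<Omega> \<longleftrightarrow> h (x - (x \<bullet> e) *\<^sub>R e) \<le> x \<bullet> e"
    and infr: "\<And>x. x \<in> ball p r \<Longrightarrow> x \<in> frontier \<Omega> \<longleftrightarrow> h (x - (x \<bullet> e) *\<^sub>R e) = x \<bullet> e"
    using smooth_boundary_chart[OF \<Omega> p] by metis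
  have ee: "e \<bullet> e = 1" using e by (simp add: norm_eq_1)
  define \<pi> where "\<pi> x = x - (x \<bullet> e) *\<^sub>R e" for x
  have \<pi>d: "norm (\<pi> x - \<pi> y) \<le> norm (x - y)" for x y
    using norm_orthogonal_part_le[OF e, of "x - y"] by (simp add: \<pi>_def algebra_simps inner_diff_left)
  have \<pi>e: "\<pi> x \<bullet> e = 0" for x by (simp add: \<pi>_def inner_diff_left ee)
  obtain C where C: "C-lipschitz_on (cball (\<pi> p) r) h"
    using smooth_function_lipschitz_on_cball[OF h] by blast
  have "0 \<le> C" using C by (rule lipschitz_on_nonneg)
  define L where "L = 1 + C"
  have "L \<ge> 1" using \<open>0 \<le> C\<close> by (simp add: L_def)
  \<comment> \<open>The lifted curve stays within L times \<open>dist p x\<close> of p. This is less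
    than r for x within \<delta> of p, so the curve does not leave the ball in which the chart
    describes the closure.\<close>
  define \<delta> where "\<delta> = r / L"
  have "0 < \<delta>" using \<open>0 < r\<close> \<open>L \<ge> 1\<close> by (simp add: \<delta>_def)
  show thesis
  proof (rule that[OF \<open>0 < \<delta>\<close>])
    show "0 \<le> L" using \<open>L \<ge> 1\<close> by simp
    fix x assume x: "x \<in> frontier \<Omega>" "dist p x < \<delta>"
    have Lx: "L * dist p x < r"
      using x(2) \<open>L \<ge> 1\<close> by (simp add: \<delta>_def pos_less_divide_eq mult.commute)
    have "dist p x \<le> L * dist p x" using \<open>L \<ge> 1\<close> by (simp add: mult_le_cancel_right1)
    then have xr: "dist p x < r" using Lx by linarith
    define q where "q s = \<pi> p + s *\<^sub>R (\<pi> x - \<pi> p)" for s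
    have qd: "dist (q s) (q s') \<le> \<bar>s - s'\<bar> * dist p x" for s s'
      using mult_left_mono[OF \<pi>d[of x p], of "\<bar>s - s'\<bar>"]
      by (simp add: q_def dist_norm norm_minus_commute flip: scaleR_left_diff_distrib)
    have qin: "q s \<in> cball (\<pi> p) r" if "s \<in> {0..1}" for s
    proof -
      have "dist (q 0) (q s) \<le> 1 * dist p x"
        using that by (intro order_trans[OF qd] mult_right_mono) auto
      then show ?thesis using xr by (simp add: q_def)
    qed
    have qe: "q s \<bullet> e = 0" for s by (simp add: q_def inner_add_left inner_diff_left \<pi>e)
    define g where "g s = q s + h (q s) *\<^sub>R e" for s
    have gd: "dist (g s) (g s') \<le> (L * dist p x) * dist s s'" if "s \<in> {0..1}" "s' \<in> {0..1}" for s s'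
    proof -
      have "dist (g s) (g s') \<le> dist (q s) (q s') + dist (h (q s)) (h (q s'))"
      proof -
        have "g s - g s' = (q s - q s') + (h (q s) - h (q s')) *\<^sub>R e"
          by (simp add: g_def algebra_simps)
        then show ?thesis
          using norm_triangle_ineq[of "q s - q s'" "(h (q s) - h (q s')) *\<^sub>R e"] e
          by (simp add: dist_norm)
      qed
      also have "\<dots> \<le> dist (q s) (q s') + C * dist (q s) (q s')"
        using lipschitz_onD[OF C qin[OF that(1)] qin[OF that(2)]] by simp
      also have "\<dots> = L * dist (q s) (q s')" by (simp add: L_def algebra_simps)
      also have "\<dots> \<le> L * (\<bar>s - s'\<bar> * dist p x)"
        using \<open>L \<ge> 1\<close> by (intro mult_left_mono qd) auto
      finally show ?thesis by (simp add: dist_real_def mult_ac)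
    qed
    have \<pi>g: "g s - (g s \<bullet> e) *\<^sub>R e = q s" and ge: "g s \<bullet> e = h (q s)" for s
      by (simp_all add: g_def inner_add_left qe ee)
    have g0: "g 0 = p"
      using infr[of p] p \<open>0 < r\<close> by (simp add: g_def q_def) (simp add: \<pi>_def)
    have g1: "g 1 = x"
      using infr[of x] x xr by (simp add: g_def q_def) (simp add: \<pi>_def)
    have "g s \<in> closure \<Omega>" if "s \<in> {0..1}" for s
    proof -
      have "dist (g 0) (g s) \<le> L * dist p x * 1"
        using that \<open>L \<ge> 1\<close> by (intro order_trans[OF gd] mult_left_mono) auto
      then have "g s \<in> ball p r" using Lx g0 by simp
      then show ?thesis using incl[of "g s"] \<pi>g ge by simp
    qed
    moreover have "(L * dist p x)-lipschitz_on {0..1} g"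
      using gd \<open>L \<ge> 1\<close> by (intro lipschitz_onI) auto
    ultimately show "domain_dist \<Omega> p x \<le> ennreal (L * dist p x)"
      using domain_dist_le_lipschitz[of "L * dist p x" g \<Omega>] g0 g1 by (simp add: image_subset_iff)
  qed
qed

lemma dual_admissible_continuous_on:
  assumes \<Omega>: "smooth_bounded_domain \<Omega>" and w: "w \<in> dual_admissible \<Omega>"
  shows "continuous_on (frontier \<Omega>) w"
  unfolding continuous_on_iff
proof (intro ballI allI impI)
  fix p \<epsilon> assume p: "p \<in> frontier \<Omega>" and "(0::real) < \<epsilon>"
  obtain L \<delta> where "0 < \<delta>" "0 \<le> L"
    and L: "\<And>x. x \<in> frontier \<Omega> \<Longrightarrow> dist p x < \<delta> \<Longrightarrow> domain_dist \<Omega> p x \<le> ennreal (L * dist p x)"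
    using domain_dist_locally_lipschitz[OF \<Omega> p] by blast
  have "dist (w x) (w p) < \<epsilon>" if x: "x \<in> frontier \<Omega>" "dist x p < min \<delta> (\<epsilon> / (L + 1))" for x
  proof -
    have "ennreal \<bar>w p - w x\<bar> \<le> domain_dist \<Omega> p x"
      using w p x by (auto simp: dual_admissible_def)
    also have "\<dots> \<le> ennreal (L * dist p x)" using L[OF x(1)] x(2) by (simp add: dist_commute)
    finally have "dist (w x) (w p) \<le> L * dist p x"
      using \<open>0 \<le> L\<close> by (simp add: dist_real_def abs_minus_commute)
    also have "\<dots> \<le> (L + 1) * dist x p" by (simp add: dist_commute mult_right_mono)
    also have "\<dots> < \<epsilon>" using x \<open>0 \<le> L\<close> by (simp add: pos_less_divide_eq mult.commute)
    finally show ?thesis .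
  qed
  then show "\<exists>d>0. \<forall>x\<in>frontier \<Omega>. dist x p < d \<longrightarrow> dist (w x) (w p) < \<epsilon>"
    using \<open>0 < \<delta>\<close> \<open>0 \<le> L\<close> \<open>0 < \<epsilon>\<close> by (intro exI[of _ "min \<delta> (\<epsilon> / (L + 1))"]) auto
qed

section \<open>Weak gradients of mollified functions\<close>

lemma integrable_bounded_support:
  fixes f :: "'a::euclidean_space \<Rightarrow> real"
  assumes [measurable]: "f \<in> borel_measurable borel" and B: "\<And>x. \<bar>f x\<bar> \<le> B"
    and zero: "\<And>x. R \<le> norm x \<Longrightarrow> f x = 0"
  shows "integrable lborel f"
proof (rule Bochner_Integration.integrable_bound)
  show "integrable lborel (\<lambda>x::'a. B * indicator (ball 0 R) x)"
    by (intro integrable_mult_right integrable_real_indicator)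
      (use emeasure_lborel_ball_finite[of "0::'a" R] in simp_all)
  have "\<bar>f x\<bar> \<le> \<bar>B * indicator (ball 0 R) x\<bar>" for x
    using B[of x] zero[of x] by (cases "norm x < R") auto
  then show "AE x in lborel. norm (f x) \<le> norm (B * indicator (ball 0 R) x)" by simp
qed simp

definition mollify_deriv :: "real \<Rightarrow> ('a::euclidean_space \<Rightarrow> real) \<Rightarrow> 'a \<Rightarrow> 'a \<Rightarrow> real" where
  "mollify_deriv \<epsilon> W x h = (LINT y|lborel. W y * frechet_derivative (mollifier \<epsilon>) (at (x - y)) h)"

context
  fixes \<epsilon> :: real and W :: "'a::euclidean_space \<Rightarrow> real"
  assumes \<epsilon>: "0 < \<epsilon>" and W: "integrable lborel W"
begin

private lemma mollifier_outside: "(x::'a) \<notin> cball 0 \<epsilon> \<Longrightarrow> mollifier \<epsilon> x = 0"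
  using mollifier_eq_0[OF \<epsilon>, of x] by simp

lemma mollify_has_directional_derivative:
  "((\<lambda>s. mollify \<epsilon> W (x + s *\<^sub>R h)) has_real_derivative mollify_deriv \<epsilon> W (x + s *\<^sub>R h) h) (at s)"
  using convolution_has_directional_derivative(1)[where S="cball 0 \<epsilon>" and a="-1",
      OF W Ck_function_mollifier[of "Suc 0" \<epsilon>] mollifier_outside compact_cball, of x h s]
  by (simp add: mollify_def[abs_def] mollify_deriv_def)

lemma integrable_mollify_deriv:
  "integrable lborel (\<lambda>y. W y * frechet_derivative (mollifier \<epsilon>) (at (x - y)) h)"
  using convolution_has_directional_derivative(2)[where S="cball 0 \<epsilon>" and a="-1" and s=0,
      OF W Ck_function_mollifier[of "Suc 0" \<epsilon>] mollifier_outside compact_cball, of x h]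
  by simp

lemma linear_frechet_derivative_mollifier: "linear (frechet_derivative (mollifier \<epsilon>) (at (x :: 'a)))"
  using Ck_function_has_derivative[OF Ck_function_mollifier[of "Suc 0" \<epsilon>]] has_derivative_linear by blast

lemma linear_mollify_deriv: "linear (mollify_deriv \<epsilon> W x)"
proof (rule linearI)
  fix h k :: 'a and c :: real
  show "mollify_deriv \<epsilon> W x (h + k) = mollify_deriv \<epsilon> W x h + mollify_deriv \<epsilon> W x k"
    unfolding mollify_deriv_def linear_add[OF linear_frechet_derivative_mollifier] distrib_left
    by (intro Bochner_Integration.integral_add integrable_mollify_deriv)
  show "mollify_deriv \<epsilon> W x (c *\<^sub>R h) = c *\<^sub>R mollify_deriv \<epsilon> W x h"
    unfolding mollify_deriv_def linear_scale[OF linear_frechet_derivative_mollifier]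
    by (simp add: mult.left_commute)
qed

text \<open>A crude bound that degenerates with \<epsilon>. It only provides domination when V is
  differentiated under the integral; the sharp bound on the gradient comes from the Lipschitz
  property of W.\<close>

lemma mollify_deriv_bounded:
  obtains C where "0 \<le> C" "\<And>x h. \<bar>mollify_deriv \<epsilon> W x h\<bar> \<le> C * norm h"
proof -
  obtain C where "0 \<le> C" and C: "\<And>x h. \<bar>frechet_derivative (mollifier \<epsilon>) (at (x :: 'a)) h\<bar> \<le> C * norm h"
    using frechet_derivative_bounded[OF Ck_function_mollifier mollifier_outside compact_cball] by blast
  show thesis
  proof (rule that)
    show "0 \<le> (LINT y|lborel. \<bar>W y\<bar>) * C" using \<open>0 \<le> C\<close> by simp
    fix x h
    have "\<bar>mollify_deriv \<epsilon> W x h\<bar> \<le> (LINT y|lborel. \<bar>W y * frechet_derivative (mollifier \<epsilon>) (at (x - y)) h\<bar>)"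
      unfolding mollify_deriv_def by (rule integral_abs_bound)
    also have "\<dots> \<le> (LINT y|lborel. \<bar>W y\<bar> * (C * norm h))"
    proof (rule integral_mono)
      show "integrable lborel (\<lambda>y. \<bar>W y * frechet_derivative (mollifier \<epsilon>) (at (x - y)) h\<bar>)"
        using integrable_mollify_deriv by (rule integrable_abs)
      show "integrable lborel (\<lambda>y. \<bar>W y\<bar> * (C * norm h))"
        using W by simp
    qed (simp add: abs_mult mult_left_mono C)
    finally show "\<bar>mollify_deriv \<epsilon> W x h\<bar> \<le> (LINT y|lborel. \<bar>W y\<bar>) * C * norm h" by simp
  qed
qed

lemma borel_measurable_mollify: "mollify \<epsilon> W \<in> borel_measurable borel"
proof -
  have [measurable]: "mollifier \<epsilon> \<in> borel_measurable (borel :: 'a measure)"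
    using Ck_function_continuous_on[OF Ck_function_mollifier] borel_measurable_continuous_onI by blast
  have [measurable]: "W \<in> borel_measurable borel" using W by auto
  show ?thesis unfolding mollify_def[abs_def] by measurable
qed

lemma borel_measurable_mollify_deriv:
  assumes "i \<in> Basis" shows "(\<lambda>x. mollify_deriv \<epsilon> W x i) \<in> borel_measurable borel"
proof -
  have "continuous_on UNIV (\<lambda>x::'a. frechet_derivative (mollifier \<epsilon>) (at x) i)"
    using Ck_function_mollifier[of "Suc 0" \<epsilon>] assms by auto
  then have [measurable]: "(\<lambda>x::'a. frechet_derivative (mollifier \<epsilon>) (at x) i) \<in> borel_measurable borel"
    by (rule borel_measurable_continuous_onI)
  have [measurable]: "W \<in> borel_measurable borel" using W by auto
  have [measurable]: "(\<lambda>p. frechet_derivative (mollifier \<epsilon>) (at (fst p - snd p)) i) \<in> borel_measurable (borel \<Otimes>\<^sub>M (borel :: 'a measure))"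
    using measurable_compose[of "\<lambda>p. fst p - snd p" "borel \<Otimes>\<^sub>M (borel :: 'a measure)" borel
        "\<lambda>x. frechet_derivative (mollifier \<epsilon>) (at x) i"] by measurable
  have "case_prod (\<lambda>x y. W y * frechet_derivative (mollifier \<epsilon>) (at (x - y)) i)
      \<in> borel_measurable (borel \<Otimes>\<^sub>M (borel :: 'a measure))"
    unfolding case_prod_beta by measurable
  then have "case_prod (\<lambda>x y. W y * frechet_derivative (mollifier \<epsilon>) (at (x - y)) i)
      \<in> borel_measurable (borel \<Otimes>\<^sub>M lborel)"
    by simp
  then show ?thesis
    unfolding mollify_deriv_def by (rule lborel.borel_measurable_lebesgue_integral)
qed

text \<open>Integration by parts against a test function: both sides are the derivative at \<open>0\<close> of
  \<open>s \<mapsto> \<integral> V(y) \<phi>(y + s i) dy = \<integral> V(y - s i) \<phi>(y) dy\<close>.\<close>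
lemma weak_gradient_mollify:
  assumes "open \<Omega>" and B: "\<And>x. \<bar>W x\<bar> \<le> B" and R: "\<And>x. R \<le> norm x \<Longrightarrow> W x = 0"
  shows "weak_gradient \<Omega> (mollify \<epsilon> W) (\<lambda>x. \<Sum>i\<in>Basis. mollify_deriv \<epsilon> W x i *\<^sub>R i)"
  unfolding weak_gradient_def
proof (intro allI impI ballI)
  fix \<phi> :: "'a \<Rightarrow> real" and i :: 'a assume "test_function \<Omega> \<phi>" and i: "i \<in> Basis"
  define S where "S = closure {x. \<phi> x \<noteq> 0}"
  define V where "V = mollify \<epsilon> W"
  define DV where "DV = mollify_deriv \<epsilon> W"
  have \<phi>: "Ck_function k \<phi>" and S: "compact S" "S \<subseteq> \<Omega>" for k
    using \<open>test_function \<Omega> \<phi>\<close> by (auto simp: test_function_def smooth_function_def S_def)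
  have \<phi>0: "\<phi> x = 0" if "x \<notin> S" for x
    using that closure_subset[of "{x. \<phi> x \<noteq> 0}"] by (auto simp: S_def)
  have D\<phi>0: "frechet_derivative \<phi> (at x) i = 0" if "x \<notin> S" for x
  proof -
    have "((\<lambda>_. 0) has_derivative (\<lambda>_. 0)) (at x)" by simp
    then have "(\<phi> has_derivative (\<lambda>_. 0)) (at x)"
      by (rule has_derivative_transform_within_open[of _ _ _ _ "- S"])
        (use that S \<phi>0 in \<open>auto simp: compact_imp_closed open_Compl\<close>)
    then show ?thesis by (metis frechet_derivative_at)
  qed
  have [measurable]: "\<phi> \<in> borel_measurable borel"
    using Ck_function_continuous_on[OF \<phi>] borel_measurable_continuous_onI by blast
  have "continuous_on UNIV (\<lambda>x. frechet_derivative \<phi> (at x) i)"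
    using \<phi>[of "Suc 0"] i by auto
  then have [measurable]: "(\<lambda>x. frechet_derivative \<phi> (at x) i) \<in> borel_measurable borel"
    by (rule borel_measurable_continuous_onI)
  have [measurable]: "V \<in> borel_measurable borel" unfolding V_def by (rule borel_measurable_mollify)
  have [measurable]: "(\<lambda>x. DV x i) \<in> borel_measurable borel"
    unfolding DV_def by (rule borel_measurable_mollify_deriv[OF i])
  obtain b where "0 < b" and b: "\<And>x. x \<in> S \<Longrightarrow> norm x \<le> b"
    using compact_imp_bounded[OF S(1)] unfolding bounded_pos by blast
  obtain C\<phi> where "0 \<le> C\<phi>" and C\<phi>: "\<And>x. \<bar>\<phi> x\<bar> \<le> C\<phi>"
    using kernel_bounded[OF \<phi>[of 0] \<phi>0 S(1)] by blast
  have \<phi>int: "integrable lborel \<phi>"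
  proof (rule integrable_bounded_support[OF _ C\<phi>])
    fix x :: 'a assume "b + 1 \<le> norm x"
    then have "x \<notin> S" using b[of x] by auto
    then show "\<phi> x = 0" by (rule \<phi>0)
  qed simp
  have Wm: "W \<in> borel_measurable borel" using W by auto
  have VB: "\<bar>V x\<bar> \<le> B" for x
    unfolding V_def by (rule mollify_bounded[OF \<epsilon> Wm B])
  have V0: "V x = 0" if "R + \<epsilon> \<le> norm x" for x
  proof -
    have "W y * mollifier \<epsilon> (x - y) = 0" for y
    proof (cases "R \<le> norm y")
      case False
      then have "\<epsilon> \<le> norm (x - y)" using that norm_triangle_ineq2[of x y] by linarith
      then show ?thesis using mollifier_eq_0[OF \<epsilon>, of "x - y"] by simp
    qed (simp add: R)
    then show ?thesis unfolding V_def mollify_def by (simp only: Bochner_Integration.integral_zero)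
  qed
  have Vint: "integrable lborel V"
    by (rule integrable_bounded_support[OF _ VB V0]) simp
  obtain C where "0 \<le> C" and C: "\<And>x h. \<bar>DV x h\<bar> \<le> C * norm h"
    unfolding DV_def using mollify_deriv_bounded by blast
  have 1: "((\<lambda>s. LINT y|lborel. V y * \<phi> (s *\<^sub>R i + y)) has_real_derivative
      (LINT y|lborel. V y * frechet_derivative \<phi> (at y) i)) (at 0)"
    using convolution_has_directional_derivative(1)[where S=S and a=1 and x=0 and s=0 and h=i,
      OF Vint \<phi> \<phi>0 S(1)] by simp
  have "(LINT y|lborel. V y * \<phi> (s *\<^sub>R i + y)) = (LINT y|lborel. \<phi> y * V (y - s *\<^sub>R i))" for s
    by (subst lborel_integral_affine_unit[symmetric, of _ 1 "- s *\<^sub>R i"]) (auto simp: algebra_simps)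
  moreover have "((\<lambda>s. LINT y|lborel. \<phi> y * V (y - s *\<^sub>R i)) has_real_derivative
      (LINT y|lborel. \<phi> y * - DV (y - 0 *\<^sub>R i) i)) (at 0)"
  proof (rule has_real_derivative_integral(1)[OF \<phi>int])
    fix s and y :: 'a
    \<comment> \<open>Subtracting s i means moving in direction -i, and linearity of the derivative
      turns this into the minus sign of the integration by parts.\<close>
    have "((\<lambda>s. V (y + s *\<^sub>R (- i))) has_real_derivative DV (y + s *\<^sub>R (- i)) (- i)) (at s)"
      unfolding V_def DV_def by (rule mollify_has_directional_derivative)
    then show "((\<lambda>s. V (y - s *\<^sub>R i)) has_real_derivative - DV (y - s *\<^sub>R i) i) (at s)"
      unfolding DV_def linear_neg[OF linear_mollify_deriv] by simp
    show "\<bar>- DV (y - s *\<^sub>R i) i\<bar> \<le> C"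
      using C[of "y - s *\<^sub>R i" i] i by simp
    show "(\<lambda>y. V (y - s *\<^sub>R i)) \<in> borel_measurable lborel" by measurable
    show "integrable lborel (\<lambda>y. \<phi> y * V (y - s *\<^sub>R i))"
    proof (rule integrable_bounded_support)
      show "\<bar>\<phi> x * V (x - s *\<^sub>R i)\<bar> \<le> C\<phi> * B" for x
        using C\<phi> VB \<open>0 \<le> C\<phi>\<close> by (auto simp: abs_mult intro!: mult_mono)
      fix x :: 'a assume "b + 1 \<le> norm x"
      then have "x \<notin> S" using b[of x] by auto
      then show "\<phi> x * V (x - s *\<^sub>R i) = 0" using \<phi>0 by simp
    qed measurable
  qed
  ultimately have 2: "(LINT y|lborel. V y * frechet_derivative \<phi> (at y) i) = (LINT y|lborel. \<phi> y * - DV y i)"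
    using DERIV_unique[OF 1] by simp
  have "(LINT x|lebesgue_on \<Omega>. V x * frechet_derivative \<phi> (at x) i)
      = (LINT y|lborel. V y * frechet_derivative \<phi> (at y) i)"
    by (rule lebesgue_on_eq_lborel(1)[OF \<open>open \<Omega>\<close>]) (use D\<phi>0 S(2) in auto)
  moreover have "(LINT x|lebesgue_on \<Omega>. ((\<Sum>j\<in>Basis. DV x j *\<^sub>R j) \<bullet> i) * \<phi> x) = (LINT y|lborel. \<phi> y * DV y i)"
    by (rule lebesgue_on_eq_lborel(1)[OF \<open>open \<Omega>\<close>])
      (use \<phi>0 S(2) i in \<open>auto simp: inner_sum_left inner_Basis if_distrib[of "\<lambda>x. _ * x"] cong: if_cong\<close>)
  ultimately show "(LINT x|lebesgue_on \<Omega>. mollify \<epsilon> W x * frechet_derivative \<phi> (at x) i)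
      = - (LINT x|lebesgue_on \<Omega>. ((\<Sum>j\<in>Basis. mollify_deriv \<epsilon> W x j *\<^sub>R j) \<bullet> i) * \<phi> x)"
    using 2 by (simp add: V_def DV_def)
qed

end

text \<open>A Lipschitz bound at small scale suffices, because it already controls the difference
  quotients and hence the gradient. It is not asked of distant points, where it may fail: the W in
  question is 1-Lipschitz along segments inside a neighbourhood of a domain that need not be
  convex.\<close>

lemma mollify_in_A_inf:
  fixes \<Omega> :: "'a::euclidean_space set"
  assumes "open \<Omega>" "bounded \<Omega>" and "0 < \<epsilon>" "0 < \<delta>"
    and Wm: "W \<in> borel_measurable borel" and B: "\<And>x. \<bar>W x\<bar> \<le> B" and R: "\<And>x. R \<le> norm x \<Longrightarrow> W x = 0"
    and lip: "\<And>x x' z. x \<in> closure \<Omega> \<Longrightarrow> dist x x' < \<delta> \<Longrightarrow> norm z < \<epsilon> \<Longrightarrow> \<bar>W (x - z) - W (x' - z)\<bar> \<le> dist x x'"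
  shows "mollify \<epsilon> W \<in> A_inf \<Omega>"
proof -
  have W: "integrable lborel W" by (rule integrable_bounded_support[OF Wm B R])
  define V where "V = mollify \<epsilon> W"
  define DV where "DV = mollify_deriv \<epsilon> W"
  define G where "G x = (\<Sum>i\<in>Basis. DV x i *\<^sub>R i)" for x
  have lipV: "\<bar>V x - V x'\<bar> \<le> dist x x'" if "x \<in> closure \<Omega>" "dist x x' < \<delta>" for x x'
    unfolding V_def using lip[OF that] by (rule mollify_lipschitz[OF \<open>0 < \<epsilon>\<close> Wm B])
  have contV: "continuous_on (closure \<Omega>) V"
    unfolding continuous_on_iff
  proof (intro ballI allI impI)
    fix x \<eta> assume "x \<in> closure \<Omega>" "(0::real) < \<eta>"
    then show "\<exists>d>0. \<forall>x'\<in>closure \<Omega>. dist x' x < d \<longrightarrow> dist (V x') (V x) < \<eta>"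
      using \<open>0 < \<delta>\<close> lipV[of x]
      by (intro exI[of _ "min \<delta> \<eta>"]) (force simp: dist_real_def dist_commute abs_minus_commute)
  qed
  have lin: "linear (DV x)" for x unfolding DV_def by (rule linear_mollify_deriv[OF \<open>0 < \<epsilon>\<close> W])
  have DV1: "\<bar>DV x h\<bar> \<le> norm h" if "x \<in> closure \<Omega>" for x h
  proof -
    have "((\<lambda>s. V (x + s *\<^sub>R h)) has_real_derivative DV (x + 0 *\<^sub>R h) h) (at 0)"
      unfolding V_def DV_def by (rule mollify_has_directional_derivative[OF \<open>0 < \<epsilon>\<close> W])
    then have "((\<lambda>s. (V (x + s *\<^sub>R h) - V x) / s) \<longlongrightarrow> DV x h) (at 0)"
      by (simp add: DERIV_def)
    then have lim: "((\<lambda>s. \<bar>(V (x + s *\<^sub>R h) - V x) / s\<bar>) \<longlongrightarrow> \<bar>DV x h\<bar>) (at 0)"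
      by (rule tendsto_rabs)
    have "((\<lambda>s::real. norm (s *\<^sub>R h)) \<longlongrightarrow> 0) (at 0)"
      by (auto intro!: tendsto_eq_intros)
    then have "\<forall>\<^sub>F s in at 0. norm (s *\<^sub>R h) < \<delta>"
      using \<open>0 < \<delta>\<close> by (rule order_tendstoD)
    then have "\<forall>\<^sub>F s in at 0. \<bar>(V (x + s *\<^sub>R h) - V x) / s\<bar> \<le> norm h"
      using eventually_neq_at_within[of 0]
    proof eventually_elim
      case (elim s)
      have "\<bar>V x - V (x + s *\<^sub>R h)\<bar> \<le> \<bar>s\<bar> * norm h"
        using lipV[OF that, of "x + s *\<^sub>R h"] elim by (simp add: dist_norm)
      then show ?case
        using elim by (simp add: abs_minus_commute pos_divide_le_eq mult.commute)
    qed
    then show ?thesis using tendsto_upperbound[OF lim] by simp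
  qed
  have Gh: "G x \<bullet> h = DV x h" for x h
  proof -
    have "G x \<bullet> h = (\<Sum>i\<in>Basis. DV x i * (i \<bullet> h))"
      by (simp add: G_def inner_sum_left)
    also have "\<dots> = (\<Sum>i\<in>Basis. (h \<bullet> i) * DV x i)"
      by (simp add: inner_commute mult.commute)
    also have "\<dots> = DV x (\<Sum>i\<in>Basis. (h \<bullet> i) *\<^sub>R i)"
      by (simp add: linear_sum[OF lin] linear_scale[OF lin])
    finally show ?thesis by (simp add: euclidean_representation)
  qed
  have G1: "norm (G x) \<le> 1" if "x \<in> \<Omega>" for x
  proof -
    \<comment> \<open>The directional bound is tested in the direction of the gradient
      itself.\<close>
    have "G x \<bullet> G x \<le> norm (G x)"
      using DV1[of x "G x"] that closure_subset[of \<Omega>] by (auto simp: Gh)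
    then have "norm (G x) * norm (G x) \<le> norm (G x)"
      by (simp add: power2_eq_square flip: power2_norm_eq_inner)
    then show ?thesis using mult_le_cancel_right2[of "norm (G x)" "norm (G x)"] by (cases "G x = 0") auto
  qed
  have [measurable]: "V \<in> borel_measurable borel"
    unfolding V_def by (rule borel_measurable_mollify[OF \<open>0 < \<epsilon>\<close> W])
  have [measurable]: "G \<in> borel_measurable borel"
    unfolding G_def DV_def
    by (intro borel_measurable_sum borel_measurable_scaleR borel_measurable_mollify_deriv[OF \<open>0 < \<epsilon>\<close> W]) auto
  have meas: "V \<in> borel_measurable (lebesgue_on \<Omega>)" "G \<in> borel_measurable (lebesgue_on \<Omega>)"
    by (intro measurable_restrict_space1 measurable_completion; simp)+
  have VB: "\<bar>V x\<bar> \<le> B" for x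
    unfolding V_def by (rule mollify_bounded[OF \<open>0 < \<epsilon>\<close> Wm B])
  have sp: "space (lebesgue_on \<Omega>) = \<Omega>" by simp
  have AEG: "AE x in lebesgue_on \<Omega>. norm (G x) \<le> 1"
    using G1 by (intro AE_I2) (simp add: sp)
  have "V \<in> Linf_on \<Omega>"
    using meas VB by (auto simp: Linf_on_def intro!: exI[of _ B])
  moreover have "G \<in> Linf_on \<Omega>"
    using meas AEG by (auto simp: Linf_on_def intro!: exI[of _ 1])
  moreover have "weak_gradient \<Omega> V G"
    unfolding V_def G_def[abs_def] DV_def by (rule weak_gradient_mollify[OF \<open>0 < \<epsilon>\<close> W \<open>open \<Omega>\<close> B R])
  ultimately have "W1inf_with_gradient \<Omega> V G" by (simp add: W1inf_with_gradient_def)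
  moreover have "continuous_on (frontier \<Omega>) V"
    using contV by (rule continuous_on_subset) (auto simp: frontier_def)
  ultimately show ?thesis
    using contV AEG by (auto simp: A_inf_def V_def[symmetric])
qed

section \<open>Approximation of admissible functions\<close>

text \<open>A curve of length at most l is encoded as a 1-Lipschitz map on \<open>{0..l}\<close>.
  Length and equicontinuity are then both at hand, so limits of curves can be taken without any
  reparametrisation.\<close>

definition curve_costs :: "'a::euclidean_space set \<Rightarrow> ('a \<Rightarrow> real) \<Rightarrow> 'a set \<Rightarrow> 'a \<Rightarrow> real set" where
  "curve_costs F w U x = {w (\<gamma> 0) + l | l \<gamma>. 0 \<le> l \<and> 1-lipschitz_on {0..l} \<gamma> \<and> \<gamma> ` {0..l} \<subseteq> U \<and>
     \<gamma> 0 \<in> F \<and> \<gamma> l = x}"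

text \<open>The cut-off at \<open>M\<close> keeps the value bounded when no curve in \<open>U\<close> joins \<open>F\<close> to \<open>x\<close>.\<close>
definition inf_convolution :: "'a::euclidean_space set \<Rightarrow> ('a \<Rightarrow> real) \<Rightarrow> real \<Rightarrow> 'a set \<Rightarrow> 'a \<Rightarrow> real" where
  "inf_convolution F w M U x = Inf (insert M (curve_costs F w U x))"

context
  fixes F :: "'a::euclidean_space set" and w :: "'a \<Rightarrow> real" and M :: real
  assumes w: "\<And>y. y \<in> F \<Longrightarrow> \<bar>w y\<bar> \<le> M" and M: "0 \<le> M"
begin

private lemma costs_lower: "c \<in> insert M (curve_costs F w U x) \<Longrightarrow> - M \<le> c"
  using M by (auto simp: curve_costs_def dest!: w)

private lemma costs_bdd_below: "bdd_below (insert M (curve_costs F w U x))"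
  using costs_lower by (meson bdd_belowI)

lemma inf_convolution_le: "c \<in> insert M (curve_costs F w U x) \<Longrightarrow> inf_convolution F w M U x \<le> c"
  unfolding inf_convolution_def using costs_bdd_below by (rule cInf_lower[rotated])

lemma inf_convolution_bounded: "\<bar>inf_convolution F w M U x\<bar> \<le> M"
proof -
  have "- M \<le> inf_convolution F w M U x"
    unfolding inf_convolution_def using costs_lower by (intro cInf_greatest) auto
  moreover have "inf_convolution F w M U x \<le> M" by (rule inf_convolution_le) simp
  ultimately show ?thesis by simp
qed

lemma inf_convolution_le_boundary:
  assumes "x \<in> F" "x \<in> U" shows "inf_convolution F w M U x \<le> w x"
proof (rule inf_convolution_le)
  have "w x + 0 \<in> curve_costs F w U x"
    unfolding curve_costs_def using assms
    by (intro CollectI exI[of _ 0] exI[of _ "\<lambda>_. x"]) auto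
  then show "w x \<in> insert M (curve_costs F w U x)" by simp
qed

lemma curve_costs_extend:
  assumes "c \<in> curve_costs F w U x" and seg: "closed_segment x x' \<subseteq> U"
  shows "c + dist x x' \<in> curve_costs F w U x'"
proof (cases "x = x'")
  case False
  define d where "d = dist x x'"
  have "d > 0" using False by (simp add: d_def)
  obtain l \<gamma> where c: "c = w (\<gamma> 0) + l" and l: "0 \<le> l" and \<gamma>: "1-lipschitz_on {0..l} \<gamma>" "\<gamma> ` {0..l} \<subseteq> U"
    "\<gamma> 0 \<in> F" "\<gamma> l = x"
    using assms(1) unfolding curve_costs_def by blast
  define e where "e t = x + ((t - l) / d) *\<^sub>R (x' - x)" for t
  define \<gamma>' where "\<gamma>' t = (if t \<le> l then \<gamma> t else e t)" for t
  have "1-lipschitz_on {l..l + d} e"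
  proof (rule lipschitz_onI)
    fix s t
    have "e s - e t = ((s - t) / d) *\<^sub>R (x' - x)"
      by (simp add: e_def diff_divide_distrib flip: scaleR_left_diff_distrib)
    then have "dist (e s) (e t) = \<bar>s - t\<bar> / d * dist x x'"
      using \<open>d > 0\<close> by (simp add: dist_norm norm_minus_commute)
    also have "\<dots> = dist s t" using \<open>d > 0\<close> by (simp add: d_def[symmetric] dist_real_def)
    finally show "dist (e s) (e t) \<le> 1 * dist s t" by simp
  qed simp
  then have "1-lipschitz_on {0..l + d} \<gamma>'"
    unfolding \<gamma>'_def using \<gamma> by (intro lipschitz_on_concat) (auto simp: e_def)
  moreover have "\<gamma>' ` {0..l + d} \<subseteq> U"
  proof (rule image_subsetI)
    fix t assume t: "t \<in> {0..l + d}"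
    show "\<gamma>' t \<in> U"
    proof (cases "t \<le> l")
      case True
      then show ?thesis using t \<gamma>(2) by (auto simp: \<gamma>'_def)
    next
      case False
      define u where "u = (t - l) / d"
      have "0 \<le> u" "u \<le> 1" using False t \<open>d > 0\<close> by (auto simp: u_def)
      moreover have "e t = (1 - u) *\<^sub>R x + u *\<^sub>R x'"
        by (simp add: e_def u_def algebra_simps)
      ultimately have "e t \<in> closed_segment x x'" by (auto simp: in_segment)
      then show ?thesis using False seg by (auto simp: \<gamma>'_def)
    qed
  qed
  moreover have "\<gamma>' 0 = \<gamma> 0" using l by (simp add: \<gamma>'_def)
  moreover have "\<gamma>' (l + d) = x'" using \<open>d > 0\<close> by (simp add: \<gamma>'_def e_def)
  moreover have "c + dist x x' = w (\<gamma>' 0) + (l + d)" using c \<open>\<gamma>' 0 = \<gamma> 0\<close> by (simp add: d_def)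
  ultimately show ?thesis
    unfolding curve_costs_def using l \<open>d > 0\<close> \<gamma>(3)
    by (intro CollectI exI[of _ "l + d"] exI[of _ \<gamma>']) simp
qed (use assms in simp)

text \<open>A curve ending at one point is prolonged by the segment to the other one, at an
  additional cost equal to their distance. The cut-off value is the same at both points and cannot
  spoil the comparison.\<close>

lemma inf_convolution_lipschitz:
  assumes "closed_segment x x' \<subseteq> U"
  shows "\<bar>inf_convolution F w M U x - inf_convolution F w M U x'\<bar> \<le> dist x x'"
proof -
  have "inf_convolution F w M U b - dist a b \<le> inf_convolution F w M U a"
    if seg: "closed_segment a b \<subseteq> U" for a b
    unfolding inf_convolution_def[of F w M U a]
  proof (rule cInf_greatest)
    fix c assume c: "c \<in> insert M (curve_costs F w U a)"
    then consider "c = M" | "c \<in> curve_costs F w U a" by blast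
    then show "inf_convolution F w M U b - dist a b \<le> c"
    proof cases
      case 1
      moreover have "inf_convolution F w M U b \<le> M" by (rule inf_convolution_le) simp
      ultimately show ?thesis using zero_le_dist[of a b] by linarith
    next
      case 2
      then have "inf_convolution F w M U b \<le> c + dist a b"
        using curve_costs_extend[OF _ seg] by (intro inf_convolution_le) simp
      then show ?thesis by simp
    qed
  qed simp
  from this[of x x'] this[of x' x] show ?thesis
    using assms by (simp add: closed_segment_commute dist_commute abs_le_iff)
qed

end

text \<open>If the values stayed below \<open>w x\<close> by a fixed amount, the curves realising them would converge,
  by the Arzela-Ascoli theorem, to a curve in \<open>closure \<Omega>\<close> that is too short.\<close>
lemma inf_convolution_lower_bound:
  fixes \<Omega> :: "'a::euclidean_space set"
  assumes "bounded \<Omega>" "\<Omega> \<noteq> {}" and w: "w \<in> dual_admissible \<Omega>"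
    and wc: "continuous_on (frontier \<Omega>) w"
    and M: "\<And>y. y \<in> frontier \<Omega> \<Longrightarrow> \<bar>w y\<bar> \<le> M" "0 \<le> M"
    and x: "x \<in> frontier \<Omega>" and "0 < \<epsilon>"
  shows "\<exists>\<delta>0>0. \<forall>\<delta>. 0 < \<delta> \<and> \<delta> \<le> \<delta>0 \<longrightarrow>
    w x - \<epsilon> \<le> inf_convolution (frontier \<Omega>) w M {z. infdist z (closure \<Omega>) < \<delta>} x"
proof (rule ccontr)
  let ?K = "closure \<Omega>" and ?U = "\<lambda>\<delta>. {z. infdist z (closure \<Omega>) < \<delta>}"
  have K: "closed ?K" "?K \<noteq> {}" "bounded ?K" using assms(1,2) by auto
  assume neg: "\<not> ?thesis"
  have "\<exists>\<delta> l \<gamma>. 0 < \<delta> \<and> \<delta> \<le> inverse (real (Suc n)) \<and> 0 \<le> l \<and> 1-lipschitz_on {0..l} \<gamma> \<and> \<gamma> ` {0..l} \<subseteq> ?U \<delta> \<and>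
     \<gamma> 0 \<in> frontier \<Omega> \<and> \<gamma> l = x \<and> w (\<gamma> 0) + l < w x - \<epsilon>" for n
  proof -
    have "0 < inverse (real (Suc n))" by simp
    then obtain \<delta> where \<delta>: "0 < \<delta>" "\<delta> \<le> inverse (real (Suc n))"
      and less: "inf_convolution (frontier \<Omega>) w M (?U \<delta>) x < w x - \<epsilon>"
      using neg by (meson not_le)
    have "\<exists>c\<in>insert M (curve_costs (frontier \<Omega>) w (?U \<delta>) x). c < w x - \<epsilon>"
      by (rule cInf_lessD) (use less in \<open>simp_all add: inf_convolution_def\<close>)
    then obtain c where c: "c \<in> insert M (curve_costs (frontier \<Omega>) w (?U \<delta>) x)" "c < w x - \<epsilon>"
      by blast
    \<comment> \<open>The cheap cost c cannot be the cut-off value, since M is at least w x.\<close>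
    moreover have "w x \<le> M" using M(1)[OF x] by simp
    ultimately have "c \<in> curve_costs (frontier \<Omega>) w (?U \<delta>) x" using \<open>0 < \<epsilon>\<close> by auto
    then show ?thesis using \<delta> c(2) unfolding curve_costs_def by blast
  qed
  then obtain \<delta> l \<gamma> where \<delta>: "\<And>n. 0 < \<delta> n" "\<And>n. \<delta> n \<le> inverse (real (Suc n))"
    and l0: "\<And>n::nat. 0 \<le> l n" and lip: "\<And>n. 1-lipschitz_on {0..l n} (\<gamma> n)"
    and sub: "\<And>n. \<gamma> n ` {0..l n} \<subseteq> ?U (\<delta> n)"
    and start: "\<And>n. \<gamma> n 0 \<in> frontier \<Omega>" and fin: "\<And>n. \<gamma> n (l n) = x"
    and cost: "\<And>n. w (\<gamma> n 0) + l n < w x - \<epsilon>"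
    by metis
  \<comment> \<open>Each length is below w x minus the value of w at the starting point, and both
    values have modulus at most M.\<close>
  define L where "L = 2 * M"
  have lL: "l n \<le> L" for n
    using cost[of n] M(1)[OF x] M(1)[OF start[of n]] \<open>0 < \<epsilon>\<close> by (simp add: L_def abs_le_iff)
  \<comment> \<open>The curves have different parameter intervals. Resting at the end point x after
    time \<open>l n\<close> puts all of them on \<open>{0..L}\<close> and keeps them
    1-Lipschitz.\<close>
  define c where "c n t = \<gamma> n (min t (l n))" for n t
  have clip: "dist (c n s) (c n t) \<le> dist s t" if "s \<in> {0..L}" "t \<in> {0..L}" for n s t
  proof -
    have "dist (c n s) (c n t) \<le> 1 * dist (min s (l n)) (min t (l n))"
      unfolding c_def using that l0[of n] by (intro lipschitz_onD[OF lip]) auto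
    also have "\<dots> \<le> dist s t" by (auto simp: dist_real_def min_def)
    finally show ?thesis .
  qed
  have cU: "infdist (c n t) ?K < inverse (real (Suc n))" if "t \<in> {0..L}" for n t
  proof -
    have "min t (l n) \<in> {0..l n}" using that l0[of n] by simp
    then have "c n t \<in> ?U (\<delta> n)" using sub[of n] unfolding c_def by blast
    then show ?thesis using \<delta>(2)[of n] by simp
  qed
  have start': "c n 0 = \<gamma> n 0" and fin': "c n (l n) = x" for n
    using l0[of n] fin by (simp_all add: c_def)
  obtain b where b: "\<And>z. z \<in> ?K \<Longrightarrow> norm z \<le> b" using K(3) unfolding bounded_iff by blast
  have bd: "norm (c n t) \<le> b + L" if t: "t \<in> {0..L}" for n t
  proof -
    have "0 \<in> {0..L}" using t by simp
    then have "dist (c n t) (c n 0) \<le> L" using clip[OF t, of 0 n] t by (simp add: dist_real_def)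
    moreover have "norm (c n 0) \<le> b"
      using start b by (simp add: start' frontier_def)
    ultimately show ?thesis
      using norm_triangle_sub[of "c n t" "c n 0"] by (simp add: dist_norm)
  qed
  have equi: "\<exists>d>0. \<forall>n t. t \<in> {0..L} \<and> norm (s - t) < d \<longrightarrow> norm (c n s - c n t) < e"
    if "s \<in> {0..L}" "0 < e" for s e
    using clip[OF that(1)] that(2)
    by (intro exI[of _ e]) (auto simp: dist_norm intro: le_less_trans)
  have "\<exists>g k. strict_mono (k :: nat \<Rightarrow> nat) \<and>
      (\<forall>e>0. \<exists>N. \<forall>n t. n \<ge> N \<and> t \<in> {0..L} \<longrightarrow> norm (c (k n) t - g t) < e)"
  proof (rule Arzela_Ascoli[of "{0..L}" c "b + L", OF compact_Icc])
    show "norm (c n t) \<le> b + L" if "t \<in> {0..L}" for n t using that by (rule bd)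
    show "\<exists>d>0. \<forall>n t. t \<in> {0..L} \<and> norm (s - t) < d \<longrightarrow> norm (c n s - c n t) < e"
      if "s \<in> {0..L}" "0 < e" for s e using that by (rule equi)
  qed blast
  then obtain g k where k: "strict_mono (k :: nat \<Rightarrow> nat)"
    and unif: "\<And>e. 0 < e \<Longrightarrow> \<exists>N. \<forall>n t. n \<ge> N \<and> t \<in> {0..L} \<longrightarrow> norm (c (k n) t - g t) < e"
    by blast
  have gk: "(\<lambda>n. c (k n) t) \<longlonglongrightarrow> g t" if "t \<in> {0..L}" for t
    unfolding LIMSEQ_iff using unif that by blast
  \<comment> \<open>A further subsequence makes the lengths converge too. Their limit m is the time
    at which the limit curve arrives at x.\<close>
  have "\<forall>n. l (k n) \<in> {0..L}" using l0 lL by auto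
  then obtain m r where r: "strict_mono (r :: nat \<Rightarrow> nat)" and m: "m \<in> {0..L}"
    and lm: "((\<lambda>n. l (k n)) \<circ> r) \<longlonglongrightarrow> m"
    using compact_Icc[of 0 L, unfolded compact_def] by metis
  define j where "j n = k (r n)" for n
  have j: "strict_mono j" using k r by (simp add: j_def strict_mono_def)
  have gj: "(\<lambda>n. c (j n) t) \<longlonglongrightarrow> g t" if "t \<in> {0..L}" for t
    using LIMSEQ_subseq_LIMSEQ[OF gk[OF that] r] by (simp add: o_def j_def)
  have lj: "(\<lambda>n. l (j n)) \<longlonglongrightarrow> m" using lm by (simp add: o_def j_def)
  have "0 \<le> m" "m \<le> L" using m by auto
  have g0: "(\<lambda>n. c (j n) 0) \<longlonglongrightarrow> g 0" using gj[of 0] \<open>0 \<le> m\<close> \<open>m \<le> L\<close> by simp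
  have gF: "g 0 \<in> frontier \<Omega>"
    by (rule closed_sequentially[OF frontier_closed _ g0]) (simp add: start' start)
  \<comment> \<open>The approximating curves reach x at time \<open>l (j n)\<close>, which tends to
    m; being 1-Lipschitz, they are close to x at time m.\<close>
  have "(\<lambda>n. dist (c (j n) m) x) \<longlonglongrightarrow> 0"
  proof (rule tendsto_sandwich[OF _ _ tendsto_const])
    have "dist (c (j n) m) x \<le> dist m (l (j n))" for n
      using clip[OF m, of "l (j n)" "j n"] l0[of "j n"] lL[of "j n"] fin'[of "j n"] by simp
    then show "\<forall>\<^sub>F n in sequentially. dist (c (j n) m) x \<le> dist m (l (j n))" by simp
    show "(\<lambda>n. dist m (l (j n))) \<longlonglongrightarrow> 0"
      using tendsto_dist[OF tendsto_const[of m] lj] by simp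
  qed simp
  moreover have "(\<lambda>n. dist (c (j n) m) x) \<longlonglongrightarrow> dist (g m) x"
    by (intro tendsto_dist gj m tendsto_const)
  ultimately have gm: "g m = x" using LIMSEQ_unique by force
  have glip: "dist (g s) (g t) \<le> dist s t" if "s \<in> {0..L}" "t \<in> {0..L}" for s t
  proof (rule LIMSEQ_le_const2)
    show "(\<lambda>n. dist (c (j n) s) (c (j n) t)) \<longlonglongrightarrow> dist (g s) (g t)"
      by (intro tendsto_dist gj that)
  qed (use clip that in blast)
  have gK: "g t \<in> ?K" if "t \<in> {0..L}" for t
  proof -
    have "(\<lambda>n. infdist (c (j n) t) ?K) \<longlonglongrightarrow> infdist (g t) ?K" by (intro tendsto_infdist gj that)
    moreover have "(\<lambda>n. infdist (c (j n) t) ?K) \<longlonglongrightarrow> 0"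
    proof (rule tendsto_sandwich[OF _ _ tendsto_const])
      show "\<forall>\<^sub>F n in sequentially. infdist (c (j n) t) ?K \<le> inverse (real (Suc (j n)))"
        using cU[OF that] by (intro always_eventually) (simp add: less_imp_le)
      show "(\<lambda>n. inverse (real (Suc (j n)))) \<longlonglongrightarrow> 0"
        using LIMSEQ_subseq_LIMSEQ[OF LIMSEQ_inverse_real_of_nat j] by (simp add: o_def)
    qed (simp add: infdist_nonneg)
    ultimately have "infdist (g t) ?K = 0" using LIMSEQ_unique by blast
    then show ?thesis using in_closed_iff_infdist_zero[OF K(1,2)] by blast
  qed
  \<comment> \<open>\<open>domain_dist\<close> is formulated with paths on the unit interval;
    rescaling makes m the Lipschitz constant and so a bound for the length.\<close>
  have "m-lipschitz_on {0..1} (\<lambda>s. g (m * s))"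
  proof (rule lipschitz_onI)
    fix s t :: real assume "s \<in> {0..1}" "t \<in> {0..1}"
    then have "m * s \<in> {0..L}" "m * t \<in> {0..L}"
      using \<open>0 \<le> m\<close> \<open>m \<le> L\<close> mult_left_le[of s m] mult_left_le[of t m] by auto
    then have "dist (g (m * s)) (g (m * t)) \<le> dist (m * s) (m * t)" by (rule glip)
    also have "\<dots> = m * dist s t"
      using \<open>0 \<le> m\<close> by (simp add: dist_real_def abs_mult flip: right_diff_distrib)
    finally show "dist (g (m * s)) (g (m * t)) \<le> m * dist s t" .
  qed (rule \<open>0 \<le> m\<close>)
  moreover have "(\<lambda>s. g (m * s)) ` {0..1} \<subseteq> ?K"
  proof (rule image_subsetI)
    fix s :: real assume "s \<in> {0..1}"
    then show "g (m * s) \<in> ?K"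
      using \<open>0 \<le> m\<close> \<open>m \<le> L\<close> mult_left_le[of s m] by (intro gK) auto
  qed
  ultimately have "domain_dist \<Omega> (g (m * 0)) (g (m * 1)) \<le> ennreal m"
    by (rule domain_dist_le_lipschitz)
  then have "domain_dist \<Omega> (g 0) x \<le> ennreal m" by (simp add: gm)
  moreover have "ennreal \<bar>w (g 0) - w x\<bar> \<le> domain_dist \<Omega> (g 0) x"
    using w gF x by (auto simp: dual_admissible_def)
  ultimately have "ennreal \<bar>w (g 0) - w x\<bar> \<le> ennreal m" by order
  then have "w x \<le> w (g 0) + m" using \<open>0 \<le> m\<close> by simp
  moreover have "w (g 0) + m \<le> w x - \<epsilon>"
  proof (rule LIMSEQ_le_const2)
    have "(\<lambda>n. w (c (j n) 0)) \<longlonglongrightarrow> w (g 0)"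
      by (rule continuous_on_tendsto_compose[OF wc g0 gF]) (simp add: start' start)
    then show "(\<lambda>n. w (c (j n) 0) + l (j n)) \<longlonglongrightarrow> w (g 0) + m"
      by (intro tendsto_add lj)
  qed (use cost in \<open>auto simp: start' intro!: less_imp_le\<close>)
  ultimately show False using \<open>0 < \<epsilon>\<close> by linarith
qed

lemma dual_admissible_approx:
  fixes \<Omega> :: "'a::euclidean_space set"
  assumes \<Omega>: "smooth_bounded_domain \<Omega>" and w: "w \<in> dual_admissible \<Omega>"
  obtains V M where "\<And>n::nat. V n \<in> A_inf \<Omega>" "\<And>n x. x \<in> frontier \<Omega> \<Longrightarrow> \<bar>V n x\<bar> \<le> M"
    "\<And>x. x \<in> frontier \<Omega> \<Longrightarrow> (\<lambda>n. V n x) \<longlonglongrightarrow> w x"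
proof -
  have "open \<Omega>" "bounded \<Omega>" "\<Omega> \<noteq> {}" using \<Omega> by (auto simp: smooth_bounded_domain_def)
  have wc: "continuous_on (frontier \<Omega>) w" by (rule dual_admissible_continuous_on[OF \<Omega> w])
  have cF: "compact (frontier \<Omega>)" using \<open>bounded \<Omega>\<close> by (rule compact_frontier_bounded)
  obtain M where "0 < M" and M: "\<And>y. y \<in> frontier \<Omega> \<Longrightarrow> \<bar>w y\<bar> \<le> M"
    using compact_imp_bounded[OF compact_continuous_image[OF wc cF]] unfolding bounded_pos by auto
  let ?K = "closure \<Omega>"
  define U where "U \<delta> = {z. infdist z ?K < \<delta>}" for \<delta>
  define d where "d n = inverse (real (Suc n))" for n
  have d0: "0 < d n" for n by (simp add: d_def)
  define J where "J n = inf_convolution (frontier \<Omega>) w M (U (d n))" for n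
  \<comment> \<open>Outside the neighbourhood nothing is known about the regularity of
    \<open>J n\<close>. Cutting it off there makes W Borel with bounded support, and the mollifier
    never sees the jump at points of the closure.\<close>
  define W where "W n x = indicator (U (d n)) x * J n x" for n x
  \<comment> \<open>Half of the width goes to the shift z of the mollifier and half to the Lipschitz
    scale \<delta>, so that the shifted segments in \<open>near\<close> remain in
    \<open>U (d n)\<close>.\<close>
  define V where "V n = mollify (d n / 2) (W n)" for n
  have M0: "0 \<le> M" using \<open>0 < M\<close> by simp
  have JM: "\<bar>J n x\<bar> \<le> M" for n x unfolding J_def by (rule inf_convolution_bounded[OF M M0])
  have WM: "\<bar>W n x\<bar> \<le> M" for n x
    using JM[of n x] M0 by (simp add: W_def indicator_def)
  have seg: "\<bar>W n x - W n x'\<bar> \<le> dist x x'" if "closed_segment x x' \<subseteq> U (d n)" for n x x'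
  proof -
    have "x \<in> U (d n)" "x' \<in> U (d n)" using that by auto
    then show ?thesis
      using inf_convolution_lipschitz[OF M M0 that] by (simp add: W_def J_def)
  qed
  have oU: "open (U \<delta>)" for \<delta>
    unfolding U_def by (intro open_Collect_less continuous_intros)
  have near: "closed_segment (a - z) (b - z) \<subseteq> U (d n)"
    if "a \<in> ?K" "dist a b < d n / 2" "norm z < d n / 2" for a b z n
  proof
    fix p assume "p \<in> closed_segment (a - z) (b - z)"
    then have "dist (a - z) p \<le> dist (a - z) (b - z)"
      by (simp add: dist_in_closed_segment dist_commute)
    then have "dist (a - z) p < d n / 2" using that by (simp add: dist_norm)
    moreover have "dist p a \<le> dist (a - z) p + norm z"
    proof -
      have "dist (a - z) a = norm z" by (simp add: dist_norm)
      then show ?thesis using dist_triangle[of p a "a - z"] by (simp add: dist_commute)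
    qed
    ultimately have "dist p a < d n" using that by linarith
    moreover have "infdist p ?K \<le> dist p a" using that by (intro infdist_le)
    ultimately show "p \<in> U (d n)" by (simp add: U_def)
  qed
  \<comment> \<open>An infimum over uncountably many curves has no evident measurability; it comes
    from the continuity of \<open>J n\<close> on the open set \<open>U (d n)\<close>.\<close>
  have Wm: "W n \<in> borel_measurable borel" for n
  proof -
    have "continuous_on (U (d n)) (J n)"
      unfolding continuous_on_iff
    proof (intro ballI allI impI)
      fix x e assume x: "x \<in> U (d n)" and "(0::real) < e"
      obtain r where "0 < r" and r: "ball x r \<subseteq> U (d n)" using oU x open_contains_ball by blast
      have "dist (J n x') (J n x) < e" if "dist x' x < min r e" for x'
      proof -
        have "closed_segment x' x \<subseteq> ball x r"
          using that \<open>0 < r\<close> by (intro closed_segment_subset) (auto simp: dist_commute)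
        then have "\<bar>J n x' - J n x\<bar> \<le> dist x' x"
          unfolding J_def using r by (intro inf_convolution_lipschitz[OF M M0]) auto
        then show ?thesis using that by (simp add: dist_real_def)
      qed
      then show "\<exists>d'>0. \<forall>x'\<in>U (d n). dist x' x < d' \<longrightarrow> dist (J n x') (J n x) < e"
        using \<open>0 < r\<close> \<open>0 < e\<close> by (intro exI[of _ "min r e"]) auto
    qed
    then show ?thesis
      using borel_measurable_continuous_on_indicator[of "U (d n)" "J n"] oU
      by (simp add: W_def[abs_def])
  qed
  obtain b where b: "\<And>z. z \<in> ?K \<Longrightarrow> norm z \<le> b"
    using bounded_closure[OF \<open>bounded \<Omega>\<close>] unfolding bounded_iff by blast
  have WR: "W n x = 0" if "b + 1 \<le> norm x" for n x
  proof -
    obtain a where a: "a \<in> ?K" "infdist x ?K = dist x a"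
      using infdist_attains_inf[of ?K x] \<open>\<Omega> \<noteq> {}\<close> by auto
    have "1 \<le> dist x a"
      using b[OF a(1)] that norm_triangle_sub[of x a] by (simp add: dist_norm)
    moreover have "d n \<le> 1" by (simp add: d_def field_simps)
    ultimately show ?thesis using a by (simp add: W_def U_def)
  qed
  have "V n \<in> A_inf \<Omega>" for n
    unfolding V_def
  proof (rule mollify_in_A_inf[OF \<open>open \<Omega>\<close> \<open>bounded \<Omega>\<close> _ _ Wm WM WR, where \<delta>="d n / 2"])
    fix x x' z :: 'a assume "x \<in> ?K" "dist x x' < d n / 2" "norm z < d n / 2"
    then show "\<bar>W n (x - z) - W n (x' - z)\<bar> \<le> dist x x'"
      using seg[OF near] by (simp add: dist_norm)
  qed (use d0 in auto)
  moreover have "\<bar>V n x\<bar> \<le> M" for n x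
    unfolding V_def by (rule mollify_bounded[OF _ Wm WM]) (use d0 in simp)
  moreover have "(\<lambda>n. V n x) \<longlonglongrightarrow> w x" if x: "x \<in> frontier \<Omega>" for x
  proof -
    have xK: "x \<in> ?K" using x by (simp add: frontier_def)
    have xU: "x \<in> U (d n)" for n using xK d0 by (simp add: U_def)
    have VJ: "\<bar>V n x - J n x\<bar> \<le> d n" for n
    proof -
      have "\<bar>mollify (d n / 2) (W n) x - W n x\<bar> \<le> d n / 2"
      proof (rule mollify_approx[OF _ Wm WM])
        fix y assume "dist x y < d n / 2"
        then show "\<bar>W n y - W n x\<bar> \<le> d n / 2"
          using seg[of x y n] near[OF xK, of y n 0] d0[of n] by (simp add: abs_minus_commute)
      qed (use d0 in simp)
      then show ?thesis using xU d0[of n] by (simp add: V_def W_def)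
    qed
    have "(\<lambda>n. J n x) \<longlonglongrightarrow> w x"
    proof (rule LIMSEQ_I)
      fix r :: real assume "0 < r"
      then have "0 < r / 2" by simp
      note inf_convolution_lower_bound[OF \<open>bounded \<Omega>\<close> \<open>\<Omega> \<noteq> {}\<close> w wc M M0 x this]
      then obtain \<delta>0 where "0 < \<delta>0" and \<delta>0: "\<And>\<delta>. 0 < \<delta> \<Longrightarrow> \<delta> \<le> \<delta>0 \<Longrightarrow>
          w x - r / 2 \<le> inf_convolution (frontier \<Omega>) w M {z. infdist z ?K < \<delta>} x"
        by blast
      obtain N where N: "\<And>n. n \<ge> N \<Longrightarrow> d n < \<delta>0"
        using order_tendstoD(2)[OF LIMSEQ_inverse_real_of_nat \<open>0 < \<delta>0\<close>]
        by (auto simp: eventually_sequentially d_def)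
      have "norm (J n x - w x) < r" if "n \<ge> N" for n
      proof -
        have "w x - r / 2 \<le> J n x"
          unfolding J_def U_def using \<delta>0[OF d0] N[OF that] by simp
        moreover have "J n x \<le> w x"
          unfolding J_def by (rule inf_convolution_le_boundary[OF M M0 x xU])
        ultimately show ?thesis using \<open>0 < r\<close> by simp
      qed
      then show "\<exists>no. \<forall>n\<ge>no. norm (J n x - w x) < r" by blast
    qed
    moreover have "(\<lambda>n. V n x - J n x) \<longlonglongrightarrow> 0"
    proof (rule Lim_null_comparison)
      show "\<forall>\<^sub>F n in sequentially. norm (V n x - J n x) \<le> d n" using VJ by simp
      show "d \<longlonglongrightarrow> 0" unfolding d_def[abs_def] by (rule LIMSEQ_inverse_real_of_nat)
    qed
    ultimately have "(\<lambda>n. (V n x - J n x) + J n x) \<longlonglongrightarrow> 0 + w x" by (intro tendsto_add)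
    then show ?thesis by simp
  qed
  ultimately show thesis using that by blast
qed

section \<open>Finiteness of the surface measure\<close>

lemma sets_hausdorff_measure: "sets (hausdorff_measure d) = sets borel"
  using sets.sigma_sets_eq[of borel] by (simp add: hausdorff_measure_def sets_measure_of_conv)

lemma space_hausdorff_measure: "space (hausdorff_measure d) = UNIV"
  by (simp add: hausdorff_measure_def space_measure_of_conv)

lemma sets_surface_measure: "sets (surface_measure \<Omega>) = sets (restrict_space borel (frontier \<Omega>))"
  unfolding surface_measure_def by (intro sets_restrict_space_cong sets_hausdorff_measure)

lemma space_surface_measure: "space (surface_measure \<Omega>) = frontier \<Omega>"
  by (simp add: surface_measure_def space_restrict_space space_hausdorff_measure)

lemma borel_measurable_surface_measure:
  "continuous_on (frontier \<Omega>) f \<Longrightarrow> f \<in> borel_measurable (surface_measure \<Omega>)"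
  using borel_measurable_continuous_on_restrict measurable_cong_sets[OF sets_surface_measure refl] by blast

text \<open>If \<open>hausdorff_outer\<close> were not countably additive, \<open>measure_of\<close> would be the zero measure,
  so this bound needs no measurability theory.\<close>
lemma emeasure_surface_measure_le:
  fixes \<Omega> :: "'a::euclidean_space set"
  assumes "closed A" "A \<subseteq> frontier \<Omega>"
  shows "emeasure (surface_measure \<Omega>) A \<le> hausdorff_outer (DIM('a) - 1) A"
proof -
  have "frontier \<Omega> \<inter> space (hausdorff_measure (DIM('a) - 1)) \<in> sets (hausdorff_measure (DIM('a) - 1))"
    by (simp add: sets_hausdorff_measure space_hausdorff_measure)
  then have "emeasure (surface_measure \<Omega>) A = emeasure (hausdorff_measure (DIM('a) - 1)) A"
    unfolding surface_measure_def using assms(2) by (rule emeasure_restrict_space)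
  also have "\<dots> \<le> hausdorff_outer (DIM('a) - 1) A"
    by (simp add: hausdorff_measure_def emeasure_measure_of_conv)
  finally show ?thesis .
qed

section \<open>Covering estimates for Lipschitz graphs\<close>

lemma hausdorff_pre_mono: "A \<subseteq> A' \<Longrightarrow> hausdorff_pre d \<delta> A \<le> hausdorff_pre d \<delta> A'"
  unfolding hausdorff_pre_def by (rule INF_superset_mono) auto

lemma hausdorff_outer_mono: "A \<subseteq> A' \<Longrightarrow> hausdorff_outer d A \<le> hausdorff_outer d A'"
  unfolding hausdorff_outer_def
  by (rule SUP_mono) (auto intro: hausdorff_pre_mono)

lemma hausdorff_pre_le_card:
  assumes "finite I" and cover: "A \<subseteq> (\<Union>c\<in>I. Q c)" and "0 \<le> D" "D \<le> \<delta>"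
    and diam: "\<And>c x y. c \<in> I \<Longrightarrow> x \<in> Q c \<Longrightarrow> y \<in> Q c \<Longrightarrow> dist x y \<le> D"
  shows "hausdorff_pre d \<delta> A \<le> ennreal (real (card I) * (unit_ball_vol (real d) * (D / 2) ^ d))"
proof -
  obtain f where f: "bij_betw f {0..<card I} I"
    using ex_bij_betw_nat_finite[OF \<open>finite I\<close>] by blast
  \<comment> \<open>The finite cover is padded with empty sets, which weigh nothing even for d =
    0.\<close>
  define C where "C i = (if i < card I then Q (f i) else {})" for i
  have fI: "f i \<in> I" if "i < card I" for i
    using f that by (auto simp: bij_betw_def)
  have dC: "dist x y \<le> D" if "x \<in> C i" "y \<in> C i" for x y i
    using that fI diam by (auto simp: C_def split: if_splits)
  have diamC: "diameter (C i) \<le> D" for i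
    using dC \<open>0 \<le> D\<close> by (intro diameter_le) (auto simp: dist_norm)
  have bC: "bounded (C i)" for i
  proof (cases "C i = {}")
    case False
    then obtain x where "x \<in> C i" by blast
    then show ?thesis using dC unfolding bounded_def by blast
  qed simp
  have sub: "A \<subseteq> (\<Union>i. C i)"
  proof
    fix x assume "x \<in> A"
    then obtain c where c: "c \<in> I" "x \<in> Q c" using cover by blast
    then obtain i where "i < card I" "f i = c"
      using f by (force simp: bij_betw_def image_iff)
    then show "x \<in> (\<Union>i. C i)" using c by (auto simp: C_def)
  qed
  let ?g = "\<lambda>i. if C i = {} then 0 else ennreal (unit_ball_vol (real d) * (diameter (C i) / 2) ^ d)"
  have "hausdorff_pre d \<delta> A \<le> (\<Sum>i. ?g i)"
    unfolding hausdorff_pre_def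
    by (rule INF_lower2[of C]) (use sub bC order_trans[OF diamC \<open>D \<le> \<delta>\<close>] in auto)
  also have "\<dots> = (\<Sum>i<card I. ?g i)"
    by (rule suminf_finite) (auto simp: C_def)
  also have "\<dots> \<le> (\<Sum>i<card I. ennreal (unit_ball_vol (real d) * (D / 2) ^ d))"
  proof (rule sum_mono)
    fix i
    have "unit_ball_vol (real d) * (diameter (C i) / 2) ^ d \<le> unit_ball_vol (real d) * (D / 2) ^ d"
      using diamC diameter_ge_0[OF bC] by (intro mult_left_mono power_mono divide_right_mono) auto
    then show "?g i \<le> ennreal (unit_ball_vol (real d) * (D / 2) ^ d)"
      by (auto intro: ennreal_leI)
  qed
  also have "\<dots> = ennreal (real (card I) * (unit_ball_vol (real d) * (D / 2) ^ d))"
    using \<open>0 \<le> D\<close> by (simp add: ennreal_mult ennreal_of_nat_eq_real_of_nat)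
  finally show ?thesis .
qed

text \<open>B is an orthonormal basis of a subspace containing S. A grid of m + 1 intervals per
  coordinate cuts S into \<open>(m + 1) ^ d\<close> cells whose images have diameter of order 1/m,
  with d the number of elements of B, so the d-dimensional sum is bounded uniformly in m.\<close>

lemma hausdorff_outer_lipschitz_image_finite:
  fixes B :: "'a::euclidean_space set" and F :: "'a \<Rightarrow> 'a"
  assumes "finite B" and orth: "pairwise orthogonal B" and norm1: "\<And>b. b \<in> B \<Longrightarrow> norm b = 1"
    and S: "S \<subseteq> span B" "\<And>z. z \<in> S \<Longrightarrow> norm z \<le> R" and "0 < R" and F: "L-lipschitz_on S F"
  shows "hausdorff_outer (card B) (F ` S) < \<infinity>"
proof -
  define d where "d = card B"
  have "0 \<le> L" using F by (rule lipschitz_on_nonneg)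
  \<comment> \<open>In the final estimate the base is \<open>real (m + 1) * (D / 2)\<close>, and
    \<open>m + 1 \<le> 2 * m\<close> bounds it by \<open>real m * D\<close>, which is
    \<open>2 * L * real d * R\<close>.\<close>
  define K where "K = unit_ball_vol (real d) * (2 * L * real d * R) ^ d"
  have pre: "hausdorff_pre d \<delta> (F ` S) \<le> ennreal K" if "0 < \<delta>" for \<delta>
  proof -
    \<comment> \<open>This is exactly the fineness at which the image of a cell, of diameter at most
      D, fits under \<delta>.\<close>
    obtain m where m: "2 * L * real d * R / \<delta> < real m" using reals_Archimedean2 by blast
    moreover have "0 \<le> 2 * L * real d * R / \<delta>" using \<open>0 \<le> L\<close> \<open>0 < R\<close> \<open>0 < \<delta>\<close> by simp
    ultimately have "0 < m" by linarith
    define w where "w = 2 * R / real m"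
    have "0 < w" using \<open>0 < R\<close> \<open>0 < m\<close> by (simp add: w_def)
    define D where "D = L * (real d * w)"
    have "0 \<le> D" using \<open>0 \<le> L\<close> \<open>0 < w\<close> by (simp add: D_def)
    have "D \<le> \<delta>"
      using m \<open>0 < m\<close> \<open>0 < \<delta>\<close> by (simp add: D_def w_def field_simps)
    define k where "k z b = nat \<lfloor>(z \<bullet> b + R) / w\<rfloor>" for z b :: 'a
    \<comment> \<open>The index m occurs when a coordinate equals R, hence m + 1 values and not
      m.\<close>
    define I where "I = B \<rightarrow>\<^sub>E {0..m}"
    define Q where "Q c = F ` {z \<in> S. \<forall>b\<in>B. k z b = c b}" for c
    have rng: "0 \<le> z \<bullet> b + R" "k z b \<le> m" if "z \<in> S" "b \<in> B" for z b
    proof -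
      have zb: "\<bar>z \<bullet> b\<bar> \<le> R"
        using Cauchy_Schwarz_ineq2[of z b] norm1[OF that(2)] S(2)[OF that(1)] by simp
      then show "0 \<le> z \<bullet> b + R" by linarith
      have "(z \<bullet> b + R) / w \<le> real m"
        using zb \<open>0 < w\<close> \<open>0 < m\<close> by (subst pos_divide_le_eq) (auto simp: w_def)
      then have "\<lfloor>(z \<bullet> b + R) / w\<rfloor> \<le> int m" by (simp add: floor_le_iff)
      then show "k z b \<le> m" by (simp add: k_def)
    qed
    have "hausdorff_pre d \<delta> (F ` S) \<le> ennreal (real (card I) * (unit_ball_vol (real d) * (D / 2) ^ d))"
    proof (rule hausdorff_pre_le_card[OF _ _ \<open>0 \<le> D\<close> \<open>D \<le> \<delta>\<close>])
      show "finite I" unfolding I_def using \<open>finite B\<close> by (intro finite_PiE) auto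
      show "F ` S \<subseteq> (\<Union>c\<in>I. Q c)"
      proof (rule image_subsetI)
        fix z assume z: "z \<in> S"
        have "restrict (k z) B \<in> I" using rng(2)[OF z] by (auto simp: I_def)
        moreover have "F z \<in> Q (restrict (k z) B)" using z by (auto simp: Q_def)
        ultimately show "F z \<in> (\<Union>c\<in>I. Q c)" by blast
      qed
      fix c x y assume "x \<in> Q c" "y \<in> Q c"
      then obtain z z' where z: "z \<in> S" "z' \<in> S" "x = F z" "y = F z'"
        and kk: "\<And>b. b \<in> B \<Longrightarrow> k z b = c b" "\<And>b. b \<in> B \<Longrightarrow> k z' b = c b"
        unfolding Q_def by blast
      have coord: "\<bar>(z - z') \<bullet> b\<bar> \<le> w" if b: "b \<in> B" for b
      proof -
        define s t where "s = (z \<bullet> b + R) / w" and "t = (z' \<bullet> b + R) / w"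
        \<comment> \<open>Nonnegativity matters because \<open>nat\<close> would identify all
          negative floors.\<close>
        have "0 \<le> s" "0 \<le> t"
          using rng(1)[OF z(1) b] rng(1)[OF z(2) b] \<open>0 < w\<close> by (simp_all add: s_def t_def)
        moreover have "nat \<lfloor>s\<rfloor> = nat \<lfloor>t\<rfloor>"
          using trans[OF kk(1)[OF b] kk(2)[OF b, symmetric]] unfolding k_def s_def t_def .
        ultimately have "\<lfloor>s\<rfloor> = \<lfloor>t\<rfloor>" by (metis eq_nat_nat_iff zero_le_floor)
        then have "\<bar>s - t\<bar> \<le> 1" by linarith
        moreover have "s - t = ((z - z') \<bullet> b) / w"
          by (simp add: s_def t_def inner_diff_left diff_divide_distrib add_divide_distrib)
        ultimately show ?thesis using \<open>0 < w\<close> by (simp add: divide_le_eq)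
      qed
      have "z - z' \<in> span B" using S(1) z by (intro span_diff) auto
      then have "z - z' = (\<Sum>b\<in>B. ((z - z') \<bullet> b) *\<^sub>R b)"
        using orthonormal_basis_expand[OF orth norm1 _ \<open>finite B\<close>, of "z - z'"] by simp
      then have "norm (z - z') \<le> (\<Sum>b\<in>B. norm (((z - z') \<bullet> b) *\<^sub>R b))"
        by (metis norm_sum)
      also have "\<dots> \<le> (\<Sum>b\<in>B. w)"
        using coord norm1 by (intro sum_mono) simp
      finally have "norm (z - z') \<le> real d * w" by (simp add: d_def)
      then have "L * dist z z' \<le> D"
        using \<open>0 \<le> L\<close> by (simp add: D_def dist_norm mult_left_mono)
      then show "dist x y \<le> D"
        using lipschitz_onD[OF F z(1,2)] z(3,4) by simp
    qed
    also have "\<dots> \<le> ennreal K"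
    proof (rule ennreal_leI)
      have "card I = (m + 1) ^ d"
        unfolding I_def using \<open>finite B\<close> by (simp add: card_PiE d_def)
      then have "real (card I) * (D / 2) ^ d = (real (m + 1) * (D / 2)) ^ d"
        by (simp only: power_mult_distrib of_nat_power)
      also have "\<dots> \<le> (2 * L * real d * R) ^ d"
      proof (rule power_mono)
        have "real (m + 1) \<le> 2 * real m" using \<open>0 < m\<close> by simp
        then have "real (m + 1) * (D / 2) \<le> 2 * real m * (D / 2)"
          using \<open>0 \<le> D\<close> by (intro mult_right_mono) auto
        also have "\<dots> = 2 * L * real d * R"
          using \<open>0 < m\<close> by (simp add: D_def w_def)
        finally show "real (m + 1) * (D / 2) \<le> 2 * L * real d * R" .
      qed (use \<open>0 \<le> D\<close> in simp)
      finally have "unit_ball_vol (real d) * (real (card I) * (D / 2) ^ d) \<le> K"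
        unfolding K_def by (rule mult_left_mono) simp
      then show "real (card I) * (unit_ball_vol (real d) * (D / 2) ^ d) \<le> K"
        by (simp add: mult.left_commute)
    qed
    finally show ?thesis .
  qed
  then have "hausdorff_outer d (F ` S) \<le> ennreal K"
    unfolding hausdorff_outer_def by (intro SUP_least) auto
  also have "\<dots> < \<infinity>" by simp
  finally show ?thesis by (simp add: d_def)
qed

text \<open>Near p the boundary is covered by the image of a bounded piece of a hyperplane under the
  Lipschitz map \<open>z + h z *\<^sub>R e\<close>. Closed balls are used because the surface
  measure is compared with \<open>hausdorff_outer\<close> on closed sets.\<close>

lemma hausdorff_outer_boundary_locally_finite:
  fixes \<Omega> :: "'a::euclidean_space set"
  assumes \<Omega>: "smooth_bounded_domain \<Omega>" and p: "p \<in> frontier \<Omega>"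
  obtains r where "0 < r" "hausdorff_outer (DIM('a) - 1) (frontier \<Omega> \<inter> cball p r) < \<infinity>"
proof -
  obtain r e h where "0 < r" and e: "norm e = 1" and h: "smooth_function h"
    and infr: "\<And>x. x \<in> ball p r \<Longrightarrow> x \<in> frontier \<Omega> \<longleftrightarrow> h (x - (x \<bullet> e) *\<^sub>R e) = x \<bullet> e"
    using smooth_boundary_chart[OF \<Omega> p] by metis
  have ee: "e \<bullet> e = 1" using e by (simp add: norm_eq_1)
  define \<pi> where "\<pi> x = x - (x \<bullet> e) *\<^sub>R e" for x
  define S where "S = \<pi> ` cball p (r / 2)"
  define F where "F z = z + h z *\<^sub>R e" for z
  have "subspace {x. e \<bullet> x = 0}" by (rule subspace_hyperplane)
  then obtain B where B: "pairwise orthogonal B" "\<And>b. b \<in> B \<Longrightarrow> norm b = 1" "independent B"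
    "card B = dim {x. e \<bullet> x = 0}" "span B = {x. e \<bullet> x = 0}"
    by (rule orthonormal_basis_subspace) blast
  have cB: "card B = DIM('a) - 1"
    using B(4) dim_hyperplane[of e] e by force
  have fB: "finite B" using B(3) by (rule independent_imp_finite)
  have "S \<subseteq> span B"
    unfolding B(5) by (auto simp: S_def \<pi>_def inner_diff_right ee inner_commute)
  have \<pi>n: "norm (\<pi> x) \<le> norm x" for x unfolding \<pi>_def by (rule norm_orthogonal_part_le[OF e])
  define R where "R = norm p + r"
  have SR: "norm z \<le> R" if zS: "z \<in> S" for z
  proof -
    obtain x where "z = \<pi> x" "dist p x \<le> r / 2"
      using zS by (auto simp: S_def)
    moreover have "norm x \<le> norm p + dist p x"
      using norm_triangle_sub[of x p] by (simp add: dist_norm norm_minus_commute)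
    ultimately show ?thesis using \<pi>n[of x] \<open>0 < r\<close> by (simp add: R_def)
  qed
  have "0 < R" using \<open>0 < r\<close> by (simp add: R_def add_nonneg_pos)
  obtain C where C: "C-lipschitz_on (cball 0 R) h"
    using smooth_function_lipschitz_on_cball[OF h] by blast
  have "0 \<le> C" using C by (rule lipschitz_on_nonneg)
  have "(1 + C)-lipschitz_on S F"
  proof (rule lipschitz_onI)
    fix x y assume xy: "x \<in> S" "y \<in> S"
    have "F x - F y = (x - y) + (h x - h y) *\<^sub>R e" by (simp add: F_def algebra_simps)
    then have "dist (F x) (F y) \<le> dist x y + dist (h x) (h y)"
      using norm_triangle_ineq[of "x - y" "(h x - h y) *\<^sub>R e"] e by (simp add: dist_norm)
    also have "dist (h x) (h y) \<le> C * dist x y"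
      using SR xy by (intro lipschitz_onD[OF C]) auto
    finally show "dist (F x) (F y) \<le> (1 + C) * dist x y" by (simp add: algebra_simps)
  qed (use \<open>0 \<le> C\<close> in simp)
  then have fin: "hausdorff_outer (DIM('a) - 1) (F ` S) < \<infinity>"
    using hausdorff_outer_lipschitz_image_finite[OF fB B(1,2) \<open>S \<subseteq> span B\<close> SR \<open>0 < R\<close>] by (simp add: cB)
  have "frontier \<Omega> \<inter> cball p (r / 2) \<subseteq> F ` S"
  proof
    fix x assume x: "x \<in> frontier \<Omega> \<inter> cball p (r / 2)"
    then have "h (\<pi> x) = x \<bullet> e" using infr[of x] \<open>0 < r\<close> by (simp add: \<pi>_def)
    then have "x = F (\<pi> x)" by (simp add: F_def) (simp add: \<pi>_def)
    then show "x \<in> F ` S" using x by (auto simp: S_def)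
  qed
  then have "hausdorff_outer (DIM('a) - 1) (frontier \<Omega> \<inter> cball p (r / 2)) < \<infinity>"
    using hausdorff_outer_mono fin by (metis order_le_less_trans)
  then show thesis using that[of "r / 2"] \<open>0 < r\<close> by simp
qed

lemma finite_surface_measure:
  fixes \<Omega> :: "'a::euclidean_space set"
  assumes \<Omega>: "smooth_bounded_domain \<Omega>"
  shows "finite_measure (surface_measure \<Omega>)"
proof (rule finite_measureI)
  have "compact (frontier \<Omega>)"
    using \<Omega> by (intro compact_frontier_bounded) (simp add: smooth_bounded_domain_def)
  have "\<forall>p\<in>frontier \<Omega>. \<exists>r>0. hausdorff_outer (DIM('a) - 1) (frontier \<Omega> \<inter> cball p r) < \<infinity>"
    using hausdorff_outer_boundary_locally_finite[OF \<Omega>] by blast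
  then obtain r where r: "\<And>p. p \<in> frontier \<Omega> \<Longrightarrow> 0 < r p"
    and fin: "\<And>p. p \<in> frontier \<Omega> \<Longrightarrow> hausdorff_outer (DIM('a) - 1) (frontier \<Omega> \<inter> cball p (r p)) < \<infinity>"
    by metis
  have "frontier \<Omega> \<subseteq> (\<Union>p\<in>frontier \<Omega>. ball p (r p))" using r by force
  then obtain P where P: "P \<subseteq> frontier \<Omega>" "finite P" "frontier \<Omega> \<subseteq> (\<Union>p\<in>P. ball p (r p))"
    using compactE_image[OF \<open>compact (frontier \<Omega>)\<close>, of "frontier \<Omega>" "\<lambda>p. ball p (r p)"] by auto
  let ?A = "\<lambda>p. frontier \<Omega> \<inter> cball p (r p)"
  have cl: "closed (?A p)" for p by (intro closed_Int) auto
  have "frontier \<Omega> = (\<Union>p\<in>P. ?A p)"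
  proof
    show "frontier \<Omega> \<subseteq> (\<Union>p\<in>P. ?A p)"
    proof
      fix x assume "x \<in> frontier \<Omega>"
      moreover from this obtain p where "p \<in> P" "x \<in> ball p (r p)" using P(3) by blast
      ultimately show "x \<in> (\<Union>p\<in>P. ?A p)" by (intro UN_I[of p]) simp_all
    qed
  qed (simp add: UN_least)
  moreover have "?A ` P \<subseteq> sets (surface_measure \<Omega>)"
    unfolding sets_surface_measure sets_restrict_space by (intro image_subsetI imageI) simp
  ultimately have "emeasure (surface_measure \<Omega>) (frontier \<Omega>) \<le> (\<Sum>p\<in>P. emeasure (surface_measure \<Omega>) (?A p))"
    using emeasure_subadditive_finite[OF P(2), of ?A] by metis
  also have "\<dots> \<le> (\<Sum>p\<in>P. hausdorff_outer (DIM('a) - 1) (?A p))"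
    by (intro sum_mono emeasure_surface_measure_le cl) simp
  also have "\<dots> < \<infinity>" using fin P(1,2) by (auto simp: ennreal_sum_less_top)
  finally show "emeasure (surface_measure \<Omega>) (space (surface_measure \<Omega>)) \<noteq> \<infinity>"
    by (simp add: space_surface_measure)
qed

section \<open>The evolution problem\<close>

lemma L2_spaceD:
  assumes "g \<in> L2_space M"
  shows "g \<in> borel_measurable M" "integrable M (\<lambda>x. (g x)\<^sup>2)"
  using assms by (auto simp: L2_space_def)

text \<open>Young's inequality with a weight. The weight 1 gives integrability of products, and a
  small weight does the work of the Cauchy-Schwarz inequality for integrals in the passage to the
  limit.\<close>

lemma mult_le_weighted_squares:
  fixes a b s :: real
  assumes "0 < s" shows "\<bar>a * b\<bar> \<le> s * a\<^sup>2 + b\<^sup>2 / s"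
proof -
  have "0 \<le> (s * \<bar>a\<bar> - \<bar>b\<bar>)\<^sup>2" by simp
  then have "2 * (s * \<bar>a * b\<bar>) \<le> s\<^sup>2 * a\<^sup>2 + b\<^sup>2"
    by (simp add: power2_diff power_mult_distrib abs_mult mult_ac)
  moreover have "0 \<le> s * \<bar>a * b\<bar>" using assms by simp
  ultimately have "s * \<bar>a * b\<bar> \<le> s\<^sup>2 * a\<^sup>2 + b\<^sup>2" by linarith
  also have "\<dots> = s * (s * a\<^sup>2 + b\<^sup>2 / s)"
    using assms by (simp add: field_simps power2_eq_square)
  finally show ?thesis using assms by simp
qed

lemma L2_integrable_mult:
  fixes f g :: "'a \<Rightarrow> real"
  assumes "f \<in> L2_space M" "g \<in> L2_space M"
  shows "integrable M (\<lambda>x. f x * g x)"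
proof (rule Bochner_Integration.integrable_bound)
  show "integrable M (\<lambda>x. (f x)\<^sup>2 + (g x)\<^sup>2)"
    using assms by (intro Bochner_Integration.integrable_add L2_spaceD)
  show "(\<lambda>x. f x * g x) \<in> borel_measurable M"
    using assms by (intro borel_measurable_times L2_spaceD)
  show "AE x in M. norm (f x * g x) \<le> norm ((f x)\<^sup>2 + (g x)\<^sup>2)"
    using mult_le_weighted_squares[of 1] by simp
qed

lemma L2_space_add:
  assumes "f \<in> L2_space M" "g \<in> L2_space M" shows "(\<lambda>x. f x + g x) \<in> L2_space M"
  using assms L2_integrable_mult[OF assms] by (auto simp: L2_space_def power2_sum mult.assoc)

lemma L2_space_cmult: "f \<in> L2_space M \<Longrightarrow> (\<lambda>x. c * f x) \<in> L2_space M"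
  by (auto simp: L2_space_def power_mult_distrib)

lemma L2_space_diff:
  assumes "f \<in> L2_space M" "g \<in> L2_space M" shows "(\<lambda>x. f x - g x) \<in> L2_space M"
  using L2_space_add[OF assms(1) L2_space_cmult[OF assms(2), of "-1"]] by simp

lemma L2_space_bound:
  assumes "f \<in> borel_measurable M" "g \<in> L2_space M" "\<And>x. \<bar>f x\<bar> \<le> \<bar>g x\<bar>"
  shows "f \<in> L2_space M" "L2_norm M f \<le> L2_norm M g"
proof -
  have le: "(f x)\<^sup>2 \<le> (g x)\<^sup>2" for x using assms(3) by (simp add: abs_le_square_iff)
  have int: "integrable M (\<lambda>x. (f x)\<^sup>2)"
    by (rule Bochner_Integration.integrable_bound[OF L2_spaceD(2)[OF assms(2)]])
      (use le assms(1) in auto)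
  then show "f \<in> L2_space M" using assms(1) by (simp add: L2_space_def)
  show "L2_norm M f \<le> L2_norm M g"
    unfolding L2_norm_def
    by (intro real_sqrt_le_mono integral_mono int L2_spaceD(2)[OF assms(2)] le)
qed

lemma L2_norm_tendsto_0_imp_integral_tendsto_0:
  assumes g: "g \<in> L2_space M" and r: "\<And>n. r n \<in> L2_space M"
    and lim: "(\<lambda>n. L2_norm M (r n)) \<longlonglongrightarrow> 0"
  shows "(\<lambda>n. LINT x|M. g x * r n x) \<longlonglongrightarrow> 0"
proof (rule LIMSEQ_I)
  fix e :: real assume "0 < e"
  define A where "A = (LINT x|M. (g x)\<^sup>2)"
  have "0 \<le> A" by (simp add: A_def)
  \<comment> \<open>The weight makes the contribution of g smaller than e/2; adding 1 to A keeps the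
    denominator positive when g vanishes.\<close>
  define s where "s = e / (2 * (A + 1))"
  have "0 < s" using \<open>0 < e\<close> \<open>0 \<le> A\<close> by (simp add: s_def)
  have "e * A < e * (A + 1)" using \<open>0 < e\<close> by simp
  then have sA: "s * A < e / 2" using \<open>0 \<le> A\<close> by (simp add: s_def field_simps)
  have B: "(L2_norm M (r n))\<^sup>2 = (LINT x|M. (r n x)\<^sup>2)" for n by (simp add: L2_norm_def)
  have "(\<lambda>n. (L2_norm M (r n))\<^sup>2) \<longlonglongrightarrow> 0\<^sup>2" by (intro tendsto_power lim)
  then have "(\<lambda>n. (L2_norm M (r n))\<^sup>2) \<longlonglongrightarrow> 0" by simp
  from order_tendstoD(2)[OF this, of "s * (e / 2)"] have "\<forall>\<^sub>F n in sequentially. (L2_norm M (r n))\<^sup>2 < s * (e / 2)"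
    using \<open>0 < s\<close> \<open>0 < e\<close> by simp
  then obtain N where N: "\<And>n. n \<ge> N \<Longrightarrow> (L2_norm M (r n))\<^sup>2 < s * (e / 2)"
    unfolding eventually_sequentially by blast
  have "norm ((LINT x|M. g x * r n x) - 0) < e" if "n \<ge> N" for n
  proof -
    have "\<bar>LINT x|M. g x * r n x\<bar> \<le> (LINT x|M. \<bar>g x * r n x\<bar>)" by (rule integral_abs_bound)
    also have "\<dots> \<le> (LINT x|M. s * (g x)\<^sup>2 + (r n x)\<^sup>2 / s)"
      using L2_spaceD[OF g] L2_spaceD[OF r] L2_integrable_mult[OF g r] mult_le_weighted_squares[OF \<open>0 < s\<close>]
      by (intro integral_mono) auto
    also have "\<dots> = s * A + (LINT x|M. (r n x)\<^sup>2) / s"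
      using L2_spaceD[OF g] L2_spaceD[OF r] by (simp add: A_def)
    also have "\<dots> < e / 2 + e / 2"
    proof (rule add_strict_mono[OF sA])
      show "(LINT x|M. (r n x)\<^sup>2) / s < e / 2"
        using N[OF that] \<open>0 < s\<close> unfolding B by (simp add: pos_divide_less_eq mult.commute)
    qed
    finally show ?thesis by simp
  qed
  then show "\<exists>no. \<forall>n\<ge>no. norm ((LINT x|M. g x * r n x) - 0) < e" by blast
qed

text \<open>Maxima are formed in \<open>dual_admissible\<close>, where this is a pointwise matter,
  and not in \<open>A_inf\<close>, where it would involve the weak gradient of a maximum.\<close>

lemma dual_admissible_max:
  assumes "v \<in> dual_admissible \<Omega>" "w \<in> dual_admissible \<Omega>"
  shows "(\<lambda>x. max (v x) (w x)) \<in> dual_admissible \<Omega>"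
  unfolding dual_admissible_def
proof (intro CollectI ballI)
  fix x y assume xy: "x \<in> frontier \<Omega>" "y \<in> frontier \<Omega>"
  then have dv: "ennreal \<bar>v x - v y\<bar> \<le> domain_dist \<Omega> x y" and dw: "ennreal \<bar>w x - w y\<bar> \<le> domain_dist \<Omega> x y"
    using assms by (simp_all add: dual_admissible_def)
  consider "\<bar>max (v x) (w x) - max (v y) (w y)\<bar> \<le> \<bar>v x - v y\<bar>"
    | "\<bar>max (v x) (w x) - max (v y) (w y)\<bar> \<le> \<bar>w x - w y\<bar>" by linarith
  then show "ennreal \<bar>max (v x) (w x) - max (v y) (w y)\<bar> \<le> domain_dist \<Omega> x y"
    using order_trans[OF ennreal_leI dv] order_trans[OF ennreal_leI dw] by cases
qed

lemma dual_admissible_add_const: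
  "v \<in> dual_admissible \<Omega> \<Longrightarrow> (\<lambda>x. v x + c) \<in> dual_admissible \<Omega>"
  by (simp add: dual_admissible_def)

lemma zero_in_A_inf: "(\<lambda>_. 0) \<in> A_inf \<Omega>"
proof -
  have "W1inf_with_gradient \<Omega> (\<lambda>_. 0) (\<lambda>_. 0)"
    by (auto simp: W1inf_with_gradient_def Linf_on_def weak_gradient_def)
  then show ?thesis
    unfolding A_inf_def
    by (intro CollectI conjI exI[of _ "\<lambda>_. 0"]) auto
qed

section \<open>Consequences of the inclusion at a fixed time\<close>

context
  fixes \<Omega> :: "'a::euclidean_space set" and \<sigma> :: "'a measure"
  assumes \<Omega>: "smooth_bounded_domain \<Omega>" and \<sigma>: "\<sigma> = surface_measure \<Omega>"
begin

interpretation finite_measure \<sigma>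
  unfolding \<sigma> by (rule finite_surface_measure[OF \<Omega>])

lemma continuous_in_L2_space:
  assumes "continuous_on (frontier \<Omega>) f" shows "f \<in> L2_space \<sigma>"
proof -
  have [measurable]: "f \<in> borel_measurable \<sigma>"
    unfolding \<sigma> using assms by (rule borel_measurable_surface_measure)
  have "compact (frontier \<Omega>)"
    using \<Omega> by (intro compact_frontier_bounded) (simp add: smooth_bounded_domain_def)
  then obtain B where B: "\<And>x. x \<in> frontier \<Omega> \<Longrightarrow> \<bar>f x\<bar> \<le> B"
    using compact_imp_bounded[OF compact_continuous_image[OF assms]] unfolding bounded_iff by auto
  have "integrable \<sigma> (\<lambda>x. (f x)\<^sup>2)"
  proof (rule integrable_const_bound[where B="B\<^sup>2"])
    show "AE x in \<sigma>. norm ((f x)\<^sup>2) \<le> B\<^sup>2"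
      using B by (intro AE_I2) (auto simp: \<sigma> space_surface_measure intro!: abs_le_square_iff[THEN iffD1] order_trans[OF B abs_ge_self])
  qed measurable
  then show ?thesis by (simp add: L2_space_def)
qed

lemma dual_admissible_in_L2_space: "w \<in> dual_admissible \<Omega> \<Longrightarrow> w \<in> L2_space \<sigma>"
  by (rule continuous_in_L2_space[OF dual_admissible_continuous_on[OF \<Omega>]])

text \<open>On \<open>A_inf\<close> both energies vanish, so the inequality is immediate there. It
  extends to admissible w by dominated convergence: the approximants share a bound M, and g is
  integrable because the surface measure is finite.\<close>

lemma subdifferential_E_inf_imp:
  assumes g: "g \<in> L2_subdifferential \<sigma> (E_inf \<Omega>) U" and U: "U \<in> L2_space \<sigma>"
  shows "\<exists>w\<in>A_inf \<Omega>. AE x in \<sigma>. U x = w x"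
    and "w \<in> dual_admissible \<Omega> \<Longrightarrow> (LINT x|\<sigma>. g x * (w x - U x)) \<le> 0"
proof -
  have gL: "g \<in> L2_space \<sigma>"
    and sub: "\<And>w. w \<in> L2_space \<sigma> \<Longrightarrow> E_inf \<Omega> w - E_inf \<Omega> U \<ge> ereal (LINT x|\<sigma>. g x * (w x - U x))"
    using g by (auto simp: L2_subdifferential_def)
  have AL: "w \<in> L2_space \<sigma>" if "w \<in> A_inf \<Omega>" for w
    using that by (intro continuous_in_L2_space) (simp add: A_inf_def)
  have E0: "E_inf \<Omega> w = 0" if "w \<in> A_inf \<Omega>" for w
    unfolding E_inf_def using that by (auto intro!: bexI[of _ w])
  \<comment> \<open>A competitor of finite energy is essential: against it, an infinite energy of U
    would give \<open>-\<infinity>\<close> on the left, while competitors of infinite energy exclude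
    nothing, as \<infinity> - \<infinity> is \<infinity> in \<open>ereal\<close>.\<close>
  have EU: "E_inf \<Omega> U = 0"
  proof (rule ccontr)
    assume "E_inf \<Omega> U \<noteq> 0"
    then have "E_inf \<Omega> U = \<infinity>" by (auto simp: E_inf_def split: if_splits)
    then show False
      using sub[OF AL[OF zero_in_A_inf]] E0[OF zero_in_A_inf] by simp
  qed
  then show "\<exists>w\<in>A_inf \<Omega>. AE x in \<sigma>. U x = w x"
    unfolding E_inf_def \<sigma> by (metis PInfty_neq_ereal(1) zero_ereal_def)
  have le: "(LINT x|\<sigma>. g x * (w x - U x)) \<le> 0" if "w \<in> A_inf \<Omega>" for w
    using sub[OF AL[OF that]] by (simp add: E0[OF that] EU)
  show "(LINT x|\<sigma>. g x * (w x - U x)) \<le> 0" if w: "w \<in> dual_admissible \<Omega>"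
  proof -
    obtain V M where V: "\<And>n::nat. V n \<in> A_inf \<Omega>" and VM: "\<And>n x. x \<in> frontier \<Omega> \<Longrightarrow> \<bar>V n x\<bar> \<le> M"
      and lim: "\<And>x. x \<in> frontier \<Omega> \<Longrightarrow> (\<lambda>n. V n x) \<longlonglongrightarrow> w x"
      using dual_admissible_approx[OF \<Omega> w] by blast
    have [measurable]: "g \<in> borel_measurable \<sigma>" "U \<in> borel_measurable \<sigma>" "w \<in> borel_measurable \<sigma>"
      "V n \<in> borel_measurable \<sigma>" for n
      using gL U dual_admissible_in_L2_space[OF w] AL[OF V] by (auto dest: L2_spaceD)
    have sp: "space \<sigma> = frontier \<Omega>" by (simp add: \<sigma> space_surface_measure)
    have gint: "integrable \<sigma> g" by (rule square_integrable_imp_integrable[OF L2_spaceD[OF gL]])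
    have "(\<lambda>n. LINT x|\<sigma>. g x * (V n x - U x)) \<longlonglongrightarrow> (LINT x|\<sigma>. g x * (w x - U x))"
    proof (rule integral_dominated_convergence[where w="\<lambda>x. \<bar>g x\<bar> * M + \<bar>g x * U x\<bar>"])
      show "integrable \<sigma> (\<lambda>x. \<bar>g x\<bar> * M + \<bar>g x * U x\<bar>)"
        using gint L2_integrable_mult[OF gL U] by auto
      show "AE x in \<sigma>. (\<lambda>n. g x * (V n x - U x)) \<longlonglongrightarrow> g x * (w x - U x)"
        by (intro AE_I2 tendsto_intros lim) (simp add: sp)
      show "AE x in \<sigma>. norm (g x * (V n x - U x)) \<le> \<bar>g x\<bar> * M + \<bar>g x * U x\<bar>" for n
      proof (intro AE_I2)
        fix x assume "x \<in> space \<sigma>"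
        then have "\<bar>g x\<bar> * \<bar>V n x\<bar> \<le> \<bar>g x\<bar> * M" using VM by (intro mult_left_mono) (auto simp: sp)
        moreover have "norm (g x * (V n x - U x)) \<le> \<bar>g x\<bar> * \<bar>V n x\<bar> + \<bar>g x * U x\<bar>"
          unfolding right_diff_distrib by (simp add: abs_triangle_ineq4 flip: abs_mult)
        ultimately show "norm (g x * (V n x - U x)) \<le> \<bar>g x\<bar> * M + \<bar>g x * U x\<bar>" by linarith
      qed
    qed measurable
    then show ?thesis by (rule LIMSEQ_le_const2) (use le[OF V] in blast)
  qed
qed

text \<open>Testing the inclusion with \<open>w = max (u (t - h)) (u t)\<close> and dividing by \<open>h\<close> gives
  \<open>\<integral> (f - u') (u')\<^sup>- \<le> 0\<close> in the limit.\<close>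
lemma derivative_nonneg:
  assumes g: "(\<lambda>x. F x - D x) \<in> L2_subdifferential \<sigma> (E_inf \<Omega>) (u t)"
    and F: "F \<in> L2_space \<sigma>" "AE x in \<sigma>. 0 \<le> F x" and ut: "u t \<in> L2_space \<sigma>"
    and D: "has_L2_derivative \<sigma> u D t"
    and X: "\<And>n::nat. 0 < X n" "X \<longlonglongrightarrow> 0"
    and uX: "\<And>n. u (t - X n) \<in> L2_space \<sigma>" "\<And>n. \<exists>w\<in>A_inf \<Omega>. AE x in \<sigma>. u (t - X n) x = w x"
  shows "AE x in \<sigma>. 0 \<le> D x"
proof -
  have DL: "D \<in> L2_space \<sigma>"
    and Dlim: "((\<lambda>h. L2_norm \<sigma> (\<lambda>x. (u (t + h) x - u t x) / h - D x)) \<longlongrightarrow> 0) (at 0)"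
    using D by (auto simp: has_L2_derivative_def)
  define G where "G x = F x - D x" for x
  have GL: "G \<in> L2_space \<sigma>" unfolding G_def by (rule L2_space_diff[OF F(1) DL])
  have [measurable]: "G \<in> borel_measurable \<sigma>" "F \<in> borel_measurable \<sigma>" "D \<in> borel_measurable \<sigma>"
    "u t \<in> borel_measurable \<sigma>" "u (t - X n) \<in> borel_measurable \<sigma>" for n
    using GL F(1) DL ut uX(1) by (auto dest: L2_spaceD)
  \<comment> \<open>The quotient of a backward step, without the sign of the increment, so q tends
    to -D and \<open>max 0 (q n x)\<close> to the negative part of D.\<close>
  define q where "q n x = (u (t - X n) x - u t x) / X n" for n x
  define r where "r n x = max 0 (q n x) - max 0 (- D x)" for n x
  obtain v where v: "v \<in> A_inf \<Omega>" "AE x in \<sigma>. u t x = v x"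
    using subdifferential_E_inf_imp(1)[OF g ut] by blast
  have neg: "(LINT x|\<sigma>. G x * max 0 (q n x)) \<le> 0" for n
  proof -
    obtain w where w: "w \<in> A_inf \<Omega>" "AE x in \<sigma>. u (t - X n) x = w x" using uX(2) by blast
    have adm: "(\<lambda>x. max (w x) (v x)) \<in> dual_admissible \<Omega>"
      using v(1) w(1) A_inf_subset_dual_admissible[OF \<Omega>] by (intro dual_admissible_max) auto
    have [measurable]: "v \<in> borel_measurable \<sigma>" "w \<in> borel_measurable \<sigma>"
      using v(1) w(1) unfolding \<sigma> A_inf_def by (auto intro: borel_measurable_surface_measure)
    have "(LINT x|\<sigma>. G x * (max (w x) (v x) - u t x)) = (LINT x|\<sigma>. X n * (G x * max 0 (q n x)))"
    proof (rule integral_cong_AE)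
      show "AE x in \<sigma>. G x * (max (w x) (v x) - u t x) = X n * (G x * max 0 (q n x))"
        using v(2) w(2)
      proof eventually_elim
        case (elim x)
        have "max (w x) (v x) - u t x = X n * max 0 (q n x)"
          using elim X(1)[of n] by (auto simp: q_def max_def field_simps)
        then show ?case by simp
      qed
    qed (simp_all add: q_def[abs_def])
    then have "X n * (LINT x|\<sigma>. G x * max 0 (q n x)) \<le> 0"
      using subdifferential_E_inf_imp(2)[OF g ut adm] by (simp add: G_def)
    then show ?thesis using X(1)[of n] by (simp add: mult_le_0_iff)
  qed
  \<comment> \<open>The error in the definition of the derivative for the increment
    \<open>- X n\<close>, which is allowed because the limit there is two-sided. It dominates r
    since taking the positive part is 1-Lipschitz.\<close>
  define E where "E n x = (u (t + - X n) x - u t x) / (- X n) - D x" for n x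
  have Eq: "E n x = - q n x - D x" for n x by (simp add: E_def q_def)
  have EL: "E n \<in> L2_space \<sigma>" for n
    unfolding E_def using uX(1)[of n] ut DL
      L2_space_diff[OF L2_space_cmult[OF L2_space_diff[OF uX(1)[of n] ut], of "- inverse (X n)"] DL]
    by (simp add: divide_inverse mult.commute)
  have Elim: "(\<lambda>n. L2_norm \<sigma> (E n)) \<longlonglongrightarrow> 0"
  proof -
    have "\<forall>i. - X i \<in> UNIV - {0}" using X(1) less_irrefl by (metis DiffI UNIV_I neg_equal_0_iff_equal singletonD)
    moreover have "(\<lambda>n. - X n) \<longlonglongrightarrow> 0" using tendsto_minus[OF X(2)] by simp
    ultimately show ?thesis
      using Dlim[unfolded tendsto_at_iff_sequentially, rule_format, of "\<lambda>n. - X n"]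
      by (simp add: o_def E_def[abs_def])
  qed
  have rE: "\<bar>r n x\<bar> \<le> \<bar>E n x\<bar>" for n x unfolding r_def Eq by linarith
  have rm: "r n \<in> borel_measurable \<sigma>" for n unfolding r_def[abs_def] q_def[abs_def] by measurable
  have rL: "r n \<in> L2_space \<sigma>" "L2_norm \<sigma> (r n) \<le> L2_norm \<sigma> (E n)" for n
    using L2_space_bound[OF rm EL rE] by auto
  have "(\<lambda>n. L2_norm \<sigma> (r n)) \<longlonglongrightarrow> 0"
    by (rule tendsto_sandwich[OF _ _ tendsto_const Elim]) (use rL(2) in \<open>auto simp: L2_norm_def\<close>)
  then have lim: "(\<lambda>n. LINT x|\<sigma>. G x * r n x) \<longlonglongrightarrow> 0"
    by (rule L2_norm_tendsto_0_imp_integral_tendsto_0[OF GL rL(1)])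
  define m where "m x = max 0 (- D x)" for x
  have mm[measurable]: "m \<in> borel_measurable \<sigma>" unfolding m_def[abs_def] by measurable
  have mL: "m \<in> L2_space \<sigma>"
    by (rule L2_space_bound(1)[OF mm DL]) (simp add: m_def)
  have int_m: "integrable \<sigma> (\<lambda>x. G x * m x)" by (rule L2_integrable_mult[OF GL mL])
  have "(LINT x|\<sigma>. G x * m x) \<le> 0"
  proof (rule LIMSEQ_le_const)
    show "(\<lambda>n. - (LINT x|\<sigma>. G x * r n x)) \<longlonglongrightarrow> 0" using tendsto_minus[OF lim] by simp
    have "(LINT x|\<sigma>. G x * m x) \<le> - (LINT x|\<sigma>. G x * r n x)" for n
    proof -
      have "(LINT x|\<sigma>. G x * m x) + (LINT x|\<sigma>. G x * r n x) = (LINT x|\<sigma>. G x * max 0 (q n x))"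
        using int_m L2_integrable_mult[OF GL rL(1)[of n]]
        by (subst Bochner_Integration.integral_add[symmetric])
          (auto simp: r_def m_def algebra_simps intro!: Bochner_Integration.integral_cong)
      then show ?thesis using neg[of n] by linarith
    qed
    then show "\<exists>N. \<forall>n\<ge>N. (LINT x|\<sigma>. G x * m x) \<le> - (LINT x|\<sigma>. G x * r n x)" by blast
  qed
  \<comment> \<open>Wherever m is nonzero it equals -D, so \<open>G x * m x\<close> is
    \<open>F x * m x\<close> plus the square of m. The nonnegativity of F enters here and forces m
    to vanish almost everywhere.\<close>
  moreover have Gm: "AE x in \<sigma>. (m x)\<^sup>2 \<le> G x * m x"
    using F(2)
  proof eventually_elim
    case (elim x)
    have "G x * m x - (m x)\<^sup>2 = F x * m x"
      by (auto simp: G_def m_def max_def power2_eq_square algebra_simps)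
    moreover have "0 \<le> F x * m x" using elim by (simp add: m_def)
    ultimately show ?case by linarith
  qed
  moreover have "(LINT x|\<sigma>. (m x)\<^sup>2) \<le> (LINT x|\<sigma>. G x * m x)"
    by (rule integral_mono_AE[OF L2_spaceD(2)[OF mL] int_m Gm])
  moreover have "0 \<le> (LINT x|\<sigma>. (m x)\<^sup>2)" by simp
  ultimately have "(LINT x|\<sigma>. (m x)\<^sup>2) = 0" by linarith
  then have "AE x in \<sigma>. (m x)\<^sup>2 = 0"
    using integral_nonneg_eq_0_iff_AE[OF L2_spaceD(2)[OF mL]] by simp
  then show ?thesis by eventually_elim (auto simp: m_def max_def split: if_splits)
qed

text \<open>The sign condition is what makes the density represent F, because \<open>ennreal\<close>
  sends negative values to 0.\<close>

lemma integral_density_of_square_integrable: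
  assumes F: "F \<in> L2_space \<sigma>" "AE x in \<sigma>. 0 \<le> F x" and w: "w \<in> borel_measurable \<sigma>"
  shows "(LINT x|density \<sigma> (\<lambda>x. ennreal (F x)). w x) = (LINT x|\<sigma>. F x * w x)"
    and "finite_measure (density \<sigma> (\<lambda>x. ennreal (F x)))"
    and "measure (density \<sigma> (\<lambda>x. ennreal (F x))) (space (density \<sigma> (\<lambda>x. ennreal (F x)))) = (LINT x|\<sigma>. F x)"
proof -
  have Fi: "integrable \<sigma> F" by (rule square_integrable_imp_integrable[OF L2_spaceD[OF F(1)]])
  have [measurable]: "F \<in> borel_measurable \<sigma>" using Fi by auto
  show "(LINT x|density \<sigma> (\<lambda>x. ennreal (F x)). w x) = (LINT x|\<sigma>. F x * w x)"
    using integral_density[OF w _ F(2)] by simp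
  have eq: "emeasure (density \<sigma> (\<lambda>x. ennreal (F x))) (space \<sigma>) = ennreal (LINT x|\<sigma>. F x)"
    using nn_integral_eq_integral[OF Fi F(2)] by (simp add: emeasure_density cong: nn_integral_cong)
  then show "finite_measure (density \<sigma> (\<lambda>x. ennreal (F x)))"
    by (intro finite_measureI) simp
  show "measure (density \<sigma> (\<lambda>x. ennreal (F x))) (space (density \<sigma> (\<lambda>x. ennreal (F x)))) = (LINT x|\<sigma>. F x)"
    using eq integral_nonneg_AE[OF F(2)] by (simp add: measure_def)
qed

text \<open>Admissibility is a pointwise condition, whereas U is determined only up to null sets.
  Hence the potential is a representative v of U taken from \<open>A_inf\<close>, and integrals of U
  are replaced by integrals of v.\<close>

lemma subdifferential_imp_kantorovich_potential:
  assumes g: "(\<lambda>x. F x - D x) \<in> L2_subdifferential \<sigma> (E_inf \<Omega>) U"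
    and F: "F \<in> L2_space \<sigma>" "AE x in \<sigma>. 0 \<le> F x"
    and D: "D \<in> L2_space \<sigma>" "AE x in \<sigma>. 0 \<le> D x" and U: "U \<in> L2_space \<sigma>"
  shows "is_maximum (LINT x|\<sigma>. U x * (F x - D x)) ((\<lambda>v. LINT x|\<sigma>. v x * (F x - D x)) ` dual_admissible \<Omega>)"
    and "\<exists>v. (AE x in \<sigma>. U x = v x) \<and>
      kantorovich_potential \<Omega> (density \<sigma> (\<lambda>x. ennreal (F x))) (density \<sigma> (\<lambda>x. ennreal (D x))) v"
proof -
  define G where "G x = F x - D x" for x
  have GL: "G \<in> L2_space \<sigma>" unfolding G_def by (rule L2_space_diff[OF F(1) D(1)])
  obtain v where "v \<in> A_inf \<Omega>" and Uv: "AE x in \<sigma>. U x = v x"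
    using subdifferential_E_inf_imp(1)[OF g U] by blast
  then have v: "v \<in> dual_admissible \<Omega>" using A_inf_subset_dual_admissible[OF \<Omega>] by blast
  have meas: "w \<in> borel_measurable \<sigma>" if "w \<in> dual_admissible \<Omega>" for w
    using L2_spaceD(1)[OF dual_admissible_in_L2_space[OF that]] .
  have UvG: "(LINT x|\<sigma>. U x * G x) = (LINT x|\<sigma>. v x * G x)"
  proof (rule integral_cong_AE)
    show "AE x in \<sigma>. U x * G x = v x * G x" using Uv by eventually_elim simp
  qed (use L2_spaceD(1)[OF U] L2_spaceD(1)[OF GL] meas[OF v] in auto)
  have le: "(LINT x|\<sigma>. w x * G x) \<le> (LINT x|\<sigma>. v x * G x)" if w: "w \<in> dual_admissible \<Omega>" for w
  proof -
    have "(LINT x|\<sigma>. w x * G x) - (LINT x|\<sigma>. U x * G x) = (LINT x|\<sigma>. G x * (w x - U x))"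
      using L2_integrable_mult[OF dual_admissible_in_L2_space[OF w] GL] L2_integrable_mult[OF U GL]
      by (subst Bochner_Integration.integral_diff[symmetric]) (auto simp: algebra_simps)
    then show ?thesis
      using subdifferential_E_inf_imp(2)[OF g U w] UvG by (simp add: G_def)
  qed
  show "is_maximum (LINT x|\<sigma>. U x * (F x - D x)) ((\<lambda>v. LINT x|\<sigma>. v x * (F x - D x)) ` dual_admissible \<Omega>)"
    using le v UvG by (auto simp: is_maximum_def G_def)
  have vG: "integrable \<sigma> (\<lambda>x. v x * G x)"
    by (rule L2_integrable_mult[OF dual_admissible_in_L2_space[OF v] GL])
  have Gi: "integrable \<sigma> G" by (rule square_integrable_imp_integrable[OF L2_spaceD[OF GL]])
  have "(LINT x|\<sigma>. (v x + c) * G x) = (LINT x|\<sigma>. v x * G x) + c * (LINT x|\<sigma>. G x)" for c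
    using vG Gi by (simp add: distrib_right)
  then have "c * (LINT x|\<sigma>. G x) \<le> 0" for c
    using le[OF dual_admissible_add_const[OF v, of c]] by simp
  from this[of 1] this[of "-1"] have G0: "(LINT x|\<sigma>. G x) = 0" by simp
  have Fi: "integrable \<sigma> F" by (rule square_integrable_imp_integrable[OF L2_spaceD[OF F(1)]])
  have Di: "integrable \<sigma> D" by (rule square_integrable_imp_integrable[OF L2_spaceD[OF D(1)]])
  have mass: "(LINT x|\<sigma>. F x) = (LINT x|\<sigma>. D x)"
    using G0 Fi Di by (simp add: G_def)
  note dF = integral_density_of_square_integrable[OF F] and dD = integral_density_of_square_integrable[OF D]
  have split: "(LINT x|density \<sigma> (\<lambda>x. ennreal (F x)). w x) - (LINT x|density \<sigma> (\<lambda>x. ennreal (D x)). w x)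
      = (LINT x|\<sigma>. w x * G x)" if w: "w \<in> dual_admissible \<Omega>" for w
  proof -
    have wL: "w \<in> L2_space \<sigma>" by (rule dual_admissible_in_L2_space[OF w])
    have "(LINT x|\<sigma>. F x * w x) - (LINT x|\<sigma>. D x * w x) = (LINT x|\<sigma>. w x * G x)"
      using L2_integrable_mult[OF F(1) wL] L2_integrable_mult[OF D(1) wL]
      by (subst Bochner_Integration.integral_diff[symmetric]) (auto simp: G_def algebra_simps)
    then show ?thesis by (simp only: dF(1)[OF meas[OF w]] dD(1)[OF meas[OF w]])
  qed
  have "kantorovich_potential \<Omega> (density \<sigma> (\<lambda>x. ennreal (F x))) (density \<sigma> (\<lambda>x. ennreal (D x))) v"
    unfolding kantorovich_potential_def
    using dF(2,3)[OF meas[OF v]] dD(2,3)[OF meas[OF v]] mass v le split by simp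
  then show "\<exists>v. (AE x in \<sigma>. U x = v x) \<and>
      kantorovich_potential \<Omega> (density \<sigma> (\<lambda>x. ennreal (F x))) (density \<sigma> (\<lambda>x. ennreal (D x))) v"
    using Uv by blast
qed

end

lemma AE_lebesgue_on_interval_dense:
  fixes a b T :: real
  assumes AE: "AE t in lebesgue_on {0<..<T}. P t" and "0 \<le> a" "a < b" "b \<le> T"
  obtains t where "t \<in> {a<..<b}" "P t"
proof -
  have "AE t in lebesgue. t \<in> {0<..<T} \<longrightarrow> P t"
    using AE by (subst (asm) AE_restrict_space_iff) auto
  then obtain N where N: "N \<in> null_sets lebesgue" "{t. \<not> (t \<in> {0<..<T} \<longrightarrow> P t)} \<subseteq> N"
    unfolding eventually_ae_filter by auto
  have "\<not> {a<..<b} \<subseteq> N"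
  proof
    assume "{a<..<b} \<subseteq> N"
    then have "emeasure lebesgue {a<..<b} \<le> emeasure lebesgue N"
      using N(1) by (intro emeasure_mono) auto
    then have "emeasure lebesgue {a<..<b} = 0" using N(1) by auto
    then show False using \<open>a < b\<close> by simp
  qed
  then obtain t where "t \<in> {a<..<b}" "t \<notin> N" by blast
  moreover from this assms(2,4) have "t \<in> {0<..<T}" by auto
  ultimately show thesis using that N(2) by blast
qed

text \<open>The integrand f - u' has the sign dictated by the inclusion, under which
  \<open>u t\<close> is the maximiser. With u' - f in its place the maximum would be attained at the
  negative of \<open>u t\<close>, because \<open>dual_admissible\<close> is symmetric.\<close>

theorem theorem1p3:
  fixes \<Omega> :: "'a::euclidean_space set" and T :: real
    and f u u' :: "real \<Rightarrow> 'a \<Rightarrow> real" and u\<^sub>0 :: "'a \<Rightarrow> real"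
  defines "\<sigma> \<equiv> surface_measure \<Omega>"
  assumes "smooth_bounded_domain \<Omega>" and "0 < T"
    and "u\<^sub>0 \<in> L2_closure \<sigma> (A_inf \<Omega>)"
    and "f \<in> L1_L2_space \<sigma> T"
    and "AE t in lebesgue_on {0<..<T}. AE x in \<sigma>. 0 \<le> f t x"
    and "evolution_solution \<Omega> T f u\<^sub>0 u u'"
  shows "AE t in lebesgue_on {0<..<T}.
     is_maximum (LINT x|\<sigma>. u t x * (f t x - u' t x))
       ((\<lambda>v. LINT x|\<sigma>. v x * (f t x - u' t x)) ` dual_admissible \<Omega>) \<and>
     (AE x in \<sigma>. 0 \<le> u' t x) \<and>
     (\<exists>v. (AE x in \<sigma>. u t x = v x) \<and>
        kantorovich_potential \<Omega> (density \<sigma> (\<lambda>x. ennreal (f t x)))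
          (density \<sigma> (\<lambda>x. ennreal (u' t x))) v)"
proof -
  have \<Omega>: "smooth_bounded_domain \<Omega>" by fact
  have \<sigma>: "\<sigma> = surface_measure \<Omega>" by (simp add: \<sigma>_def)
  have uL: "u t \<in> L2_space \<sigma>" if "t \<in> {0..T}" for t
    using assms(7) that by (auto simp: evolution_solution_def L2_continuous_on_def \<sigma>)
  have fL: "AE t in lebesgue_on {0<..<T}. f t \<in> L2_space \<sigma>"
    using assms(5) by (simp add: L1_L2_space_def)
  have sol: "AE t in lebesgue_on {0<..<T}. has_L2_derivative \<sigma> u (u' t) t \<and>
      (\<lambda>x. f t x - u' t x) \<in> L2_subdifferential \<sigma> (E_inf \<Omega>) (u t)"
    using assms(7) by (simp add: evolution_solution_def \<sigma>)
  have mem: "AE t in lebesgue_on {0<..<T}. t \<in> {0<..<T}"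
    by (rule AE_I2) simp
  have rep: "AE t in lebesgue_on {0<..<T}. \<exists>w\<in>A_inf \<Omega>. AE x in \<sigma>. u t x = w x"
    using sol mem
  proof eventually_elim
    case (elim t)
    then show ?case using subdifferential_E_inf_imp(1)[OF \<Omega> \<sigma>] uL by auto
  qed
  show ?thesis
    using sol fL assms(6) mem
  proof eventually_elim
    case (elim t)
    have t: "0 < t" "t < T" and ut: "u t \<in> L2_space \<sigma>" using elim(4) uL by auto
    have D: "has_L2_derivative \<sigma> u (u' t) t"
      and g: "(\<lambda>x. f t x - u' t x) \<in> L2_subdifferential \<sigma> (E_inf \<Omega>) (u t)" using elim(1) by auto
    have DL: "u' t \<in> L2_space \<sigma>" using D by (simp add: has_L2_derivative_def)
    \<comment> \<open>Membership in \<open>A_inf\<close> is known only for almost every time, so the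
      backward steps must end at good times, which are dense. The length t/(n + 1) shrinks to 0 and
      keeps the interval inside (0, T), also for n = 0.\<close>
    have "\<exists>s. s \<in> {t - t / real (Suc n)<..<t} \<and> (\<exists>w\<in>A_inf \<Omega>. AE x in \<sigma>. u s x = w x)" for n
    proof -
      have "t / real (Suc n) \<le> t" "0 < t / real (Suc n)" using t by (auto simp: field_simps)
      then have "0 \<le> t - t / real (Suc n)" "t - t / real (Suc n) < t" "t \<le> T" using t by linarith+
      from AE_lebesgue_on_interval_dense[OF rep this] show ?thesis by blast
    qed
    then obtain s where s: "\<And>n. s n \<in> {t - t / real (Suc n)<..<t}"
      and sw: "\<And>n. \<exists>w\<in>A_inf \<Omega>. AE x in \<sigma>. u (s n) x = w x"
      by metis
    have s0: "s n \<in> {0..T}" for n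
    proof -
      have "t / real (Suc n) \<le> t" using t by (auto simp: field_simps)
      then show ?thesis using s[of n] t by auto
    qed
    define X where "X n = t - s n" for n
    have "X \<longlonglongrightarrow> 0"
    proof (rule tendsto_sandwich[OF _ _ tendsto_const])
      show "\<forall>\<^sub>F n in sequentially. 0 \<le> X n" using s by (auto simp: X_def less_imp_le)
      show "\<forall>\<^sub>F n in sequentially. X n \<le> t * inverse (real (Suc n))"
        using s by (intro always_eventually allI) (simp add: X_def divide_inverse less_imp_le algebra_simps)
      show "(\<lambda>n. t * inverse (real (Suc n))) \<longlonglongrightarrow> 0"
        using tendsto_mult_right_zero[OF LIMSEQ_inverse_real_of_nat] by simp
    qed
    moreover have "0 < X n" for n using s[of n] by (simp add: X_def)
    moreover have "t - X n = s n" for n by (simp add: X_def)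
    ultimately have D0: "AE x in \<sigma>. 0 \<le> u' t x"
      using derivative_nonneg[OF \<Omega> \<sigma> g elim(2,3) ut D, of X] uL[OF s0] sw by simp
    show ?case
      using subdifferential_imp_kantorovich_potential[OF \<Omega> \<sigma> g elim(2,3) DL D0 ut] D0 by blast
  qed
qed

end
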